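(* Let $f\in L^2(\mathbb{R}^N)$ be arbitrary and let $\psi$ be a wavelet admissible function (with respect to $\boldsymbol\alpha,\lambda$). Suppose $$C_{\boldsymbol\alpha,\lambda}=(2\pi)^N\int_{\mathbb{R}^N_0}|(\mathfrak F_{\boldsymbol\alpha,\lambda}\psi)(\boldsymbol u)|^2\frac{d\boldsymbol u}{|\boldsymbol u|_m}\neq0.$$ Then the following reconstruction formula for $f$ holds: $$f(\boldsymbol t)=\frac{1}{C_{\boldsymbol\alpha,\lambda}}\int_{\mathbb{R}^N_0}\int_{\mathbb{R}^N}(W_\psi^{\boldsymbol\alpha,\lambda}f)(\boldsymbol a,\boldsymbol b)\,\boldsymbol\Psi_{\boldsymbol\alpha,\lambda,\boldsymbol a,\boldsymbol b}(\boldsymbol t)\,\frac{d\boldsymbol a\,d\boldsymbol b}{|\boldsymbol a|_m^2}.$$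
   Context: $N\ge1$ is an integer, $\lambda\in\mathbb{R}\setminus\{0\}$, $\boldsymbol\alpha=(\alpha_1,\dots,\alpha_N)$ with $\alpha_k\in(-\pi,\pi)\setminus\{0\}$. For $\boldsymbol x\in\mathbb{R}^N$, $|\boldsymbol x|_m=|x_1x_2\cdots x_N|$ and $\mathbb{R}^N_0=\{\boldsymbol x\in\mathbb{R}^N:|\boldsymbol x|_m\ne0\}$. Products and quotients of vectors are componentwise. Put $a(\alpha_k)=\tfrac12\cot\alpha_k$, $c(\alpha_k)=\sqrt{1-i\cot\alpha_k}$, $c(\boldsymbol\alpha_\lambda)=c(\alpha_1)c(\alpha_2)\cdots c(\alpha_N)$, $e_{\boldsymbol\alpha,\pm\lambda^2}(\boldsymbol x)=e^{\pm i\lambda^2\sum_{k=1}^N a(\alpha_k)x_k^2}$. The multidimensional fractional Fourier transform (MFrFT) of $f\in L^2(\mathbb{R}^N)$ is $(\mathfrak F_{\boldsymbol\alpha,\lambda}f)(\boldsymbol\xi)=\int_{\mathbb{R}^N}f(\boldsymbol x)K_{\boldsymbol\alpha,\lambda}(\boldsymbol x,\boldsymbol\xi)\,d\boldsymbol x$, with kernel $K_{\boldsymbol\alpha,\lambda}(\boldsymbol x,\boldsymbol\xi)=\frac{c(\boldsymbol\alpha_\lambda)}{(\sqrt{2\pi})^N}e_{\boldsymbol\alpha,\lambda^2}(\boldsymbol x)e_{\boldsymbol\alpha,\lambda^2}(\boldsymbol\xi)e^{-i\lambda^2\sum_{k=1}^N x_k\xi_k\csc\alpha_k}$. A wavelet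 admissible function (wavelet) is a non-zero $\psi\in L^2(\mathbb{R}^N)$ with $\int_{\mathbb{R}^N_0}|(\mathfrak F_{\boldsymbol\alpha,\lambda}\psi)(\boldsymbol u)|^2\frac{d\boldsymbol u}{|\boldsymbol u|_m}<\infty$. The multidimensional fractional wavelet transform (MFrWT) of $f\in L^2(\mathbb{R}^N)$ with respect to $\psi$ is, for $\boldsymbol a\in\mathbb{R}^N_0$, $\boldsymbol b\in\mathbb{R}^N$, $(W_\psi^{\boldsymbol\alpha,\lambda}f)(\boldsymbol a,\boldsymbol b)=\int_{\mathbb{R}^N}f(\boldsymbol t)\overline{\boldsymbol\Psi_{\boldsymbol\alpha,\lambda,\boldsymbol a,\boldsymbol b}(\boldsymbol t)}\,d\boldsymbol t$, where $\boldsymbol\Psi_{\boldsymbol\alpha,\lambda,\boldsymbol a,\boldsymbol b}(\boldsymbol t)=\overline{c(\boldsymbol\alpha_\lambda)}\,e_{\boldsymbol\alpha,\lambda^2}(\boldsymbol b)\,e_{\boldsymbol\alpha,-\lambda^2}(\boldsymbol t)\frac{1}{\sqrt{|\boldsymbol a|_m}}\tilde\psi\!\left(\frac{\boldsymbol t-\boldsymbol b}{\boldsymbol a}\right)$ and $\tilde\psi=\psi\,e_{\boldsymbol\alpha,\lambda^2}$. *)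

theory Defs
  imports "HOL-Analysis.Analysis"
begin

text \<open>
  The space $L^2(R^N)$, with \<^typ>\<open>'n\<close> as the index set of size $N$. Its elements are represented
  by functions; functions that agree almost everywhere represent the same element.
\<close>

definition square_integrable :: "('a::euclidean_space \<Rightarrow> complex) \<Rightarrow> bool" where
  "square_integrable f \<longleftrightarrow>
     f \<in> borel_measurable lebesgue \<and> integrable lebesgue (\<lambda>x. (norm (f x))\<^sup>2)"

definition l2_inner :: "('a::euclidean_space \<Rightarrow> complex) \<Rightarrow> ('a \<Rightarrow> complex) \<Rightarrow> complex" where
  "l2_inner f g = (LINT x|lebesgue. f x * cnj (g x))"

definition l2_tendsto :: "(nat \<Rightarrow> 'a::euclidean_space \<Rightarrow> complex) \<Rightarrow> ('a \<Rightarrow> complex) \<Rightarrow> bool" where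
  "l2_tendsto F f \<longleftrightarrow>
     (\<forall>n. square_integrable (F n)) \<and> square_integrable f \<and>
     (\<lambda>n. \<integral>\<^sup>+x. ennreal ((norm (F n x - f x))\<^sup>2) \<partial>lebesgue) \<longlonglongrightarrow> 0"

definition abs_m :: "real ^ 'n::finite \<Rightarrow> real" where
  "abs_m x = \<bar>\<Prod>k\<in>UNIV. x $ k\<bar>"

definition R0 :: "(real ^ 'n::finite) set" where
  "R0 = {x. abs_m x \<noteq> 0}"

definition vec_divide :: "real ^ 'n::finite \<Rightarrow> real ^ 'n \<Rightarrow> real ^ 'n" where
  "vec_divide x y = (\<chi> k. x $ k / y $ k)"

definition c_coef :: "real ^ 'n::finite \<Rightarrow> complex" where
  "c_coef \<alpha> = (\<Prod>k\<in>UNIV. csqrt (1 - \<i> * complex_of_real (cot (\<alpha> $ k))))"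

text \<open>\<open>chirp \<alpha> s\<close> is $e_{\alpha,s}$; it is used with $s = \lambda^2$ and $s = -\lambda^2$.\<close>

definition chirp :: "real ^ 'n::finite \<Rightarrow> real \<Rightarrow> real ^ 'n \<Rightarrow> complex" where
  "chirp \<alpha> s x =
     exp (\<i> * complex_of_real (s * (\<Sum>k\<in>UNIV. (1 / 2) * cot (\<alpha> $ k) * (x $ k)\<^sup>2)))"

definition mfrft_kernel ::
  "real ^ 'n::finite \<Rightarrow> real \<Rightarrow> real ^ 'n \<Rightarrow> real ^ 'n \<Rightarrow> complex" where
  "mfrft_kernel \<alpha> lam x \<xi> =
     c_coef \<alpha> / complex_of_real (sqrt (2 * pi) ^ CARD('n)) *
     chirp \<alpha> (lam\<^sup>2) x * chirp \<alpha> (lam\<^sup>2) \<xi> *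
     exp (- \<i> * complex_of_real (lam\<^sup>2 * (\<Sum>k\<in>UNIV. x $ k * \<xi> $ k * (1 / sin (\<alpha> $ k)))))"

text \<open>
  For a square-integrable function the integral defining the transform need not converge
  absolutely. As for the ordinary Fourier transform on $L^2$ (Plancherel), it is the limit in
  the $L^2$ norm of the transforms of the truncations to balls. This determines the transform up
  to a null set, and it agrees a.e. with the plain integral when the function is also integrable.
\<close>

definition mfrft_trunc ::
  "real ^ 'n::finite \<Rightarrow> real \<Rightarrow> (real ^ 'n \<Rightarrow> complex) \<Rightarrow> nat \<Rightarrow> real ^ 'n \<Rightarrow> complex" where
  "mfrft_trunc \<alpha> lam f n \<xi> =
     (LINT x:cball 0 (real n)|lebesgue. f x * mfrft_kernel \<alpha> lam x \<xi>)"

definition mfrft ::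
  "real ^ 'n::finite \<Rightarrow> real \<Rightarrow> (real ^ 'n \<Rightarrow> complex) \<Rightarrow> real ^ 'n \<Rightarrow> complex" where
  "mfrft \<alpha> lam f = (SOME g. l2_tendsto (mfrft_trunc \<alpha> lam f) g)"

definition wavelet_admissible ::
  "real ^ 'n::finite \<Rightarrow> real \<Rightarrow> (real ^ 'n \<Rightarrow> complex) \<Rightarrow> bool" where
  "wavelet_admissible \<alpha> lam \<psi> \<longleftrightarrow>
     square_integrable \<psi> \<and> \<not> (AE x in lebesgue. \<psi> x = 0) \<and>
     (\<integral>\<^sup>+u\<in>R0. ennreal ((norm (mfrft \<alpha> lam \<psi> u))\<^sup>2 / abs_m u) \<partial>lebesgue) < \<infinity>"

definition wavelet_const ::
  "real ^ 'n::finite \<Rightarrow> real \<Rightarrow> (real ^ 'n \<Rightarrow> complex) \<Rightarrow> real" where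
  "wavelet_const \<alpha> lam \<psi> =
     (2 * pi) ^ CARD('n) * (LINT u:R0|lebesgue. (norm (mfrft \<alpha> lam \<psi> u))\<^sup>2 / abs_m u)"

definition wavelet_atom ::
  "real ^ 'n::finite \<Rightarrow> real \<Rightarrow> (real ^ 'n \<Rightarrow> complex) \<Rightarrow> real ^ 'n \<Rightarrow> real ^ 'n \<Rightarrow> real ^ 'n \<Rightarrow> complex"
where
  "wavelet_atom \<alpha> lam \<psi> a b t =
     (let \<psi>' = (\<lambda>x. \<psi> x * chirp \<alpha> (lam\<^sup>2) x)
      in cnj (c_coef \<alpha>) * chirp \<alpha> (lam\<^sup>2) b * chirp \<alpha> (- (lam\<^sup>2)) t *
         complex_of_real (1 / sqrt (abs_m a)) * \<psi>' (vec_divide (t - b) a))"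

definition mfrwt ::
  "real ^ 'n::finite \<Rightarrow> real \<Rightarrow> (real ^ 'n \<Rightarrow> complex) \<Rightarrow> (real ^ 'n \<Rightarrow> complex) \<Rightarrow>
   real ^ 'n \<Rightarrow> real ^ 'n \<Rightarrow> complex" where
  "mfrwt \<alpha> lam \<psi> f a b = (LINT t|lebesgue. f t * cnj (wavelet_atom \<alpha> lam \<psi> a b t))"

text \<open>
  The measure $da\,db / |a|_m^2$. It gives no mass to the null set $|a|_m = 0$, which is outside
  the domain \<open>phase_space\<close> of the wavelet transform.
\<close>

definition phase_measure :: "((real ^ 'n::finite) \<times> (real ^ 'n)) measure" where
  "phase_measure = density lebesgue (\<lambda>(a, b). ennreal (1 / (abs_m a)\<^sup>2))"

definition phase_space :: "((real ^ 'n::finite) \<times> (real ^ 'n)) set" where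
  "phase_space = R0 \<times> UNIV"

text \<open>
  The integrand of the reconstruction formula at the point \<open>t\<close>, and the right-hand side of the
  formula with the integration restricted to a set \<open>K\<close> of parameters.
\<close>

definition recon_integrand ::
  "real ^ 'n::finite \<Rightarrow> real \<Rightarrow> (real ^ 'n \<Rightarrow> complex) \<Rightarrow> (real ^ 'n \<Rightarrow> complex) \<Rightarrow>
   real ^ 'n \<Rightarrow> (real ^ 'n) \<times> (real ^ 'n) \<Rightarrow> complex" where
  "recon_integrand \<alpha> lam \<psi> f t =
     (\<lambda>(a, b). mfrwt \<alpha> lam \<psi> f a b * wavelet_atom \<alpha> lam \<psi> a b t)"

definition recon ::
  "real ^ 'n::finite \<Rightarrow> real \<Rightarrow> (real ^ 'n \<Rightarrow> complex) \<Rightarrow> (real ^ 'n \<Rightarrow> complex) \<Rightarrow>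
   ((real ^ 'n) \<times> (real ^ 'n)) set \<Rightarrow> real ^ 'n \<Rightarrow> complex" where
  "recon \<alpha> lam \<psi> f K t =
     complex_of_real (1 / wavelet_const \<alpha> lam \<psi>) *
     (LINT p:K|phase_measure. recon_integrand \<alpha> lam \<psi> f t p)"

text \<open>
  The right-hand side of the reconstruction formula for a general square-integrable function is
  an integral with values in $L^2$; for fixed \<open>t\<close> it need not converge absolutely.
  \<open>recon_weak\<close> is the formula as a weak integral, i.e. after pairing with an arbitrary \<open>g\<close>.
  \<open>recon_norm\<close> is the formula as an improper integral converging in the $L^2$ norm, where the
  parts of finite measure that exhaust the domain are arbitrary.
  \<open>recon_ae\<close> is the formula as an ordinary integral at almost every \<open>t\<close> at which it converges
  absolutely.
\<close>

definition recon_weak ::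
  "real ^ 'n::finite \<Rightarrow> real \<Rightarrow> (real ^ 'n \<Rightarrow> complex) \<Rightarrow> (real ^ 'n \<Rightarrow> complex) \<Rightarrow> bool" where
  "recon_weak \<alpha> lam \<psi> f \<longleftrightarrow>
     (\<forall>g. square_integrable g \<longrightarrow>
        set_integrable phase_measure phase_space
          (\<lambda>(a, b). mfrwt \<alpha> lam \<psi> f a b * l2_inner (wavelet_atom \<alpha> lam \<psi> a b) g) \<and>
        l2_inner f g =
          complex_of_real (1 / wavelet_const \<alpha> lam \<psi>) *
          (LINT p:phase_space|phase_measure.
             (case p of (a, b) \<Rightarrow> mfrwt \<alpha> lam \<psi> f a b * l2_inner (wavelet_atom \<alpha> lam \<psi> a b) g)))"

definition recon_norm ::
  "real ^ 'n::finite \<Rightarrow> real \<Rightarrow> (real ^ 'n \<Rightarrow> complex) \<Rightarrow> (real ^ 'n \<Rightarrow> complex) \<Rightarrow> bool" where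
  "recon_norm \<alpha> lam \<psi> f \<longleftrightarrow>
     (\<forall>K. (\<forall>n. K n \<in> sets lebesgue \<and> emeasure phase_measure (K n) < \<infinity>) \<longrightarrow>
          incseq K \<longrightarrow> (\<Union>n. K n) = phase_space \<longrightarrow>
          (\<forall>n. AE t in lebesgue.
             set_integrable phase_measure (K n) (recon_integrand \<alpha> lam \<psi> f t)) \<and>
          l2_tendsto (\<lambda>n. recon \<alpha> lam \<psi> f (K n)) f)"

definition recon_ae ::
  "real ^ 'n::finite \<Rightarrow> real \<Rightarrow> (real ^ 'n \<Rightarrow> complex) \<Rightarrow> (real ^ 'n \<Rightarrow> complex) \<Rightarrow> bool" where
  "recon_ae \<alpha> lam \<psi> f \<longleftrightarrow>
     (AE t in lebesgue.
        set_integrable phase_measure phase_space (recon_integrand \<alpha> lam \<psi> f t) \<longrightarrow>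
        f t = recon \<alpha> lam \<psi> f phase_space t)"

end

theory Submission
  imports Defs "HOL-Probability.Characteristic_Functions"
begin

text \<open>
  Why the formula holds. Write \<open>F\<close> for the ordinary Fourier transform. Multiplying \<open>f\<close> and \<open>\<psi>\<close> by
  the chirp removes everything fractional from the problem: the fractional transform of \<open>\<psi>\<close> has,
  up to a constant, the modulus of \<open>F (\<psi> chirp)\<close> at the frequencies \<open>lam\<^sup>2 \<xi> / sin \<alpha>\<close>, and for fixed
  dilation \<open>a\<close> the wavelet transform of \<open>f\<close> is, up to a constant and a unimodular factor, the
  correlation of \<open>f chirp\<close> with the dilated function \<open>\<psi> chirp\<close>. Plancherel's theorem in \<open>b\<close> turns
  the square integral of this correlation into the integral of
  \<open>|F (f chirp) \<eta>|\<^sup>2 |F (\<psi> chirp) (a \<eta>)|\<^sup>2\<close>. The powers of \<open>|a|\<^sub>m\<close> combine to the measure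
  \<open>da / |a|\<^sub>m\<close>, which is invariant under componentwise dilations, so that the integral over \<open>a\<close> no
  longer depends on \<open>\<eta>\<close>. The same invariance absorbs \<open>lam\<^sup>2 / sin \<alpha>\<close> and identifies the value with
  the wavelet constant. Hence
    \<open>\<integral>\<integral> |W f (a, b)|\<^sup>2 da db / |a|\<^sub>m\<^sup>2 = C \<integral> |f|\<^sup>2\<close>     (lemma \<open>isometry\<close>),
  that is, the atoms form a tight frame with constant \<open>C\<close>.

  Everything else is a property of tight frames (locale \<open>tight_frame\<close>). Polarization gives the
  weak formula. The atoms have bounded norm, so the integral over a set \<open>K\<close> of finite measure
  converges absolutely at almost every point, and duality bounds the square of the norm of the
  difference between \<open>C f\<close> and this integral by \<open>C\<close> times the integral of \<open>|W f|\<^sup>2\<close> outside \<open>K\<close>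
  (lemma \<open>synth_error\<close>). This gives convergence in norm. Pointwise, a subsequence
  of the integrals over an exhaustion converges almost everywhere to \<open>f\<close>, and dominated convergence identifies its limit where the full integral converges
  absolutely.

  Plancherel's theorem is obtained for functions that are both integrable and square-integrable. The
  difference of the two sides, \<open>(2 pi)\<^sup>N \<integral> |f|\<^sup>2 - \<integral> |F f|\<^sup>2\<close>, is a quadratic form. A Gaussian weight on
  the frequency side, which becomes an approximate identity on the space side, shows that this form
  is nonnegative; it is bounded by the square norm of \<open>f\<close>, and it vanishes on indicators of open sets
  by Fatou's lemma. The parallelogram law spreads its vanishing to indicators of Borel sets, to simple
  functions and to all functions.

  The functions \<open>f\<close> and \<open>\<psi>\<close> are Borel measurable until the last step, which passes from Lebesgue
  measurable functions to Borel representatives.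
\<close>

section \<open>Square-integrable functions on a measure space\<close>

lemma cnj_measurable [measurable]: "cnj \<in> borel_measurable borel"
  by (intro borel_measurable_continuous_onI continuous_intros)

lemma norm_integral_le_nn: "ennreal (norm (integral\<^sup>L M f)) \<le> (\<integral>\<^sup>+x. ennreal (norm (f x)) \<partial>M)"
  for f :: "'a \<Rightarrow> complex"
  by (cases "integrable M f") (auto simp: not_integrable_integral_eq intro: integral_norm_bound_ennreal)

text \<open>
  These notions are needed on two kinds of measure spaces: the space of points \<open>t\<close> and the space of
  parameters \<open>(a, b)\<close>. They are therefore set up for an arbitrary measure. On \<open>lebesgue\<close> they
  specialize to \<^const>\<open>square_integrable\<close> and \<^const>\<open>l2_inner\<close>.
\<close>

definition L2 :: "'a measure \<Rightarrow> ('a \<Rightarrow> complex) set" where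
  "L2 M = {f \<in> borel_measurable M. integrable M (\<lambda>x. (cmod (f x))\<^sup>2)}"

definition normsq :: "'a measure \<Rightarrow> ('a \<Rightarrow> complex) \<Rightarrow> real" where
  "normsq M f = (\<integral>x. (cmod (f x))\<^sup>2 \<partial>M)"

definition ip :: "'a measure \<Rightarrow> ('a \<Rightarrow> complex) \<Rightarrow> ('a \<Rightarrow> complex) \<Rightarrow> complex" where
  "ip M f g = (\<integral>x. f x * cnj (g x) \<partial>M)"

lemma L2_measurable: "f \<in> L2 M \<Longrightarrow> f \<in> borel_measurable M"
  by (simp add: L2_def)

lemma L2_integrable: "f \<in> L2 M \<Longrightarrow> integrable M (\<lambda>x. (cmod (f x))\<^sup>2)"
  by (simp add: L2_def)

lemma L2_iff_nn:
  "f \<in> L2 M \<longleftrightarrow> f \<in> borel_measurable M \<and> (\<integral>\<^sup>+x. ennreal ((cmod (f x))\<^sup>2) \<partial>M) < \<infinity>"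
  by (auto simp: L2_def integrable_iff_bounded)

lemma normsq_nonneg [simp]: "0 \<le> normsq M f"
  by (simp add: normsq_def)

lemma nn_integral_eq_normsq:
  "f \<in> L2 M \<Longrightarrow> (\<integral>\<^sup>+x. ennreal ((cmod (f x))\<^sup>2) \<partial>M) = ennreal (normsq M f)"
  unfolding normsq_def by (intro nn_integral_eq_integral L2_integrable) auto

lemma L2I_nn:
  assumes "f \<in> borel_measurable M" "(\<integral>\<^sup>+x. ennreal ((cmod (f x))\<^sup>2) \<partial>M) \<le> ennreal c" "0 \<le> c"
  shows "f \<in> L2 M" "normsq M f \<le> c"
proof -
  show 1: "f \<in> L2 M"
    using assms by (auto simp: L2_iff_nn intro: le_less_trans)
  show "normsq M f \<le> c"
    using assms nn_integral_eq_normsq[OF 1] by simp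
qed

lemma L2_cong_AE:
  assumes "f \<in> L2 M" "g \<in> borel_measurable M" "AE x in M. f x = g x"
  shows "g \<in> L2 M" "normsq M g = normsq M f"
proof -
  have [measurable]: "f \<in> borel_measurable M" "g \<in> borel_measurable M"
    using assms by (auto simp: L2_def)
  show "g \<in> L2 M"
    unfolding L2_def using assms
    by (auto intro!: integrable_cong_AE_imp[OF L2_integrable[OF assms(1)]])
  show "normsq M g = normsq M f"
    unfolding normsq_def using assms by (intro integral_cong_AE) auto
qed

lemma norm_sq_add_le: "(cmod (a + b))\<^sup>2 \<le> 2 * (cmod a)\<^sup>2 + 2 * (cmod b)\<^sup>2"
proof -
  have "(cmod (a + b))\<^sup>2 \<le> (cmod a + cmod b)\<^sup>2"
    by (intro power_mono norm_triangle_ineq) auto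
  also have "\<dots> \<le> 2 * (cmod a)\<^sup>2 + 2 * (cmod b)\<^sup>2"
    using sum_squares_bound[of "cmod a" "cmod b"] by (simp add: power2_sum)
  finally show ?thesis .
qed

lemma L2_add: "f \<in> L2 M \<Longrightarrow> g \<in> L2 M \<Longrightarrow> (\<lambda>x. f x + g x) \<in> L2 M"
proof -
  assume fg: "f \<in> L2 M" "g \<in> L2 M"
  then have [measurable]: "f \<in> borel_measurable M" "g \<in> borel_measurable M"
    by (auto simp: L2_def)
  have "integrable M (\<lambda>x. 2 * (cmod (f x))\<^sup>2 + 2 * (cmod (g x))\<^sup>2)"
    using fg by (auto simp: L2_def)
  then have "integrable M (\<lambda>x. (cmod (f x + g x))\<^sup>2)"
    by (rule Bochner_Integration.integrable_bound) (auto simp: norm_sq_add_le)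
  then show ?thesis by (simp add: L2_def)
qed

lemma L2_cmult: "f \<in> L2 M \<Longrightarrow> (\<lambda>x. c * f x) \<in> L2 M"
  by (auto simp: L2_def norm_mult power_mult_distrib)

lemma L2_diff: "f \<in> L2 M \<Longrightarrow> g \<in> L2 M \<Longrightarrow> (\<lambda>x. f x - g x) \<in> L2 M"
  using L2_add[of f M "\<lambda>x. (-1) * g x"] L2_cmult[of g M "-1"] by simp

lemma L2_zero: "(\<lambda>x. 0) \<in> L2 M"
  by (simp add: L2_def)

lemma L2_bound:
  assumes "f \<in> L2 M" "g \<in> borel_measurable M" "\<And>x. x \<in> space M \<Longrightarrow> cmod (g x) \<le> c * cmod (f x)"
  shows "g \<in> L2 M" "normsq M g \<le> c\<^sup>2 * normsq M f"
proof -
  have *: "(cmod (g x))\<^sup>2 \<le> c\<^sup>2 * (cmod (f x))\<^sup>2" if "x \<in> space M" for x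
    using power_mono[OF assms(3)[OF that], of 2] by (simp add: power_mult_distrib)
  have i: "integrable M (\<lambda>x. c\<^sup>2 * (cmod (f x))\<^sup>2)"
    using assms(1) by (auto simp: L2_def)
  have j: "integrable M (\<lambda>x. (cmod (g x))\<^sup>2)"
    by (rule Bochner_Integration.integrable_bound[OF i]) (use assms(2) * in \<open>auto intro!: AE_I2\<close>)
  then show "g \<in> L2 M" using assms(2) by (simp add: L2_def)
  show "normsq M g \<le> c\<^sup>2 * normsq M f"
    using integral_mono[OF j i] * by (simp add: normsq_def)
qed

lemma L2_indicator_mult:
  assumes "f \<in> L2 M" "A \<in> sets M"
  shows "(\<lambda>x. indicator A x * f x) \<in> L2 M"
  using assms by (intro L2_bound(1)[OF assms(1), of _ 1]) (auto simp: L2_def norm_mult indicator_def)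

lemma L2_mult_integrable:
  assumes "f \<in> L2 M" "g \<in> L2 M"
  shows "integrable M (\<lambda>x. f x * g x)"
proof -
  have [measurable]: "f \<in> borel_measurable M" "g \<in> borel_measurable M"
    using assms by (auto simp: L2_def)
  have "integrable M (\<lambda>x. (cmod (f x))\<^sup>2 + (cmod (g x))\<^sup>2)"
    using assms by (auto simp: L2_def)
  then show ?thesis
  proof (rule Bochner_Integration.integrable_bound)
    have "cmod (f x * g x) \<le> (cmod (f x))\<^sup>2 + (cmod (g x))\<^sup>2" for x
    proof -
      have "2 * cmod (f x) * cmod (g x) \<le> (cmod (f x))\<^sup>2 + (cmod (g x))\<^sup>2"
        by (rule sum_squares_bound)
      moreover have "0 \<le> cmod (f x) * cmod (g x)" by simp
      ultimately have "cmod (f x) * cmod (g x) \<le> (cmod (f x))\<^sup>2 + (cmod (g x))\<^sup>2" by linarith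
      then show ?thesis by (simp add: norm_mult)
    qed
    then show "AE x in M. norm (f x * g x) \<le> norm ((cmod (f x))\<^sup>2 + (cmod (g x))\<^sup>2)"
      by simp
  qed simp
qed

lemma L2_cnj: "f \<in> L2 M \<Longrightarrow> (\<lambda>x. cnj (f x)) \<in> L2 M"
  by (auto simp: L2_def intro: measurable_compose[OF _ cnj_measurable])

lemma ip_integrable:
  assumes "f \<in> L2 M" "g \<in> L2 M"
  shows "integrable M (\<lambda>x. f x * cnj (g x))"
  by (intro L2_mult_integrable L2_cnj assms)

lemma L2_Cauchy_Schwarz_nn:
  assumes "f \<in> L2 M" "g \<in> L2 M"
  shows "(\<integral>x. cmod (f x) * cmod (g x) \<partial>M)\<^sup>2 \<le> normsq M f * normsq M g"
proof -
  have [measurable]: "f \<in> borel_measurable M" "g \<in> borel_measurable M"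
    using assms by (auto simp: L2_def)
  have i: "integrable M (\<lambda>x. cmod (f x) * cmod (g x))"
    using integrable_norm[OF L2_mult_integrable[OF assms]] by (simp add: norm_mult)
  have "(\<integral>\<^sup>+x. ennreal (cmod (f x)) * ennreal (cmod (g x)) \<partial>M)\<^sup>2
      \<le> (\<integral>\<^sup>+x. (ennreal (cmod (f x)))\<^sup>2 \<partial>M) * (\<integral>\<^sup>+x. (ennreal (cmod (g x)))\<^sup>2 \<partial>M)"
    by (rule Cauchy_Schwarz_nn_integral) auto
  also have "\<dots> = ennreal (normsq M f * normsq M g)"
    using assms by (simp add: ennreal_power nn_integral_eq_normsq ennreal_mult)
  also have "(\<integral>\<^sup>+x. ennreal (cmod (f x)) * ennreal (cmod (g x)) \<partial>M)
      = ennreal (\<integral>x. cmod (f x) * cmod (g x) \<partial>M)"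
    by (subst nn_integral_eq_integral[OF i, symmetric]) (auto simp: ennreal_mult)
  finally show ?thesis
    by (simp add: ennreal_power)
qed

lemma L2_Cauchy_Schwarz:
  assumes "f \<in> L2 M" "g \<in> L2 M"
  shows "(cmod (ip M f g))\<^sup>2 \<le> normsq M f * normsq M g"
proof -
  have "cmod (ip M f g) \<le> (\<integral>x. cmod (f x) * cmod (g x) \<partial>M)"
    unfolding ip_def using integral_norm_bound[of M "\<lambda>x. f x * cnj (g x)"] by (simp add: norm_mult)
  then have "(cmod (ip M f g))\<^sup>2 \<le> (\<integral>x. cmod (f x) * cmod (g x) \<partial>M)\<^sup>2"
    by (intro power_mono) auto
  then show ?thesis using L2_Cauchy_Schwarz_nn[OF assms] by linarith
qed

lemma ip_self: "f \<in> L2 M \<Longrightarrow> ip M f f = complex_of_real (normsq M f)"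
  unfolding ip_def normsq_def complex_norm_square[symmetric] by (rule integral_complex_of_real)

lemma ip_cnj: "cnj (ip M f g) = ip M g f"
  using Bochner_Integration.integral_cnj[of M "\<lambda>x. f x * cnj (g x)"] by (simp add: ip_def mult.commute)

lemma ip_add_left:
  "f \<in> L2 M \<Longrightarrow> g \<in> L2 M \<Longrightarrow> h \<in> L2 M \<Longrightarrow> ip M (\<lambda>x. f x + g x) h = ip M f h + ip M g h"
  unfolding ip_def by (simp add: distrib_right ip_integrable)

lemma ip_diff_left:
  "f \<in> L2 M \<Longrightarrow> g \<in> L2 M \<Longrightarrow> h \<in> L2 M \<Longrightarrow> ip M (\<lambda>x. f x - g x) h = ip M f h - ip M g h"
  unfolding ip_def by (simp add: left_diff_distrib ip_integrable)

lemma ip_cmult_left: "ip M (\<lambda>x. c * f x) h = c * ip M f h"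
  unfolding ip_def by (simp add: mult.assoc)

lemma norm_sq_add: "(cmod (a + b))\<^sup>2 = (cmod a)\<^sup>2 + (cmod b)\<^sup>2 + 2 * Re (a * cnj b)"
  unfolding cmod_power2 by (simp add: power2_eq_square algebra_simps)

lemma normsq_add:
  assumes "f \<in> L2 M" "g \<in> L2 M"
  shows "normsq M (\<lambda>x. f x + g x) = normsq M f + normsq M g + 2 * Re (ip M f g)"
proof -
  have i: "integrable M (\<lambda>x. Re (f x * cnj (g x)))"
    by (rule integrable_Re[OF ip_integrable[OF assms]])
  have "normsq M (\<lambda>x. f x + g x)
      = (\<integral>x. ((cmod (f x))\<^sup>2 + (cmod (g x))\<^sup>2) + 2 * Re (f x * cnj (g x)) \<partial>M)"
    unfolding normsq_def norm_sq_add ..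
  also have "\<dots> = normsq M f + normsq M g + 2 * (\<integral>x. Re (f x * cnj (g x)) \<partial>M)"
    unfolding normsq_def using L2_integrable[OF assms(1)] L2_integrable[OF assms(2)] i
    by (simp only: Bochner_Integration.integral_add Bochner_Integration.integrable_add integrable_mult_right integral_mult_right_zero)
  finally show ?thesis
    unfolding ip_def by (simp only: integral_Re[OF ip_integrable[OF assms]])
qed

lemma normsq_cmult: "normsq M (\<lambda>x. c * f x) = (cmod c)\<^sup>2 * normsq M f"
  by (simp add: normsq_def norm_mult power_mult_distrib)

lemma normsq_minus_commute: "normsq M (\<lambda>x. f x - g x) = normsq M (\<lambda>x. g x - f x)"
  by (simp add: normsq_def norm_minus_commute)

lemma normsq_parallelogram:
  assumes "f \<in> L2 M" "g \<in> L2 M"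
  shows "normsq M (\<lambda>x. f x + g x) + normsq M (\<lambda>x. f x - g x) = 2 * normsq M f + 2 * normsq M g"
proof -
  have "normsq M (\<lambda>x. f x + (-1) * g x) = normsq M f + normsq M g + 2 * Re (ip M f (\<lambda>x. (-1) * g x))"
    using assms normsq_cmult[of M "-1" g] L2_cmult[of g M "-1"] by (subst normsq_add) auto
  moreover have "ip M f (\<lambda>x. (-1) * g x) = - ip M f g"
    by (simp add: ip_def)
  ultimately show ?thesis
    using normsq_add[OF assms] by simp
qed

lemma normsq_add_le:
  assumes "f \<in> L2 M" "g \<in> L2 M"
  shows "normsq M (\<lambda>x. f x + g x) \<le> 2 * normsq M f + 2 * normsq M g"
  using normsq_parallelogram[OF assms] normsq_nonneg[of M "\<lambda>x. f x - g x"] by linarith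

lemma normsq_tendsto:
  assumes u: "\<And>n. u n \<in> L2 M" and v: "v \<in> L2 M"
    and lim: "(\<lambda>n. normsq M (\<lambda>x. u n x - v x)) \<longlonglongrightarrow> 0"
  shows "(\<lambda>n. normsq M (u n)) \<longlonglongrightarrow> normsq M v"
proof -
  have eq: "normsq M (u n) = normsq M (\<lambda>x. u n x - v x) + normsq M v + 2 * Re (ip M (\<lambda>x. u n x - v x) v)" for n
    using normsq_add[OF L2_diff[OF u v] v, of n] by simp
  have "(\<lambda>n. ip M (\<lambda>x. u n x - v x) v) \<longlonglongrightarrow> 0"
  proof (rule Lim_null_comparison)
    show "\<forall>\<^sub>F n in sequentially. cmod (ip M (\<lambda>x. u n x - v x) v)
        \<le> sqrt (normsq M (\<lambda>x. u n x - v x) * normsq M v)"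
      by (intro always_eventually allI real_le_rsqrt L2_Cauchy_Schwarz L2_diff u v)
    show "(\<lambda>n. sqrt (normsq M (\<lambda>x. u n x - v x) * normsq M v)) \<longlonglongrightarrow> 0"
      using tendsto_real_sqrt[OF tendsto_mult_left_zero[OF lim, of "normsq M v"]] by simp
  qed
  then have "(\<lambda>n. normsq M (\<lambda>x. u n x - v x) + normsq M v + 2 * Re (ip M (\<lambda>x. u n x - v x) v))
      \<longlonglongrightarrow> 0 + normsq M v + 2 * Re 0"
    by (intro tendsto_intros lim)
  then show ?thesis by (simp add: eq[abs_def])
qed

lemma L2_AE_subseq:
  assumes u: "\<And>n. u n \<in> L2 M" and v: "v \<in> L2 M"
    and lim: "(\<lambda>n. normsq M (\<lambda>x. u n x - v x)) \<longlonglongrightarrow> 0"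
  obtains r :: "nat \<Rightarrow> nat" where "strict_mono r" "AE x in M. (\<lambda>n. u (r n) x) \<longlonglongrightarrow> v x"
proof -
  have "\<exists>r::nat\<Rightarrow>nat. strict_mono r \<and> (AE x in M. (\<lambda>n. (cmod (u (r n) x - v x))\<^sup>2) \<longlonglongrightarrow> 0)"
    using lim L2_integrable[OF L2_diff[OF u v]]
    by (intro tendsto_L1_AE_subseq) (auto simp: normsq_def)
  then obtain r :: "nat \<Rightarrow> nat" where r: "strict_mono r"
    and ae: "AE x in M. (\<lambda>n. (cmod (u (r n) x - v x))\<^sup>2) \<longlonglongrightarrow> 0" by auto
  have "(\<lambda>n. u (r n) x) \<longlonglongrightarrow> v x" if "(\<lambda>n. (cmod (u (r n) x - v x))\<^sup>2) \<longlonglongrightarrow> 0" for x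
  proof -
    have "(\<lambda>n. cmod (u (r n) x - v x)) \<longlonglongrightarrow> 0"
      using tendsto_real_sqrt[OF that] by simp
    then show ?thesis
      by (simp add: tendsto_norm_zero_iff LIM_zero_iff)
  qed
  with ae have "AE x in M. (\<lambda>n. u (r n) x) \<longlonglongrightarrow> v x"
    by (auto elim!: eventually_mono)
  then show thesis using r that by blast
qed

definition L2_Cauchy :: "'a measure \<Rightarrow> (nat \<Rightarrow> 'a \<Rightarrow> complex) \<Rightarrow> bool" where
  "L2_Cauchy M u \<longleftrightarrow> (\<forall>n. u n \<in> L2 M) \<and>
     (\<forall>e>0. \<exists>N. \<forall>m\<ge>N. \<forall>n\<ge>N. normsq M (\<lambda>x. u m x - u n x) < e)"

text \<open>
  Fatou's lemma: a Cauchy sequence with an almost everywhere convergent subsequence converges in norm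
  to the pointwise limit. This is the tool by which an identity between norms is carried from
  truncated functions to general ones.
\<close>

lemma L2_Cauchy_limit:
  assumes "L2_Cauchy M u" and [measurable]: "v \<in> borel_measurable M"
    and r: "strict_mono r" and ae: "AE x in M. (\<lambda>n. u (r n) x) \<longlonglongrightarrow> v x"
  shows "v \<in> L2 M" "(\<lambda>n. normsq M (\<lambda>x. u n x - v x)) \<longlonglongrightarrow> 0"
proof -
  have u: "u n \<in> L2 M" for n using assms(1) by (simp add: L2_Cauchy_def)
  then have [measurable]: "u n \<in> borel_measurable M" for n by (simp add: L2_def)
  have *: "\<exists>N. \<forall>m\<ge>N. (\<lambda>x. u m x - v x) \<in> L2 M \<and> normsq M (\<lambda>x. u m x - v x) \<le> e" if "e > 0" for e
  proof -
    obtain N where N: "normsq M (\<lambda>x. u m x - u n x) < e" if "m \<ge> N" "n \<ge> N" for m n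
      using assms(1) \<open>e > 0\<close> unfolding L2_Cauchy_def by blast
    have "(\<integral>\<^sup>+x. ennreal ((cmod (u m x - v x))\<^sup>2) \<partial>M) \<le> ennreal e" if "m \<ge> N" for m
    proof -
      have "(\<integral>\<^sup>+x. ennreal ((cmod (u m x - v x))\<^sup>2) \<partial>M)
          = (\<integral>\<^sup>+x. liminf (\<lambda>n. ennreal ((cmod (u m x - u (r n) x))\<^sup>2)) \<partial>M)"
      proof (rule nn_integral_cong_AE, use ae in eventually_elim)
        fix x assume "(\<lambda>n. u (r n) x) \<longlonglongrightarrow> v x"
        then have "(\<lambda>n. ennreal ((cmod (u m x - u (r n) x))\<^sup>2)) \<longlonglongrightarrow> ennreal ((cmod (u m x - v x))\<^sup>2)"
          by (intro tendsto_intros tendsto_ennrealI)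
        then show "ennreal ((cmod (u m x - v x))\<^sup>2) = liminf (\<lambda>n. ennreal ((cmod (u m x - u (r n) x))\<^sup>2))"
          by (intro lim_imp_Liminf[symmetric]) auto
      qed
      also have "\<dots> \<le> liminf (\<lambda>n. \<integral>\<^sup>+x. ennreal ((cmod (u m x - u (r n) x))\<^sup>2) \<partial>M)"
        by (rule nn_integral_liminf) simp
      also have "\<dots> \<le> ennreal e"
      proof (rule Liminf_le)
        show "\<forall>\<^sub>F n in sequentially. (\<integral>\<^sup>+x. ennreal ((cmod (u m x - u (r n) x))\<^sup>2) \<partial>M) \<le> ennreal e"
          using eventually_ge_at_top[of N]
        proof eventually_elim
          case (elim n)
          have "r n \<ge> N" using seq_suble[OF r, of n] elim by linarith
          then show ?case
            using N[OF \<open>m \<ge> N\<close>, of "r n"] u by (simp add: nn_integral_eq_normsq L2_diff ennreal_leI)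
        qed
      qed simp
      finally show ?thesis .
    qed
    then show ?thesis using L2I_nn[of "\<lambda>x. u _ x - v x" M e] \<open>e > 0\<close> by (intro exI[of _ N]) auto
  qed
  obtain m where "(\<lambda>x. u m x - v x) \<in> L2 M" using *[of 1] by auto
  from L2_diff[OF u this, of m] show "v \<in> L2 M" by simp
  show "(\<lambda>n. normsq M (\<lambda>x. u n x - v x)) \<longlonglongrightarrow> 0"
  proof (rule LIMSEQ_I)
    fix e :: real assume "e > 0"
    then obtain N where "normsq M (\<lambda>x. u m x - v x) \<le> e / 2" if "m \<ge> N" for m
      using *[of "e/2"] by auto
    then show "\<exists>N. \<forall>n\<ge>N. norm (normsq M (\<lambda>x. u n x - v x) - 0) < e"
      using \<open>e > 0\<close> by (intro exI[of _ N]) force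
  qed
qed

text \<open>
  Completeness of $L^2$. A strictly positive square-integrable weight turns the Cauchy sequence into a
  Cauchy sequence in $L^1$, which has an almost everywhere convergent subsequence; dividing by the
  weight and applying \<open>L2_Cauchy_limit\<close> finishes the argument.
\<close>

lemma (in sigma_finite_measure) L2_complete:
  assumes c: "L2_Cauchy M u"
  obtains v where "v \<in> L2 M" "(\<lambda>n. normsq M (\<lambda>x. u n x - v x)) \<longlonglongrightarrow> 0"
proof -
  have u: "u n \<in> L2 M" for n using c by (simp add: L2_Cauchy_def)
  then have [measurable]: "u n \<in> borel_measurable M" for n by (simp add: L2_def)
  obtain h where h[measurable]: "h \<in> borel_measurable M" and hi: "integral\<^sup>N M h \<noteq> \<infinity>"
    and hp: "\<And>x. x \<in> space M \<Longrightarrow> 0 < h x \<and> h x < \<infinity>"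
    using Ex_finite_integrable_function by blast
  \<comment> \<open>The square of the weight is the everywhere positive integrable function that a sigma-finite measure admits.\<close>
  define w where "w x = complex_of_real (sqrt (enn2real (h x)))" for x
  have [measurable]: "w \<in> borel_measurable M" unfolding w_def by simp
  have wsq: "ennreal ((cmod (w x))\<^sup>2) = h x" if "x \<in> space M" for x
    using hp[OF that] by (simp add: w_def)
  have "(\<integral>\<^sup>+x. ennreal ((cmod (w x))\<^sup>2) \<partial>M) = integral\<^sup>N M h"
    by (intro nn_integral_cong wsq)
  then have w: "w \<in> L2 M" using hi by (simp add: L2_iff_nn less_top)
  have w0: "w x \<noteq> 0" if "x \<in> space M" for x
    using hp[OF that] by (auto simp: w_def enn2real_eq_0_iff)
  obtain r :: "nat \<Rightarrow> nat" where r: "strict_mono r" and ae: "AE x in M. Cauchy (\<lambda>n. u (r n) x * w x)"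
  proof (rule cauchy_L1_AE_cauchy_subseq[of M "\<lambda>n x. u n x * w x"])
    show "integrable M (\<lambda>x. u n x * w x)" for n by (intro L2_mult_integrable u w)
    fix e :: real assume e: "e > 0"
    have "0 < e\<^sup>2 / (normsq M w + 1)"
      using e by (intro divide_pos_pos) (auto simp: add_nonneg_pos)
    then obtain N where N: "normsq M (\<lambda>x. u m x - u n x) < e\<^sup>2 / (normsq M w + 1)" if "m \<ge> N" "n \<ge> N" for m n
      using c unfolding L2_Cauchy_def by blast
    have "(\<integral>x. cmod (u m x * w x - u n x * w x) \<partial>M) < e" if "m \<ge> N" "n \<ge> N" for m n
    proof -
      have pos: "normsq M w + 1 > 0" using normsq_nonneg[of M w] by linarith
      have "(\<integral>x. cmod (u m x - u n x) * cmod (w x) \<partial>M)\<^sup>2 \<le> normsq M (\<lambda>x. u m x - u n x) * normsq M w"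
        by (intro L2_Cauchy_Schwarz_nn L2_diff u w)
      also have "\<dots> \<le> normsq M (\<lambda>x. u m x - u n x) * (normsq M w + 1)"
        by (intro mult_left_mono) auto
      also have "\<dots> < e\<^sup>2"
        using N[OF that] pos by (simp add: field_simps)
      finally have "(\<integral>x. cmod (u m x - u n x) * cmod (w x) \<partial>M) < e"
        by (rule power2_less_imp_less) (use e in simp)
      then show ?thesis by (simp add: left_diff_distrib[symmetric] norm_mult)
    qed
    then show "\<exists>N. \<forall>i\<ge>N. \<forall>j\<ge>N. (\<integral>x. cmod (u i x * w x - u j x * w x) \<partial>M) < e" by blast
  qed auto
  define v where "v x = lim (\<lambda>n. u (r n) x)" for x
  have [measurable]: "v \<in> borel_measurable M" unfolding v_def by simp
  have "AE x in M. (\<lambda>n. u (r n) x) \<longlonglongrightarrow> v x"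
    using ae AE_space
  proof eventually_elim
    fix x assume "Cauchy (\<lambda>n. u (r n) x * w x)" "x \<in> space M"
    then have "convergent (\<lambda>n. u (r n) x * w x * (1 / w x))"
      by - (rule convergent_mult[OF _ convergent_const], simp add: Cauchy_convergent_iff)
    moreover have "(\<lambda>n. u (r n) x * w x * (1 / w x)) = (\<lambda>n. u (r n) x)"
      using w0[OF \<open>x \<in> space M\<close>] by simp
    ultimately have "convergent (\<lambda>n. u (r n) x)" by (simp only:)
    then show "(\<lambda>n. u (r n) x) \<longlonglongrightarrow> v x"
      by (simp add: v_def convergent_LIMSEQ_iff)
  qed
  from L2_Cauchy_limit[OF c _ r this] that show thesis by simp
qed

lemma L2_tendsto_Cauchy:
  assumes u: "\<And>n. u n \<in> L2 M" and v: "v \<in> L2 M"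
    and lim: "(\<lambda>n. normsq M (\<lambda>x. u n x - v x)) \<longlonglongrightarrow> 0"
  shows "L2_Cauchy M u"
  unfolding L2_Cauchy_def
proof (intro conjI allI impI u)
  fix e :: real assume "e > 0"
  then obtain N where N: "normsq M (\<lambda>x. u n x - v x) < e / 4" if "n \<ge> N" for n
    using LIMSEQ_D[OF lim, of "e/4"] by auto
  have "normsq M (\<lambda>x. u m x - u n x) < e" if "m \<ge> N" "n \<ge> N" for m n
  proof -
    have "normsq M (\<lambda>x. (u m x - v x) + (v x - u n x)) \<le> 2 * normsq M (\<lambda>x. u m x - v x) + 2 * normsq M (\<lambda>x. v x - u n x)"
      by (intro normsq_add_le L2_diff u v)
    then show ?thesis
      using N[OF that(1)] N[OF that(2)] by (simp add: normsq_minus_commute[of M v])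
  qed
  then show "\<exists>N. \<forall>m\<ge>N. \<forall>n\<ge>N. normsq M (\<lambda>x. u m x - u n x) < e" by blast
qed

lemma normsq_eq_0_AE:
  assumes "f \<in> L2 M" "normsq M f = 0"
  shows "AE x in M. f x = 0"
  using assms integral_nonneg_eq_0_iff_AE[OF L2_integrable[OF assms(1)]] by (simp add: normsq_def)

lemma L2_lim_unique:
  assumes u: "\<And>n. u n \<in> L2 M" and v: "v \<in> L2 M" and w: "w \<in> L2 M"
    and "(\<lambda>n. normsq M (\<lambda>x. u n x - v x)) \<longlonglongrightarrow> 0" "(\<lambda>n. normsq M (\<lambda>x. u n x - w x)) \<longlonglongrightarrow> 0"
  shows "AE x in M. v x = w x"
proof -
  have "(\<lambda>n. 2 * normsq M (\<lambda>x. u n x - v x) + 2 * normsq M (\<lambda>x. u n x - w x)) \<longlonglongrightarrow> 2 * 0 + 2 * 0"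
    by (intro tendsto_intros assms)
  moreover have "normsq M (\<lambda>x. v x - w x) \<le> 2 * normsq M (\<lambda>x. u n x - v x) + 2 * normsq M (\<lambda>x. u n x - w x)" for n
    using normsq_add_le[OF L2_diff[OF v u] L2_diff[OF u w], of n n] by (simp add: normsq_minus_commute[of M v "u n"])
  ultimately have "normsq M (\<lambda>x. v x - w x) \<le> 2 * 0 + 2 * 0"
    by (intro LIMSEQ_le_const) blast+
  then have "normsq M (\<lambda>x. v x - w x) = 0" using normsq_nonneg[of M "\<lambda>x. v x - w x"] by linarith
  from normsq_eq_0_AE[OF L2_diff[OF v w] this] show ?thesis by simp
qed

lemma L2_same_modulus:
  assumes "f \<in> L2 M" "g \<in> borel_measurable M" "\<And>x. x \<in> space M \<Longrightarrow> cmod (g x) = cmod (f x)"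
  shows "g \<in> L2 M" "normsq M g = normsq M f"
proof -
  show "g \<in> L2 M"
    using assms by (intro L2_bound(1)[OF assms(1), of g 1]) auto
  show "normsq M g = normsq M f"
    unfolding normsq_def by (intro Bochner_Integration.integral_cong) (auto simp: assms)
qed

section \<open>Reconstruction from a tight continuous frame\<close>

text \<open>
  The atoms \<open>\<phi> p\<close> form a tight frame with constant \<open>C\<close>: the analysis map \<open>f \<mapsto> (\<lambda>p. \<langle>f, \<phi> p\<rangle>)\<close> is
  \<open>sqrt C\<close> times an isometry. The uniform bound \<open>B\<close> makes partial synthesis over parameter sets of
  finite measure absolutely convergent.
\<close>

locale tight_frame = pair_sigma_finite P M
  for P :: "'p measure" and M :: "'a measure" +
  fixes \<phi> :: "'p \<Rightarrow> 'a \<Rightarrow> complex" and B C :: real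
  assumes atom_measurable [measurable]: "case_prod \<phi> \<in> borel_measurable (P \<Otimes>\<^sub>M M)"
    and atom_L2: "\<And>p. \<phi> p \<in> L2 M" and atom_bound: "\<And>p. normsq M (\<phi> p) \<le> B"
    and C_pos: "0 < C"
    and analysis_L2: "\<And>f. f \<in> L2 M \<Longrightarrow> (\<lambda>p. ip M f (\<phi> p)) \<in> L2 P"
    and analysis_normsq: "\<And>f. f \<in> L2 M \<Longrightarrow> normsq P (\<lambda>p. ip M f (\<phi> p)) = C * normsq M f"
begin

abbreviation V :: "('a \<Rightarrow> complex) \<Rightarrow> 'p \<Rightarrow> complex" where
  "V f p \<equiv> ip M f (\<phi> p)"

definition synth :: "('a \<Rightarrow> complex) \<Rightarrow> 'p set \<Rightarrow> 'a \<Rightarrow> complex" where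
  "synth f K t = (\<integral>p. indicator K p * (V f p * \<phi> p t) \<partial>P)"

lemma B_nonneg: "0 \<le> B"
  using normsq_nonneg atom_bound order_trans by blast

lemma Re_polarization:
  assumes "f \<in> L2 M" "g \<in> L2 M"
  shows "Re (ip P (V f) (V g)) = C * Re (ip M f g)"
proof -
  have "V (\<lambda>x. f x + g x) p = V f p + V g p" for p
    by (intro ip_add_left assms atom_L2)
  then have "normsq P (\<lambda>p. V f p + V g p) = C * normsq M (\<lambda>x. f x + g x)"
    using analysis_normsq[OF L2_add[OF assms]] by simp
  moreover note normsq_add[OF analysis_L2 analysis_L2, OF assms] normsq_add[OF assms]
    analysis_normsq[OF assms(1)] analysis_normsq[OF assms(2)]
  ultimately have "2 * Re (ip P (V f) (V g)) = 2 * (C * Re (ip M f g))"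
    by (simp add: algebra_simps)
  then show ?thesis by simp
qed

text \<open>
  The isometry determines the real part of inner products; the imaginary part is the real part for
  \<open>\<i> f\<close>.
\<close>

lemma polarization:
  assumes "f \<in> L2 M" "g \<in> L2 M"
  shows "ip P (V f) (V g) = C * ip M f g"
proof (rule complex_eqI)
  show "Re (ip P (V f) (V g)) = Re (C * ip M f g)"
    using Re_polarization[OF assms] by simp
  have "ip P (V (\<lambda>x. \<i> * f x)) (V g) = \<i> * ip P (V f) (V g)"
    by (simp add: ip_cmult_left)
  then show "Im (ip P (V f) (V g)) = Im (C * ip M f g)"
    using Re_polarization[OF L2_cmult[OF assms(1)] assms(2), of \<i>] by (simp add: ip_cmult_left)
qed

lemma weak_reconstruction:
  assumes "f \<in> L2 M" "g \<in> L2 M"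
  shows "integrable P (\<lambda>p. V f p * ip M (\<phi> p) g)"
    and "(\<integral>p. V f p * ip M (\<phi> p) g \<partial>P) = C * ip M f g"
  using ip_integrable[OF analysis_L2[OF assms(1)] analysis_L2[OF assms(2)]] polarization[OF assms]
  by (simp_all only: ip_cnj) (simp add: ip_def[of P] ip_cnj)

context
  fixes f K
  assumes f: "f \<in> L2 M" and K: "K \<in> sets P" and fin: "emeasure P K < \<infinity>"
begin

text \<open>
  The value, possibly infinite, of the integral of the modulus of the integrand of \<^const>\<open>synth\<close>. All
  integrability statements about \<^const>\<open>synth\<close> follow from its square-integrability.
\<close>

definition majorant :: "'a \<Rightarrow> ennreal" where
  "majorant t = (\<integral>\<^sup>+p. indicator K p * (ennreal (cmod (V f p)) * ennreal (cmod (\<phi> p t))) \<partial>P)"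

lemma V_measurable [measurable]: "V f \<in> borel_measurable P"
  using analysis_L2[OF f] by (rule L2_measurable)

lemma K_measurable [measurable]: "K \<in> sets P" by (fact K)

lemma majorant_measurable [measurable]: "majorant \<in> borel_measurable M"
  unfolding majorant_def by measurable

text \<open>
  By the Cauchy-Schwarz inequality in \<open>p\<close>, the square at \<open>t\<close> is at most \<open>\<integral> |V f|\<^sup>2\<close> times the integral
  of \<open>|\<phi> p t|\<^sup>2\<close> over \<open>K\<close>. Integrated in \<open>t\<close> first, the last factor is at most \<open>B\<close> times the measure
  of \<open>K\<close>.
\<close>

lemma majorant_sq: "(\<integral>\<^sup>+t. (majorant t)\<^sup>2 \<partial>M) \<le> ennreal (C * normsq M f * (B * measure P K))"
proof -
  have "(majorant t)\<^sup>2 \<le> ennreal (C * normsq M f) * (\<integral>\<^sup>+p. indicator K p * ennreal ((cmod (\<phi> p t))\<^sup>2) \<partial>P)"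
    if [measurable]: "t \<in> space M" for t
  proof -
    have "(majorant t)\<^sup>2 = (\<integral>\<^sup>+p. ennreal (cmod (V f p)) * (indicator K p * ennreal (cmod (\<phi> p t))) \<partial>P)\<^sup>2"
      unfolding majorant_def by (simp add: ac_simps)
    also have "\<dots> \<le> (\<integral>\<^sup>+p. (ennreal (cmod (V f p)))\<^sup>2 \<partial>P)
        * (\<integral>\<^sup>+p. (indicator K p * ennreal (cmod (\<phi> p t)))\<^sup>2 \<partial>P)"
      by (rule Cauchy_Schwarz_nn_integral) measurable
    also have "(\<integral>\<^sup>+p. (ennreal (cmod (V f p)))\<^sup>2 \<partial>P) = ennreal (C * normsq M f)"
      using nn_integral_eq_normsq[OF analysis_L2[OF f]] analysis_normsq[OF f] by (simp add: ennreal_power)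
    also have "(\<integral>\<^sup>+p. (indicator K p * ennreal (cmod (\<phi> p t)))\<^sup>2 \<partial>P)
        = (\<integral>\<^sup>+p. indicator K p * ennreal ((cmod (\<phi> p t))\<^sup>2) \<partial>P)"
      by (intro nn_integral_cong) (auto simp: indicator_def ennreal_power)
    finally show ?thesis .
  qed
  then have "(\<integral>\<^sup>+t. (majorant t)\<^sup>2 \<partial>M)
      \<le> (\<integral>\<^sup>+t. ennreal (C * normsq M f) * (\<integral>\<^sup>+p. indicator K p * ennreal ((cmod (\<phi> p t))\<^sup>2) \<partial>P) \<partial>M)"
    by (intro nn_integral_mono)
  also have "\<dots> = ennreal (C * normsq M f) * (\<integral>\<^sup>+t. \<integral>\<^sup>+p. indicator K p * ennreal ((cmod (\<phi> p t))\<^sup>2) \<partial>P \<partial>M)"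
    by (rule nn_integral_cmult) measurable
  also have "(\<integral>\<^sup>+t. \<integral>\<^sup>+p. indicator K p * ennreal ((cmod (\<phi> p t))\<^sup>2) \<partial>P \<partial>M)
      = (\<integral>\<^sup>+p. \<integral>\<^sup>+t. indicator K p * ennreal ((cmod (\<phi> p t))\<^sup>2) \<partial>M \<partial>P)"
    by (rule Fubini') measurable
  also have "\<dots> \<le> (\<integral>\<^sup>+p. ennreal B * indicator K p \<partial>P)"
  proof (rule nn_integral_mono)
    fix p
    have [measurable]: "\<phi> p \<in> borel_measurable M" using atom_L2 by (rule L2_measurable)
    show "(\<integral>\<^sup>+t. indicator K p * ennreal ((cmod (\<phi> p t))\<^sup>2) \<partial>M) \<le> ennreal B * indicator K p"
      using atom_bound[of p]
      by (auto simp: nn_integral_cmult nn_integral_eq_normsq[OF atom_L2] indicator_def ennreal_leI)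
  qed
  also have "\<dots> = ennreal (B * measure P K)"
    using fin B_nonneg K by (simp add: nn_integral_cmult emeasure_eq_ennreal_measure ennreal_mult)
  finally show ?thesis
    using C_pos B_nonneg by (simp add: ennreal_mult mult_left_mono)
qed

lemma nn_integral_synth_integrand:
  "(\<integral>\<^sup>+p. ennreal (cmod (indicator K p * (V f p * \<phi> p t))) \<partial>P) = majorant t"
  unfolding majorant_def
  by (intro nn_integral_cong) (auto simp: norm_mult ennreal_mult indicator_def)

lemma majorant_finite: "AE t in M. majorant t < \<infinity>"
proof -
  have "AE t in M. (majorant t)\<^sup>2 \<noteq> \<infinity>"
    using majorant_sq by (intro nn_integral_PInf_AE) (auto simp: top_unique)
  then show ?thesis
    by eventually_elim (auto simp: power2_eq_square ennreal_mult_eq_top_iff less_top)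
qed

lemma synth_integrable: "AE t in M. integrable P (\<lambda>p. indicator K p * (V f p * \<phi> p t))"
  using majorant_finite AE_space
proof eventually_elim
  fix t assume t[measurable]: "t \<in> space M" and "majorant t < \<infinity>"
  then show "integrable P (\<lambda>p. indicator K p * (V f p * \<phi> p t))"
    by (intro integrableI_bounded) (auto simp: nn_integral_synth_integrand)
qed

lemma synth_measurable [measurable]: "synth f K \<in> borel_measurable M"
  unfolding synth_def by measurable

lemma synth_le_majorant: "ennreal (cmod (synth f K t)) \<le> majorant t"
  unfolding synth_def nn_integral_synth_integrand[symmetric] by (rule norm_integral_le_nn)

lemma synth_L2: "synth f K \<in> L2 M"
proof -
  have "(\<integral>\<^sup>+t. ennreal ((cmod (synth f K t))\<^sup>2) \<partial>M) \<le> (\<integral>\<^sup>+t. (majorant t)\<^sup>2 \<partial>M)"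
    by (intro nn_integral_mono) (auto simp: ennreal_power[symmetric] intro!: power_mono synth_le_majorant)
  also note majorant_sq
  finally show ?thesis
    using C_pos B_nonneg by (intro L2I_nn(1)[where c = "C * normsq M f * (B * measure P K)"]) auto
qed

text \<open>
  Fubini's theorem; the majorant is square-integrable, hence its product with \<open>|g|\<close> is integrable.
\<close>

lemma ip_synth:
  assumes g: "g \<in> L2 M"
  shows "ip M (synth f K) g = ip P (\<lambda>p. indicator K p * V f p) (V g)"
proof -
  have [measurable]: "g \<in> borel_measurable M" using g by (rule L2_measurable)
  let ?F = "\<lambda>(p, t). indicator K p * (V f p * \<phi> p t) * cnj (g t)"
  have "(\<integral>\<^sup>+t. majorant t * ennreal (cmod (g t)) \<partial>M)\<^sup>2
      \<le> (\<integral>\<^sup>+t. (majorant t)\<^sup>2 \<partial>M) * (\<integral>\<^sup>+t. (ennreal (cmod (g t)))\<^sup>2 \<partial>M)"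
    by (rule Cauchy_Schwarz_nn_integral) measurable
  also have "\<dots> < \<infinity>"
    using majorant_sq nn_integral_eq_normsq[OF g]
    by (auto simp: ennreal_power ennreal_mult_less_top intro: le_less_trans)
  finally have fin': "(\<integral>\<^sup>+t. majorant t * ennreal (cmod (g t)) \<partial>M) < \<infinity>"
    by (auto simp: power2_eq_square ennreal_mult_less_top)
  have "(\<integral>\<^sup>+p. \<integral>\<^sup>+t. ennreal (cmod (?F (p, t))) \<partial>M \<partial>P) = (\<integral>\<^sup>+t. \<integral>\<^sup>+p. ennreal (cmod (?F (p, t))) \<partial>P \<partial>M)"
    by (rule Fubini'[symmetric]) measurable
  also have "\<dots> = (\<integral>\<^sup>+t. majorant t * ennreal (cmod (g t)) \<partial>M)"
    unfolding majorant_def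
    by (intro nn_integral_cong, subst nn_integral_multc[symmetric])
       (auto intro!: nn_integral_cong simp: norm_mult ennreal_mult indicator_def)
  finally have "integrable (P \<Otimes>\<^sub>M M) ?F"
    using fin' by (intro integrableI_bounded) (auto simp: M2.nn_integral_fst[symmetric])
  then have eq: "(\<integral>t. \<integral>p. ?F (p, t) \<partial>P \<partial>M) = (\<integral>p. \<integral>t. ?F (p, t) \<partial>M \<partial>P)"
    using Fubini_integral[of "\<lambda>p t. ?F (p, t)"] by (simp add: case_prod_beta')
  have "ip M (synth f K) g = (\<integral>t. \<integral>p. ?F (p, t) \<partial>P \<partial>M)"
    unfolding ip_def synth_def by simp
  also note eq
  also have "(\<integral>p. \<integral>t. ?F (p, t) \<partial>M \<partial>P) = (\<integral>p. indicator K p * V f p * ip M (\<phi> p) g \<partial>P)"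
    unfolding ip_def[of M "\<phi> _"] by (simp add: mult.assoc)
  finally show ?thesis
    by (simp add: ip_def[of P] ip_cnj)
qed

text \<open>
  For the difference \<open>d\<close> of \<open>C f\<close> and the partial synthesis, polarization and \<open>ip_synth\<close> express
  \<open>\<langle>d, d\<rangle>\<close> as the inner product of the part of \<open>V f\<close> outside \<open>K\<close> with \<open>V d\<close>. The Cauchy-Schwarz
  inequality and the isometry for \<open>d\<close> bound this by a multiple of the norm of \<open>d\<close>, which cancels.
\<close>

lemma synth_error:
  "normsq M (\<lambda>t. C * f t - synth f K t) \<le> C * normsq P (\<lambda>p. indicator (space P - K) p * V f p)"
proof -
  define d where "d t = C * f t - synth f K t" for t
  let ?r = "\<lambda>p. indicator (space P - K) p * V f p"
  have d: "d \<in> L2 M" unfolding d_def by (intro L2_diff L2_cmult f synth_L2)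
  have Kf: "(\<lambda>p. indicator K p * V f p) \<in> L2 P" and r: "?r \<in> L2 P"
    by (auto intro!: L2_indicator_mult analysis_L2 f K)
  have split: "V f p = indicator K p * V f p + ?r p" if "p \<in> space P" for p
    using that by (auto simp: indicator_def)
  have "ip M d d = C * ip M f d - ip M (synth f K) d"
    using ip_diff_left[OF L2_cmult[OF f] synth_L2 d, of C] by (simp add: d_def[symmetric] ip_cmult_left)
  also have "C * ip M f d = ip P (V f) (V d)"
    by (rule polarization[OF f d, symmetric])
  also have "\<dots> = ip P (\<lambda>p. indicator K p * V f p + ?r p) (V d)"
    unfolding ip_def[of P] by (intro Bochner_Integration.integral_cong) (use split in auto)
  also have "\<dots> = ip P (\<lambda>p. indicator K p * V f p) (V d) + ip P ?r (V d)"
    by (intro ip_add_left Kf r analysis_L2 d)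
  also note ip_synth[OF d]
  finally have "complex_of_real (normsq M d) = ip P ?r (V d)"
    using ip_self[OF d] by simp
  then have "(normsq M d)\<^sup>2 = (cmod (ip P ?r (V d)))\<^sup>2"
    by (metis norm_of_real power2_abs)
  also have "\<dots> \<le> normsq P ?r * normsq P (V d)"
    by (intro L2_Cauchy_Schwarz r analysis_L2 d)
  also have "\<dots> = C * normsq P ?r * normsq M d"
    using analysis_normsq[OF d] by simp
  finally have "normsq M d * normsq M d \<le> (C * normsq P ?r) * normsq M d"
    by (simp add: power2_eq_square)
  then have "normsq M d \<le> C * normsq P ?r"
    using C_pos by (cases "normsq M d = 0") (auto simp: less_le)
  then show ?thesis by (simp add: d_def[abs_def])
qed

end

text \<open>
  The hypothesis that almost every parameter is eventually in \<open>K n\<close> survives changes of these sets on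
  null sets.
\<close>

lemma norm_reconstruction:
  assumes f: "f \<in> L2 M" and K: "\<And>n. K n \<in> sets P" "\<And>n. emeasure P (K n) < \<infinity>"
    and ev: "AE p in P. \<forall>\<^sub>F n in sequentially. p \<in> K n"
  shows "(\<lambda>n. normsq M (\<lambda>t. 1 / C * synth f (K n) t - f t)) \<longlonglongrightarrow> 0"
proof -
  have [measurable]: "V f \<in> borel_measurable P" by (rule L2_measurable[OF analysis_L2[OF f]])
  note K(1)[measurable]
  have "(\<lambda>n. normsq P (\<lambda>p. indicator (space P - K n) p * V f p)) \<longlonglongrightarrow> (\<integral>p. 0 \<partial>P)"
    unfolding normsq_def
  proof (rule integral_dominated_convergence[where w="\<lambda>p. (cmod (V f p))\<^sup>2"])
    show "AE p in P. (\<lambda>n. (cmod (indicator (space P - K n) p * V f p))\<^sup>2) \<longlonglongrightarrow> 0"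
      using ev
    proof eventually_elim
      fix p assume "\<forall>\<^sub>F n in sequentially. p \<in> K n"
      then have "\<forall>\<^sub>F n in sequentially. (cmod (indicator (space P - K n) p * V f p))\<^sup>2 = 0"
        by eventually_elim simp
      then show "(\<lambda>n. (cmod (indicator (space P - K n) p * V f p))\<^sup>2) \<longlonglongrightarrow> 0"
        by (simp add: tendsto_eventually)
    qed
    show "AE p in P. norm ((cmod (indicator (space P - K n) p * V f p))\<^sup>2) \<le> (cmod (V f p))\<^sup>2" for n
      by (auto simp: indicator_def)
  qed (use L2_integrable[OF analysis_L2[OF f]] in auto)
  then have "(\<lambda>n. C * normsq P (\<lambda>p. indicator (space P - K n) p * V f p)) \<longlonglongrightarrow> 0"
    by (auto intro!: tendsto_eq_intros)
  then have lim: "(\<lambda>n. normsq M (\<lambda>t. C * f t - synth f (K n) t)) \<longlonglongrightarrow> 0"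
    by (rule Lim_null_comparison[rotated]) (use synth_error[OF f K] in auto)
  have "normsq M (\<lambda>t. 1 / C * synth f (K n) t - f t) = (1 / C)\<^sup>2 * normsq M (\<lambda>t. C * f t - synth f (K n) t)" for n
  proof -
    have "1 / C * synth f (K n) t - f t = - (1 / C) * (C * f t - synth f (K n) t)" for t
      using C_pos by (simp add: field_simps)
    then show ?thesis
      using normsq_cmult[of M "- (1 / C)"] by (simp add: power_divide norm_divide)
  qed
  with tendsto_mult_right_zero[OF lim, of "(1/C)\<^sup>2"] show ?thesis by simp
qed

text \<open>
  Along an exhaustion by sets of finite measure, a subsequence of the partial integrals tends to \<open>f\<close>
  almost everywhere by convergence in norm, and to the full integral by dominated convergence.
\<close>

lemma pointwise_reconstruction:
  assumes f: "f \<in> L2 M"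
  shows "AE t in M. integrable P (\<lambda>p. V f p * \<phi> p t) \<longrightarrow> f t = 1 / C * (\<integral>p. V f p * \<phi> p t \<partial>P)"
proof -
  have [measurable]: "V f \<in> borel_measurable P" by (rule L2_measurable[OF analysis_L2[OF f]])
  obtain K where K: "range K \<subseteq> sets P" "(\<Union>i. K i) = space P" "\<And>i. emeasure P (K i) \<noteq> \<infinity>" "incseq K"
    using M1.sigma_finite_incseq by blast
  then have K': "K n \<in> sets P" "emeasure P (K n) < \<infinity>" for n
    by (auto simp: less_top)
  have evK: "\<forall>\<^sub>F n in sequentially. p \<in> K n" if p: "p \<in> space P" for p
  proof -
    obtain m where m: "p \<in> K m" using K(2) p by blast
    show ?thesis
      using eventually_ge_at_top[of m] by eventually_elim (use m K(4) in \<open>auto simp: incseq_def\<close>)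
  qed
  have "(\<lambda>n. normsq M (\<lambda>t. 1 / C * synth f (K n) t - f t)) \<longlonglongrightarrow> 0"
    by (intro norm_reconstruction f K' AE_I2 evK)
  then obtain r :: "nat \<Rightarrow> nat" where r: "strict_mono r"
    and ae: "AE t in M. (\<lambda>n. 1 / C * synth f (K (r n)) t) \<longlonglongrightarrow> f t"
    using L2_AE_subseq[of "\<lambda>n t. 1 / C * synth f (K n) t" M f] L2_cmult[OF synth_L2[OF f K'], of "1/C"] f
    by blast
  show ?thesis
    using ae AE_space
  proof (eventually_elim, intro impI)
    fix t assume lim: "(\<lambda>n. 1 / C * synth f (K (r n)) t) \<longlonglongrightarrow> f t" and [measurable]: "t \<in> space M"
      and int: "integrable P (\<lambda>p. V f p * \<phi> p t)"
    note K'(1)[measurable]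
    have "(\<lambda>n. synth f (K n) t) \<longlonglongrightarrow> (\<integral>p. V f p * \<phi> p t \<partial>P)"
      unfolding synth_def
    proof (rule integral_dominated_convergence[where w="\<lambda>p. cmod (V f p * \<phi> p t)"])
      show "AE p in P. (\<lambda>n. indicator (K n) p * (V f p * \<phi> p t)) \<longlonglongrightarrow> V f p * \<phi> p t"
      proof (rule AE_I2)
        fix p assume "p \<in> space P"
        then have "\<forall>\<^sub>F n in sequentially. indicator (K n) p * (V f p * \<phi> p t) = V f p * \<phi> p t"
          by (intro eventually_mono[OF evK]) auto
        then show "(\<lambda>n. indicator (K n) p * (V f p * \<phi> p t)) \<longlonglongrightarrow> V f p * \<phi> p t"
          by (simp add: tendsto_eventually)
      qed
      show "AE p in P. norm (indicator (K n) p * (V f p * \<phi> p t)) \<le> cmod (V f p * \<phi> p t)" for n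
        by (auto simp: indicator_def)
    qed (use int in \<open>auto\<close>)
    from LIMSEQ_subseq_LIMSEQ[OF this r]
    have "(\<lambda>n. 1 / C * synth f (K (r n)) t) \<longlonglongrightarrow> 1 / C * (\<integral>p. V f p * \<phi> p t \<partial>P)"
      by (intro tendsto_intros) (simp add: o_def)
    with lim show "f t = 1 / C * (\<integral>p. V f p * \<phi> p t \<partial>P)"
      by (rule LIMSEQ_unique)
  qed
qed

end

section \<open>Affine changes of variables and Gaussians\<close>

text \<open>
  The hypothesis on \<open>lborel\<close> says that \<open>T\<close> scales volumes by the factor \<open>k\<close>; \<open>lborel_affine_euclidean\<close>
  provides it for affine maps with diagonal linear part. Translations,
  reflections, homotheties and componentwise dilations are all covered by it.
\<close>

lemma affine_change_of_variables:
  fixes T :: "'a::euclidean_space \<Rightarrow> 'a" and k :: real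
  assumes k: "0 < k" and [measurable]: "T \<in> borel_measurable borel"
    and eq: "lborel = density (distr lborel borel T) (\<lambda>_. ennreal k)"
  shows nn_integral_affine: "\<And>f. f \<in> borel_measurable borel \<Longrightarrow>
      (\<integral>\<^sup>+x. f x \<partial>lborel) = ennreal k * (\<integral>\<^sup>+x. f (T x) \<partial>lborel)"
    and integrable_affine: "\<And>f::'a \<Rightarrow> complex. integrable lborel f \<Longrightarrow> integrable lborel (\<lambda>x. f (T x))"
    and integral_affine: "\<And>f::'a \<Rightarrow> complex. f \<in> borel_measurable borel \<Longrightarrow>
      (\<integral>x. f x \<partial>lborel) = k * (\<integral>x. f (T x) \<partial>lborel)"
    and AE_affine: "\<And>P. (AE x in lborel. P x) \<Longrightarrow> (AE x in lborel. P (T x))"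
proof -
  show nn: "(\<integral>\<^sup>+x. f x \<partial>lborel) = ennreal k * (\<integral>\<^sup>+x. f (T x) \<partial>lborel)"
    if [measurable]: "f \<in> borel_measurable borel" for f
    by (subst eq) (simp add: nn_integral_density nn_integral_distr nn_integral_cmult)
  show "integrable lborel (\<lambda>x. f (T x))" if i: "integrable lborel f" for f :: "'a \<Rightarrow> complex"
  proof (rule integrableI_bounded)
    have [measurable]: "f \<in> borel_measurable borel" using borel_measurable_integrable[OF i] by simp
    show "(\<lambda>x. f (T x)) \<in> borel_measurable lborel" by simp
    have "ennreal k * (\<integral>\<^sup>+x. ennreal (norm (f (T x))) \<partial>lborel) < \<infinity>"
      using i nn[of "\<lambda>x. ennreal (norm (f x))"] by (simp add: integrable_iff_bounded)
    then show "(\<integral>\<^sup>+x. ennreal (norm (f (T x))) \<partial>lborel) < \<infinity>"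
      using k by (auto simp: ennreal_mult_less_top)
  qed
  show "(\<integral>x. f x \<partial>lborel) = k * (\<integral>x. f (T x) \<partial>lborel)"
    if [measurable]: "f \<in> borel_measurable borel" for f :: "'a \<Rightarrow> complex"
  proof -
    have "(\<integral>x. f x \<partial>lborel) = (\<integral>x. f x \<partial>density (distr lborel borel T) (\<lambda>_. ennreal k))"
      using eq by simp
    also have "\<dots> = k * (\<integral>x. f (T x) \<partial>lborel)"
      using k by (subst integral_density) (auto simp: integral_distr scaleR_conv_of_real)
    finally show ?thesis .
  qed
  show "AE x in lborel. P (T x)" if "AE x in lborel. P x" for P
  proof -
    from that obtain N where N: "{x \<in> space lborel. \<not> P x} \<subseteq> N" "emeasure lborel N = 0" "N \<in> sets lborel"
      by (rule AE_E)
    have [measurable]: "N \<in> sets borel" using N by simp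
    have "ennreal k * (\<integral>\<^sup>+x. indicator N (T x) \<partial>lborel) = (\<integral>\<^sup>+x. indicator N x \<partial>lborel)"
      by (rule nn[symmetric]) simp
    also have "\<dots> = 0" using N by simp
    finally have "(\<integral>\<^sup>+x. indicator N (T x) \<partial>lborel) = (0::ennreal)"
      using k by simp
    then have "AE x in lborel. indicator N (T x) = (0::ennreal)"
      by (subst (asm) nn_integral_0_iff_AE) auto
    then show ?thesis
      by eventually_elim (use N in \<open>auto simp: indicator_def split: if_splits\<close>)
  qed
qed

lemma lborel_affine':
  fixes t :: "'a::euclidean_space"
  assumes "c \<noteq> 0"
  shows "lborel = density (distr lborel borel (\<lambda>x. t + c *\<^sub>R x)) (\<lambda>_. ennreal (\<bar>c\<bar>^DIM('a)))"
  using lborel_affine[OF assms, of t] by simp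

lemma integral_affine_scaleR:
  fixes f :: "'a::euclidean_space \<Rightarrow> complex"
  assumes "c \<noteq> 0" "f \<in> borel_measurable borel"
  shows "(\<integral>x. f x \<partial>lborel) = complex_of_real (\<bar>c\<bar>^DIM('a)) * (\<integral>x. f (t + c *\<^sub>R x) \<partial>lborel)"
  using integral_affine[of "\<bar>c\<bar>^DIM('a)" "\<lambda>x. t + c *\<^sub>R x" f] lborel_affine'[OF assms(1), of t] assms
  by simp

lemma nn_integral_translate:
  fixes f :: "'a::euclidean_space \<Rightarrow> ennreal"
  assumes "f \<in> borel_measurable borel"
  shows "(\<integral>\<^sup>+x. f (x + t) \<partial>lborel) = (\<integral>\<^sup>+x. f x \<partial>lborel)"
  using nn_integral_affine[of 1 "\<lambda>x. t + 1 *\<^sub>R x" f] lborel_affine'[of 1 t] assms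
  by (simp add: add.commute)

lemma (in pair_sigma_finite) integrable_product:
  fixes f :: "'a \<Rightarrow> complex" and g :: "'b \<Rightarrow> complex"
  assumes f: "integrable M1 f" and g: "integrable M2 g"
  shows "integrable (M1 \<Otimes>\<^sub>M M2) (\<lambda>(x, y). f x * g y)"
proof (rule integrableI_bounded)
  have [measurable]: "f \<in> borel_measurable M1" "g \<in> borel_measurable M2" using f g by auto
  show "(\<lambda>(x, y). f x * g y) \<in> borel_measurable (M1 \<Otimes>\<^sub>M M2)" by measurable
  have "(\<integral>\<^sup>+z. ennreal (norm (case z of (x, y) \<Rightarrow> f x * g y)) \<partial>(M1 \<Otimes>\<^sub>M M2))
      = (\<integral>\<^sup>+x. \<integral>\<^sup>+y. ennreal (norm (f x)) * ennreal (norm (g y)) \<partial>M2 \<partial>M1)"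
    by (subst M2.nn_integral_fst[symmetric]) (auto simp: norm_mult ennreal_mult)
  also have "\<dots> = (\<integral>\<^sup>+x. ennreal (norm (f x)) \<partial>M1) * (\<integral>\<^sup>+y. ennreal (norm (g y)) \<partial>M2)"
    by (simp add: nn_integral_cmult nn_integral_multc)
  also have "\<dots> < \<infinity>"
    using f g by (auto simp: integrable_iff_bounded ennreal_mult_less_top)
  finally show "(\<integral>\<^sup>+z. ennreal (norm (case z of (x, y) \<Rightarrow> f x * g y)) \<partial>(M1 \<Otimes>\<^sub>M M2)) < \<infinity>" .
qed

lemma cis_measurable [measurable]: "cis \<in> borel_measurable borel"
  unfolding cis_conv_exp[abs_def] by measurable

text \<open>
  The standard normal density on the whole space, as a product, so that its Fourier transform reduces
  to the characteristic function of the normal distribution on the line.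
\<close>

definition gauss :: "'a::euclidean_space \<Rightarrow> real" where
  "gauss x = (\<Prod>b\<in>Basis. std_normal_density (x \<bullet> b))"

lemma gauss_measurable [measurable]: "gauss \<in> borel_measurable borel"
  unfolding gauss_def by measurable

lemma gauss_nonneg: "0 \<le> gauss x"
  unfolding gauss_def by (intro prod_nonneg) (auto simp: normal_density_nonneg)

lemma gauss_eq: "gauss x = exp (- (norm x)\<^sup>2 / 2) / sqrt (2 * pi) ^ DIM('a)"
  for x :: "'a::euclidean_space"
proof -
  have "gauss x = (\<Prod>b\<in>Basis. exp (- (x \<bullet> b)\<^sup>2 / 2)) / sqrt (2 * pi) ^ DIM('a)"
    unfolding gauss_def normal_density_def by (simp add: prod_dividef)
  also have "(\<Prod>b\<in>Basis. exp (- (x \<bullet> b)\<^sup>2 / 2)) = exp (\<Sum>b\<in>Basis. - (x \<bullet> b)\<^sup>2 / 2)"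
    by (simp add: exp_sum)
  also have "(\<Sum>b\<in>Basis. - (x \<bullet> b)\<^sup>2 / 2) = - (norm x)\<^sup>2 / 2"
    by (subst euclidean_inner[of x x, folded power2_norm_eq_inner, simplified])
       (simp add: sum_negf sum_divide_distrib power2_eq_square)
  finally show ?thesis .
qed

lemma nn_integral_gauss: "(\<integral>\<^sup>+x. ennreal (gauss (x::'a::euclidean_space)) \<partial>lborel) = 1"
proof -
  have 1: "(\<integral>\<^sup>+x. ennreal (std_normal_density x) \<partial>lborel) = 1"
    by (subst nn_integral_eq_integral) (auto simp: normal_density_nonneg)
  have "(\<integral>\<^sup>+x. ennreal (gauss (x::'a)) \<partial>lborel)
      = (\<integral>\<^sup>+x. (\<Prod>b\<in>(Basis::'a set). ennreal (std_normal_density (x \<bullet> b))) \<partial>lborel)"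
    unfolding gauss_def by (simp add: prod_ennreal normal_density_nonneg)
  also have "\<dots> = (\<Prod>b\<in>(Basis::'a set). (\<integral>\<^sup>+x. ennreal (std_normal_density x) \<partial>lborel))"
    by (rule nn_integral_lborel_prod) auto
  finally show ?thesis by (simp add: 1)
qed

lemma integrable_gauss: "integrable lborel gauss"
  by (rule integrableI_bounded) (auto simp: gauss_nonneg nn_integral_gauss)

lemma char_std_normal:
  "(\<integral>x. complex_of_real (std_normal_density x) * cis (x * t) \<partial>lborel) = exp (- t\<^sup>2 / 2)"
  and integrable_char_std_normal:
  "integrable lborel (\<lambda>x. complex_of_real (std_normal_density x) * cis (x * t))"
proof -
  have "char std_normal_distribution t = (\<integral>x. std_normal_density x *\<^sub>R cis (x * t) \<partial>lborel)"
    unfolding char_def by (subst integral_density) (auto simp: normal_density_nonneg cis_conv_exp mult.commute)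
  then show "(\<integral>x. complex_of_real (std_normal_density x) * cis (x * t) \<partial>lborel) = exp (- t\<^sup>2 / 2)"
    by (simp add: char_std_normal_distribution scaleR_conv_of_real)
  show "integrable lborel (\<lambda>x. complex_of_real (std_normal_density x) * cis (x * t))"
    by (rule Bochner_Integration.integrable_bound[OF integrable_normal_density[of 1 0]])
       (auto simp: norm_mult)
qed

lemma char_gauss:
  fixes t :: "'a::euclidean_space"
  shows "(\<integral>x. complex_of_real (gauss x) * cis (x \<bullet> t) \<partial>lborel) = exp (- (norm t)\<^sup>2 / 2)"
proof -
  interpret product_sigma_finite "\<lambda>_::'a. lborel :: real measure" ..
  let ?T = "\<lambda>f::'a \<Rightarrow> real. \<Sum>b\<in>Basis. f b *\<^sub>R b"
  have T: "?T f \<bullet> b = f b" if "b \<in> Basis" for f b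
    using that by (simp add: inner_sum_left inner_Basis if_distrib sum.delta cong: if_cong)
  have "(\<integral>x. complex_of_real (gauss x) * cis (x \<bullet> t) \<partial>lborel)
      = (\<integral>f. complex_of_real (gauss (?T f)) * cis (?T f \<bullet> t) \<partial>(\<Pi>\<^sub>M b\<in>Basis. lborel))"
    by (subst lborel_eq, subst integral_distr) auto
  also have "\<dots> = (\<integral>f. (\<Prod>b\<in>Basis. complex_of_real (std_normal_density (f b)) * cis (f b * (t \<bullet> b)))
      \<partial>(\<Pi>\<^sub>M b\<in>Basis. lborel))"
  proof (intro Bochner_Integration.integral_cong refl)
    fix f :: "'a \<Rightarrow> real"
    have "cis (\<Sum>b\<in>Basis. f b * (t \<bullet> b)) = (\<Prod>b\<in>Basis. cis (f b * (t \<bullet> b)))"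
      by (simp add: cis_conv_exp exp_sum sum_distrib_left)
    moreover have "?T f \<bullet> t = (\<Sum>b\<in>Basis. f b * (t \<bullet> b))"
      by (simp add: inner_sum_left inner_commute[of t])
    ultimately show "complex_of_real (gauss (?T f)) * cis (?T f \<bullet> t)
        = (\<Prod>b\<in>Basis. complex_of_real (std_normal_density (f b)) * cis (f b * (t \<bullet> b)))"
      by (simp add: gauss_def T prod.distrib)
  qed
  also have "\<dots> = (\<Prod>b\<in>Basis. exp (- (t \<bullet> b)\<^sup>2 / 2))"
    by (subst product_integral_prod) (auto simp: integrable_char_std_normal char_std_normal)
  also have "\<dots> = exp (\<Sum>b\<in>Basis. - (t \<bullet> b)\<^sup>2 / 2)"
    by (simp add: exp_sum)
  also have "(\<Sum>b\<in>Basis. - (t \<bullet> b)\<^sup>2 / 2) = - (norm t)\<^sup>2 / 2"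
    by (subst euclidean_inner[of t t, folded power2_norm_eq_inner, simplified])
       (simp add: sum_negf sum_divide_distrib power2_eq_square)
  finally show ?thesis .
qed

text \<open>
  For small \<open>e\<close> this is close to 1 and its Fourier transform concentrates at the origin.
\<close>

definition weight :: "real \<Rightarrow> 'a::euclidean_space \<Rightarrow> real" where
  "weight e x = exp (- (e * norm x)\<^sup>2 / 2)"

lemma weight_measurable [measurable]: "weight e \<in> borel_measurable borel"
  unfolding weight_def by measurable

lemma weight_gauss: "weight e x = sqrt (2 * pi) ^ DIM('a) * gauss (e *\<^sub>R x)" for x :: "'a::euclidean_space"
  by (simp add: weight_def gauss_eq power_mult_distrib)

lemma weight_bounds: "0 < weight e x" "weight e x \<le> 1"
  by (auto simp: weight_def)

lemma integrable_weight:
  assumes "e > 0"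
  shows "integrable lborel (\<lambda>x::'a::euclidean_space. complex_of_real (weight e x))"
proof -
  have "integrable lborel (\<lambda>x::'a. complex_of_real (gauss x))"
    by (intro integrable_of_real integrable_gauss)
  then have "integrable lborel (\<lambda>x::'a. complex_of_real (gauss (0 + e *\<^sub>R x)))"
    by (rule integrable_affine[rotated 3, of _ "\<bar>e\<bar>^DIM('a)"]) (use assms lborel_affine'[of e 0] in auto)
  then show ?thesis by (simp add: weight_gauss)
qed

text \<open>
  A rescaling of \<open>char_gauss\<close>; the right-hand side is \<open>(2 pi)\<^sup>N\<close> times the centered normal density with
  standard deviation \<open>e\<close>.
\<close>

lemma fourier_weight:
  fixes z :: "'a::euclidean_space"
  assumes "e > 0"
  shows "(\<integral>x. complex_of_real (weight e x) * cis (x \<bullet> z) \<partial>lborel)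
    = complex_of_real ((2 * pi) ^ DIM('a) * (1 / e) ^ DIM('a) * gauss ((1/e) *\<^sub>R z))"
proof -
  have "exp (- (norm ((1/e) *\<^sub>R z))\<^sup>2 / 2) = (\<integral>x. complex_of_real (gauss x) * cis (x \<bullet> ((1/e) *\<^sub>R z)) \<partial>lborel)"
    by (rule char_gauss[symmetric])
  also have "\<dots> = complex_of_real (\<bar>e\<bar>^DIM('a)) * (\<integral>x. complex_of_real (gauss (0 + e *\<^sub>R x)) * cis ((0 + e *\<^sub>R x) \<bullet> ((1/e) *\<^sub>R z)) \<partial>lborel)"
    using assms by (intro integral_affine_scaleR) auto
  also have "(\<integral>x. complex_of_real (gauss (0 + e *\<^sub>R x)) * cis ((0 + e *\<^sub>R x) \<bullet> ((1/e) *\<^sub>R z)) \<partial>lborel)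
     = (\<integral>x. complex_of_real (gauss (e *\<^sub>R x)) * cis (x \<bullet> z) \<partial>lborel)"
    using assms by simp
  finally have 1: "complex_of_real (exp (- (norm ((1/e) *\<^sub>R z))\<^sup>2 / 2)) = e^DIM('a) * (\<integral>x. complex_of_real (gauss (e *\<^sub>R x)) * cis (x \<bullet> z) \<partial>lborel)"
    using assms by simp
  have "(\<integral>x. complex_of_real (weight e x) * cis (x \<bullet> z) \<partial>lborel)
      = complex_of_real (sqrt (2 * pi) ^ DIM('a)) * (\<integral>x. complex_of_real (gauss (e *\<^sub>R x)) * cis (x \<bullet> z) \<partial>lborel)"
    by (simp add: weight_gauss mult.assoc)
  also have "\<dots> = complex_of_real (sqrt (2 * pi) ^ DIM('a) * (1 / e) ^ DIM('a) * exp (- (norm ((1/e) *\<^sub>R z))\<^sup>2 / 2))"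
    using assms by (simp only: of_real_mult 1) (simp add: field_simps)
  also have "sqrt (2 * pi) ^ DIM('a) * (1 / e) ^ DIM('a) * exp (- (norm ((1/e) *\<^sub>R z))\<^sup>2 / 2)
     = (sqrt (2 * pi) * sqrt (2 * pi)) ^ DIM('a) * (1 / e) ^ DIM('a) * gauss ((1/e) *\<^sub>R z)"
    unfolding gauss_eq power_mult_distrib by simp
  finally show ?thesis by simp
qed

section \<open>Plancherel's theorem\<close>

text \<open>
  Without a normalizing factor; the factor \<open>(2 pi)\<^sup>N\<close> then appears in Plancherel's theorem.
\<close>

definition fourier :: "('a::euclidean_space \<Rightarrow> complex) \<Rightarrow> 'a \<Rightarrow> complex" where
  "fourier f \<xi> = (\<integral>x. f x * cis (- (x \<bullet> \<xi>)) \<partial>lborel)"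

definition L12 :: "('a::euclidean_space \<Rightarrow> complex) set" where
  "L12 = {f. integrable lborel f} \<inter> L2 lborel"

lemma L12D: "f \<in> L12 \<Longrightarrow> integrable lborel f" "f \<in> L12 \<Longrightarrow> f \<in> L2 lborel"
  "f \<in> L12 \<Longrightarrow> f \<in> borel_measurable borel"
  by (auto simp: L12_def L2_def)

lemma fourier_integrable:
  assumes f: "integrable lborel f"
  shows "integrable lborel (\<lambda>x. f x * cis (- (x \<bullet> \<xi>)))"
proof (rule Bochner_Integration.integrable_bound[OF f])
  have [measurable]: "f \<in> borel_measurable borel" using borel_measurable_integrable[OF f] by simp
  show "(\<lambda>x. f x * cis (- (x \<bullet> \<xi>))) \<in> borel_measurable lborel" by simp
qed (auto simp: norm_mult)

lemma fourier_measurable [measurable]: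
  assumes [measurable]: "f \<in> borel_measurable borel"
  shows "fourier f \<in> borel_measurable borel"
  unfolding fourier_def by measurable

lemma fourier_bound: "integrable lborel f \<Longrightarrow> cmod (fourier f \<xi>) \<le> (\<integral>x. cmod (f x) \<partial>lborel)"
  unfolding fourier_def using integral_norm_bound[of lborel "\<lambda>x. f x * cis (- (x \<bullet> \<xi>))"]
  by (simp add: norm_mult)

lemma fourier_add: "integrable lborel f \<Longrightarrow> integrable lborel g \<Longrightarrow>
    fourier (\<lambda>x. f x + g x) \<xi> = fourier f \<xi> + fourier g \<xi>"
  unfolding fourier_def by (simp add: distrib_right fourier_integrable)

lemma fourier_cmult: "fourier (\<lambda>x. c * f x) \<xi> = c * fourier f \<xi>"
  unfolding fourier_def by (simp add: mult.assoc)

lemma fourier_diff: "integrable lborel f \<Longrightarrow> integrable lborel g \<Longrightarrow>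
    fourier (\<lambda>x. f x - g x) \<xi> = fourier f \<xi> - fourier g \<xi>"
  unfolding fourier_def by (simp add: left_diff_distrib fourier_integrable)

interpretation lborel_pair: pair_sigma_finite lborel lborel ..

lemma norm_sq_fourier:
  assumes f: "integrable lborel f"
  shows "complex_of_real ((cmod (fourier f \<xi>))\<^sup>2)
     = (\<integral>z. f (fst z) * cnj (f (snd z)) * cis (- ((fst z - snd z) \<bullet> \<xi>)) \<partial>(lborel \<Otimes>\<^sub>M lborel))"
proof -
  have cf: "integrable lborel (\<lambda>y. cnj (f y * cis (- (y \<bullet> \<xi>))))"
    using fourier_integrable[OF f] by (simp only: complex_integrable_cnj)
  have "complex_of_real ((cmod (fourier f \<xi>))\<^sup>2) = fourier f \<xi> * cnj (fourier f \<xi>)"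
    using complex_norm_square[of "fourier f \<xi>"] by simp
  also have "\<dots> = (\<integral>x. \<integral>y. (f x * cis (- (x \<bullet> \<xi>))) * cnj (f y * cis (- (y \<bullet> \<xi>))) \<partial>lborel \<partial>lborel)"
    unfolding fourier_def Bochner_Integration.integral_cnj[symmetric] by simp
  also have "\<dots> = (\<integral>z. (f (fst z) * cis (- (fst z \<bullet> \<xi>))) * cnj (f (snd z) * cis (- (snd z \<bullet> \<xi>))) \<partial>(lborel \<Otimes>\<^sub>M lborel))"
    using lborel_pair.integral_fst'[OF lborel_pair.integrable_product[OF fourier_integrable[OF f] cf]]
    by (simp add: case_prod_beta')
  also have "\<dots> = (\<integral>z. f (fst z) * cnj (f (snd z)) * cis (- ((fst z - snd z) \<bullet> \<xi>)) \<partial>(lborel \<Otimes>\<^sub>M lborel))"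
  proof (intro Bochner_Integration.integral_cong refl)
    fix z :: "'a \<times> 'a"
    have "cis (- (fst z \<bullet> \<xi>)) * cis (snd z \<bullet> \<xi>) = cis (- ((fst z - snd z) \<bullet> \<xi>))"
      by (simp add: cis_mult inner_diff_left)
    then show "(f (fst z) * cis (- (fst z \<bullet> \<xi>))) * cnj (f (snd z) * cis (- (snd z \<bullet> \<xi>)))
        = f (fst z) * cnj (f (snd z)) * cis (- ((fst z - snd z) \<bullet> \<xi>))"
      by (simp add: cis_cnj mult_ac)
  qed
  finally show ?thesis .
qed

lemma abs_mono: "0 \<le> a \<Longrightarrow> a \<le> b \<Longrightarrow> \<bar>a\<bar> \<le> \<bar>b::real\<bar>"
  by simp

text \<open>
  Expand \<open>|F f \<xi>|\<^sup>2\<close> as a double integral, integrate in \<open>\<xi>\<close> first, and substitute \<open>y = x - e s\<close>. For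
  square-integrable \<open>f\<close> the integral on the right is the average, over a normally distributed shift
  \<open>e s\<close>, of the inner product of \<open>f\<close> with its translate, which approaches the square norm of \<open>f\<close>.
\<close>

lemma weighted_plancherel:
  fixes f :: "'a::euclidean_space \<Rightarrow> complex"
  assumes f: "integrable lborel f" and e: "e > 0"
  shows "complex_of_real (\<integral>\<xi>. weight e \<xi> * (cmod (fourier f \<xi>))\<^sup>2 \<partial>lborel)
     = complex_of_real ((2 * pi) ^ DIM('a)) *
       (\<integral>x. \<integral>s. f x * cnj (f (x - e *\<^sub>R s)) * complex_of_real (gauss s) \<partial>lborel \<partial>lborel)"
proof -
  have [measurable]: "f \<in> borel_measurable borel" using borel_measurable_integrable[OF f] by simp
  interpret P2: pair_sigma_finite "lborel :: 'a measure" "lborel \<Otimes>\<^sub>M lborel :: ('a \<times> 'a) measure" ..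
  let ?w = "\<lambda>\<xi>::'a. complex_of_real (weight e \<xi>)"
  let ?c = "complex_of_real ((2 * pi) ^ DIM('a))"
  let ?k = "\<lambda>u. ?c * complex_of_real ((1 / e) ^ DIM('a) * gauss ((1/e) *\<^sub>R u))"
  let ?D = "?c * complex_of_real ((1 / e) ^ DIM('a) * (1 / sqrt (2 * pi) ^ DIM('a)))"
  let ?f = "\<lambda>z. f (fst z) * cnj (f (snd z))"
  let ?L = "lborel \<Otimes>\<^sub>M lborel :: ('a \<times> 'a) measure"
  define F where "F z \<xi> = ?f z * cis (- ((fst z - snd z) \<bullet> \<xi>))" for z \<xi>
  have iff: "integrable ?L (\<lambda>z. ?f z)"
    using lborel_pair.integrable_product[OF f, of "\<lambda>y. cnj (f y)"] f by (simp add: case_prod_beta')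
  have int: "integrable (lborel \<Otimes>\<^sub>M ?L) (\<lambda>(\<xi>, z). ?w \<xi> * F z \<xi>)"
  proof (rule Bochner_Integration.integrable_bound[OF P2.integrable_product[OF integrable_weight[OF e] iff]])
    show "(\<lambda>(\<xi>, z). ?w \<xi> * F z \<xi>) \<in> borel_measurable (lborel \<Otimes>\<^sub>M ?L)"
      unfolding F_def by measurable
  qed (auto simp: F_def norm_mult)
  have "complex_of_real (\<integral>\<xi>. weight e \<xi> * (cmod (fourier f \<xi>))\<^sup>2 \<partial>lborel)
      = (\<integral>\<xi>. ?w \<xi> * complex_of_real ((cmod (fourier f \<xi>))\<^sup>2) \<partial>lborel)"
    by (subst integral_complex_of_real[symmetric]) simp
  also have "\<dots> = (\<integral>\<xi>. \<integral>z. ?w \<xi> * F z \<xi> \<partial>?L \<partial>lborel)"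
    unfolding norm_sq_fourier[OF f] F_def by simp
  also have "\<dots> = (\<integral>z. \<integral>\<xi>. ?w \<xi> * F z \<xi> \<partial>lborel \<partial>?L)"
    by (rule P2.Fubini_integral[OF int, symmetric])
  also have "\<dots> = (\<integral>z. ?f z * ?k (fst z - snd z) \<partial>?L)"
  proof (intro Bochner_Integration.integral_cong refl)
    fix z :: "'a \<times> 'a"
    have "(\<integral>\<xi>. ?w \<xi> * F z \<xi> \<partial>lborel) = (\<integral>\<xi>. ?f z * (?w \<xi> * cis (\<xi> \<bullet> (- (fst z - snd z)))) \<partial>lborel)"
    proof (intro Bochner_Integration.integral_cong refl)
      fix \<xi> :: 'a
      have "\<xi> \<bullet> (- (fst z - snd z)) = - ((fst z - snd z) \<bullet> \<xi>)"
        by (simp only: inner_minus_right inner_commute)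
      then show "?w \<xi> * F z \<xi> = ?f z * (?w \<xi> * cis (\<xi> \<bullet> (- (fst z - snd z))))"
        unfolding F_def by (simp only: mult_ac)
    qed
    also have "\<dots> = ?f z * (\<integral>\<xi>. ?w \<xi> * cis (\<xi> \<bullet> (- (fst z - snd z))) \<partial>lborel)"
      by (rule integral_mult_right_zero)
    also have "\<dots> = ?f z * complex_of_real ((2 * pi) ^ DIM('a) * (1 / e) ^ DIM('a) * gauss ((1/e) *\<^sub>R (- (fst z - snd z))))"
      unfolding fourier_weight[OF e] ..
    also have "gauss ((1/e) *\<^sub>R (- (fst z - snd z))) = gauss ((1/e) *\<^sub>R (fst z - snd z))"
      by (simp add: gauss_eq norm_minus_commute)
    finally show "(\<integral>\<xi>. ?w \<xi> * F z \<xi> \<partial>lborel) = ?f z * ?k (fst z - snd z)"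
      by (simp add: mult_ac)
  qed
  also have "\<dots> = (\<integral>x. \<integral>y. f x * cnj (f y) * ?k (x - y) \<partial>lborel \<partial>lborel)"
  proof -
    have bd: "gauss x \<le> 1 / sqrt (2 * pi) ^ DIM('a)" for x :: 'a
      by (auto simp: gauss_eq intro!: divide_right_mono)
    have "integrable ?L (\<lambda>z. ?f z * ?k (fst z - snd z))"
    proof (rule Bochner_Integration.integrable_bound)
      show "integrable ?L (\<lambda>z. ?f z * ?D)"
        using iff by (rule integrable_mult_left)
      show "AE z in lborel \<Otimes>\<^sub>M lborel. norm (?f z * ?k (fst z - snd z))
         \<le> norm (?f z * ?D)"
      proof (rule AE_I2)
        fix z :: "'a \<times> 'a"
        have "cmod (?f z * complex_of_real ((2 * pi) ^ DIM('a) * ((1 / e) ^ DIM('a) * gauss ((1/e) *\<^sub>R (fst z - snd z)))))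
            \<le> cmod (?f z * complex_of_real ((2 * pi) ^ DIM('a) * ((1 / e) ^ DIM('a) * (1 / sqrt (2 * pi) ^ DIM('a)))))"
          unfolding norm_mult[of "?f z"] norm_of_real using e
          by (intro mult_left_mono abs_mono bd mult_nonneg_nonneg gauss_nonneg) auto
        then show "norm (?f z * ?k (fst z - snd z))
            \<le> norm (?f z * ?D)"
          by (simp only: of_real_mult)
      qed
    qed simp
    from lborel_pair.integral_fst'[OF this] show ?thesis by simp
  qed
  also have "\<dots> = (\<integral>x. ?c * (\<integral>s. f x * cnj (f (x - e *\<^sub>R s)) * complex_of_real (gauss s) \<partial>lborel) \<partial>lborel)"
  proof (intro Bochner_Integration.integral_cong refl)
    fix x :: 'a
    have "(\<integral>y. f x * cnj (f y) * ?k (x - y) \<partial>lborel)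
       = complex_of_real (\<bar>- e\<bar> ^ DIM('a)) * (\<integral>s. f x * cnj (f (x + (-e) *\<^sub>R s)) * ?k (x - (x + (-e) *\<^sub>R s)) \<partial>lborel)"
      using e by (intro integral_affine_scaleR) auto
    also have "\<dots> = (\<integral>s. complex_of_real (\<bar>- e\<bar> ^ DIM('a)) * (f x * cnj (f (x + (-e) *\<^sub>R s)) * ?k (x - (x + (-e) *\<^sub>R s))) \<partial>lborel)"
      by (rule integral_mult_right_zero[symmetric])
    also have "\<dots> = (\<integral>s. ?c * (f x * cnj (f (x - e *\<^sub>R s)) * complex_of_real (gauss s)) \<partial>lborel)"
      using e by (intro Bochner_Integration.integral_cong refl) (simp add: field_simps)
    also have "\<dots> = ?c * (\<integral>s. f x * cnj (f (x - e *\<^sub>R s)) * complex_of_real (gauss s) \<partial>lborel)"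
      by (rule integral_mult_right_zero)
    finally show "(\<integral>y. f x * cnj (f y) * ?k (x - y) \<partial>lborel)
       = ?c * (\<integral>s. f x * cnj (f (x - e *\<^sub>R s)) * complex_of_real (gauss s) \<partial>lborel)" .
  qed
  finally show ?thesis by simp
qed

lemma integrable_weighted_fourier:
  assumes f: "integrable lborel f" and e: "e > 0"
  shows "integrable lborel (\<lambda>\<xi>. weight e \<xi> * (cmod (fourier f \<xi>))\<^sup>2)"
proof -
  have [measurable]: "f \<in> borel_measurable borel" using borel_measurable_integrable[OF f] by simp
  let ?B = "(\<integral>x. cmod (f x) \<partial>lborel)\<^sup>2"
  have *: "\<bar>weight e x\<bar> * (cmod (fourier f x))\<^sup>2 \<le> weight e x * ?B" for x
    using weight_bounds[of e x] by (auto intro!: mult_mono power_mono fourier_bound f)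
  show ?thesis
    by (rule Bochner_Integration.integrable_bound[OF integrable_mult_left[OF integrable_norm[OF integrable_weight[OF e]], of ?B]])
       (use * in \<open>auto simp: abs_mult weight_bounds less_imp_le abs_of_pos\<close>)
qed

text \<open>
  In the right-hand side of \<open>weighted_plancherel\<close>, use \<open>2 |a b| \<le> |a|\<^sup>2 + |b|\<^sup>2\<close> and the invariance of
  the integral under translations.
\<close>

lemma nn_weighted_upper:
  fixes f :: "'a::euclidean_space \<Rightarrow> complex"
  assumes f: "f \<in> L12" and e: "e > 0"
  shows "(\<integral>\<^sup>+\<xi>. ennreal (weight e \<xi> * (cmod (fourier f \<xi>))\<^sup>2) \<partial>lborel) \<le> ennreal ((2 * pi) ^ DIM('a) * normsq lborel f)"
proof -
  let ?i = "\<lambda>x s. f x * cnj (f (x - e *\<^sub>R s)) * complex_of_real (gauss s)"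
  let ?m = "\<lambda>x s. ennreal (gauss s) * (ennreal ((cmod (f x))\<^sup>2 / 2) + ennreal ((cmod (f (x - e *\<^sub>R s)))\<^sup>2 / 2))"
  have [measurable]: "f \<in> borel_measurable borel" using f by (rule L12D)
  let ?I = "\<integral>\<xi>. weight e \<xi> * (cmod (fourier f \<xi>))\<^sup>2 \<partial>lborel"
  let ?J = "\<integral>x. \<integral>s. ?i x s \<partial>lborel \<partial>lborel"
  have I0: "?I \<ge> 0" by (intro integral_nonneg_AE AE_I2) (simp add: weight_bounds less_imp_le)
  have am: "cmod a * cmod b \<le> ((cmod a)\<^sup>2 + (cmod b)\<^sup>2) / 2" for a b
    using sum_squares_bound[of "cmod a" "cmod b"] by simp
  have "ennreal (cmod ?J) \<le> (\<integral>\<^sup>+x. ennreal (cmod (\<integral>s. ?i x s \<partial>lborel)) \<partial>lborel)"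
    by (rule norm_integral_le_nn)
  also have "\<dots> \<le> (\<integral>\<^sup>+x. \<integral>\<^sup>+s. ennreal (cmod (?i x s)) \<partial>lborel \<partial>lborel)"
    by (intro nn_integral_mono norm_integral_le_nn)
  also have "\<dots> \<le> (\<integral>\<^sup>+x. \<integral>\<^sup>+s. ?m x s \<partial>lborel \<partial>lborel)"
  proof (intro nn_integral_mono)
    fix x s :: 'a
    have "cmod (?i x s)
      \<le> gauss s * ((cmod (f x))\<^sup>2 / 2 + (cmod (f (x - e *\<^sub>R s)))\<^sup>2 / 2)"
      using mult_left_mono[OF am[of "f x" "f (x - e *\<^sub>R s)"] gauss_nonneg[of s]]
      by (simp add: norm_mult gauss_nonneg mult_ac add_divide_distrib)
    then show "ennreal (cmod (?i x s))
       \<le> ?m x s"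
      by (simp add: ennreal_plus[symmetric] ennreal_mult[symmetric] gauss_nonneg ennreal_leI del: ennreal_plus)
  qed
  also have "\<dots> = (\<integral>\<^sup>+s. \<integral>\<^sup>+x. ?m x s \<partial>lborel \<partial>lborel)"
    by (rule lborel_pair.Fubini') measurable
  also have "\<dots> = (\<integral>\<^sup>+s. ennreal (gauss s) * ennreal (normsq lborel f) \<partial>(lborel::'a measure))"
  proof (intro nn_integral_cong)
    fix s :: 'a
    have h: "(\<integral>\<^sup>+x. ennreal ((cmod (f x))\<^sup>2 / 2) \<partial>lborel) = ennreal (normsq lborel f / 2)"
      unfolding normsq_def using L2_integrable[OF L12D(2)[OF f]]
      by (subst nn_integral_eq_integral) auto
    have "(\<integral>\<^sup>+x. ennreal ((cmod (f (x - e *\<^sub>R s)))\<^sup>2 / 2) \<partial>lborel) = (\<integral>\<^sup>+x. ennreal ((cmod (f x))\<^sup>2 / 2) \<partial>lborel)"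
      using nn_integral_translate[of "\<lambda>x. ennreal ((cmod (f x))\<^sup>2 / 2)" "- e *\<^sub>R s"] by simp
    then have h': "(\<integral>\<^sup>+x. ennreal ((cmod (f (x - e *\<^sub>R s)))\<^sup>2 / 2) \<partial>lborel) = ennreal (normsq lborel f / 2)"
      using h by simp
    have "(\<integral>\<^sup>+x. ?m x s \<partial>lborel)
        = ennreal (gauss s) * (ennreal (normsq lborel f / 2) + ennreal (normsq lborel f / 2))"
      unfolding h[symmetric] by (subst nn_integral_cmult, simp, subst nn_integral_add) (auto simp: h h')
    also have "ennreal (normsq lborel f / 2) + ennreal (normsq lborel f / 2) = ennreal (normsq lborel f)"
      by (subst ennreal_plus[symmetric]) auto
    finally show "(\<integral>\<^sup>+x. ?m x s \<partial>lborel)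
        = ennreal (gauss s) * ennreal (normsq lborel f)" .
  qed
  also have "\<dots> = ennreal (normsq lborel f)"
    by (simp add: nn_integral_multc nn_integral_gauss)
  finally have J: "cmod ?J \<le> normsq lborel f" by simp
  have "?I = cmod (complex_of_real ?I)" using I0 by simp
  also have "\<dots> = (2 * pi) ^ DIM('a) * cmod ?J"
    unfolding weighted_plancherel[OF L12D(1)[OF f] e] by (simp add: norm_mult norm_power)
  also have "\<dots> \<le> (2 * pi) ^ DIM('a) * normsq lborel f"
    using J by (intro mult_left_mono) auto
  finally show ?thesis
    using integrable_weighted_fourier[OF L12D(1)[OF f] e]
    by (subst nn_integral_eq_integral) (auto simp: weight_bounds less_imp_le ennreal_leI)
qed

lemma weight_tendsto: "(\<lambda>n. weight (1 / Suc n) \<xi>) \<longlonglongrightarrow> 1"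
proof -
  have "(\<lambda>n. 1 / real (Suc n)) \<longlonglongrightarrow> 0" by (rule lim_1_over_n[THEN LIMSEQ_Suc])
  then have "(\<lambda>n. exp (- ((1 / real (Suc n)) * norm \<xi>)\<^sup>2 / 2)) \<longlonglongrightarrow> exp (- (0 * norm \<xi>)\<^sup>2 / 2)"
    by (intro tendsto_intros) auto
  then show ?thesis by (simp add: weight_def)
qed

text \<open>
  Fatou's lemma as the weight tends to 1.
\<close>

lemma fourier_L2_upper:
  fixes f :: "'a::euclidean_space \<Rightarrow> complex"
  assumes f: "f \<in> L12"
  shows "fourier f \<in> L2 lborel" "normsq lborel (fourier f) \<le> (2 * pi) ^ DIM('a) * normsq lborel f"
proof -
  have [measurable]: "f \<in> borel_measurable borel" using f by (rule L12D)
  have "(\<integral>\<^sup>+\<xi>. ennreal ((cmod (fourier f \<xi>))\<^sup>2) \<partial>lborel)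
    = (\<integral>\<^sup>+\<xi>. liminf (\<lambda>n. ennreal (weight (1 / Suc n) \<xi> * (cmod (fourier f \<xi>))\<^sup>2)) \<partial>lborel)"
  proof (intro nn_integral_cong)
    fix \<xi> :: 'a
    have "(\<lambda>n. ennreal (weight (1 / Suc n) \<xi> * (cmod (fourier f \<xi>))\<^sup>2)) \<longlonglongrightarrow> ennreal (1 * (cmod (fourier f \<xi>))\<^sup>2)"
      by (intro tendsto_ennrealI tendsto_intros weight_tendsto)
    then show "ennreal ((cmod (fourier f \<xi>))\<^sup>2) = liminf (\<lambda>n. ennreal (weight (1 / Suc n) \<xi> * (cmod (fourier f \<xi>))\<^sup>2))"
      by (intro lim_imp_Liminf[symmetric]) auto
  qed
  also have "\<dots> \<le> liminf (\<lambda>n. \<integral>\<^sup>+\<xi>. ennreal (weight (1 / Suc n) \<xi> * (cmod (fourier f \<xi>))\<^sup>2) \<partial>lborel)"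
    by (rule nn_integral_liminf) simp
  also have "\<dots> \<le> ennreal ((2 * pi) ^ DIM('a) * normsq lborel f)"
    by (intro Liminf_le always_eventually allI nn_weighted_upper f) auto
  finally have le: "(\<integral>\<^sup>+\<xi>. ennreal ((cmod (fourier f \<xi>))\<^sup>2) \<partial>lborel) \<le> ennreal ((2 * pi) ^ DIM('a) * normsq lborel f)" .
  show "fourier f \<in> L2 lborel"
    by (rule L2I_nn(1)[OF _ le]) auto
  show "normsq lborel (fourier f) \<le> (2 * pi) ^ DIM('a) * normsq lborel f"
    by (rule L2I_nn(2)[OF _ le]) auto
qed

lemma integrable_complex_indicator:
  assumes "A \<in> sets M" "emeasure M A < \<infinity>"
  shows "integrable M (indicator A :: 'a \<Rightarrow> complex)"
proof -
  have "integrable M (\<lambda>x. complex_of_real (indicator A x))"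
    using assms by (intro integrable_of_real) simp
  moreover have "(\<lambda>x. complex_of_real (indicator A x)) = indicator A"
    by (auto simp: indicator_def fun_eq_iff)
  ultimately show ?thesis by simp
qed

lemma indicator_L12:
  assumes "A \<in> sets borel" "emeasure lborel A < \<infinity>"
  shows "(indicator A :: 'a::euclidean_space \<Rightarrow> complex) \<in> L12"
    and "normsq lborel (indicator A) = measure lborel A"
proof -
  have sq: "(cmod (indicator A x))\<^sup>2 = indicator A x" for x by (simp add: indicator_def)
  show "(indicator A :: 'a \<Rightarrow> complex) \<in> L12"
    using assms integrable_complex_indicator[of A lborel] unfolding L12_def L2_def by (simp add: sq)
  show "normsq lborel (indicator A) = measure lborel A"
    using assms by (simp add: normsq_def sq)
qed

text \<open>
  For the indicator of an open set, the shifted indicator is eventually 1 at each point of the set, so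
  that Fatou's lemma applied to \<open>weighted_plancherel\<close> gives the reverse of \<open>fourier_L2_upper\<close>.
\<close>

lemma plancherel_open:
  fixes U :: "'a::euclidean_space set"
  assumes U: "open U" and fin: "emeasure lborel U < \<infinity>"
  shows "(2 * pi) ^ DIM('a) * measure lborel U \<le> normsq lborel (fourier (indicator U))"
proof -
  have [measurable]: "U \<in> sets borel" using U by simp
  let ?f = "indicator U :: 'a \<Rightarrow> complex"
  have i: "integrable lborel ?f"
    using fin by (rule integrable_complex_indicator[rotated]) simp
  have f12: "?f \<in> L12"
    by (rule indicator_L12) (use fin in auto)
  define h where "h e x = (\<integral>s. indicator U (x - e *\<^sub>R s) * gauss s \<partial>lborel)" for e :: real and x :: 'a
  have hi: "integrable lborel (\<lambda>s. indicator U (x - e *\<^sub>R s) * gauss s)" for e and x :: 'a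
    by (rule Bochner_Integration.integrable_bound[OF integrable_gauss]) (auto simp: indicator_def)
  have h_nn: "ennreal (h e x) = (\<integral>\<^sup>+s. ennreal (indicator U (x - e *\<^sub>R s) * gauss s) \<partial>lborel)" for e x
    unfolding h_def by (rule nn_integral_eq_integral[OF hi, symmetric]) (auto simp: gauss_nonneg)
  have h0: "0 \<le> h e x" for e x unfolding h_def by (intro integral_nonneg_AE) (auto simp: gauss_nonneg)
  have h1: "h e x \<le> 1" for e x
  proof -
    have "ennreal (h e x) \<le> (\<integral>\<^sup>+s. ennreal (gauss s) \<partial>(lborel::'a measure))"
      unfolding h_nn by (intro nn_integral_mono ennreal_leI) (auto simp: indicator_def gauss_nonneg)
    then show ?thesis by (simp add: nn_integral_gauss)
  qed
  have [measurable]: "h e \<in> borel_measurable borel" for e unfolding h_def by measurable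
  have Uh: "integrable lborel (\<lambda>x. indicator U x * h e x)" for e
    by (rule Bochner_Integration.integrable_bound[OF i]) (auto simp: indicator_def h0 h1)
  have le: "(\<integral>\<^sup>+x. ennreal (indicator U x * h e x) \<partial>lborel) \<le> ennreal (normsq lborel (fourier ?f) / (2 * pi) ^ DIM('a))" if e: "e > 0" for e
  proof -
    have "complex_of_real (\<integral>\<xi>. weight e \<xi> * (cmod (fourier ?f \<xi>))\<^sup>2 \<partial>lborel)
      = complex_of_real ((2 * pi) ^ DIM('a)) * (\<integral>x. \<integral>s. complex_of_real (indicator U x * (indicator U (x - e *\<^sub>R s) * gauss s)) \<partial>lborel \<partial>lborel)"
      unfolding weighted_plancherel[OF i e]
      by (intro arg_cong2[where f="(*)"] Bochner_Integration.integral_cong refl) (auto simp: indicator_def)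
    also have "\<dots> = complex_of_real ((2 * pi) ^ DIM('a) * (\<integral>x. indicator U x * h e x \<partial>lborel))"
      unfolding integral_complex_of_real h_def by simp
    finally have "(2 * pi) ^ DIM('a) * (\<integral>x. indicator U x * h e x \<partial>lborel) = (\<integral>\<xi>. weight e \<xi> * (cmod (fourier ?f \<xi>))\<^sup>2 \<partial>lborel)"
      by (simp only: of_real_eq_iff)
    also have "\<dots> \<le> normsq lborel (fourier ?f)"
      unfolding normsq_def
      by (intro integral_mono integrable_weighted_fourier[OF i e] L2_integrable fourier_L2_upper f12)
         (auto intro!: mult_left_le_one_le simp: weight_bounds less_imp_le)
    finally show ?thesis
      by (subst nn_integral_eq_integral[OF Uh]) (auto simp: h0 field_simps intro!: ennreal_leI)
  qed
  have "emeasure lborel U = (\<integral>\<^sup>+x. indicator U x * (\<integral>\<^sup>+s. ennreal (gauss s) \<partial>(lborel::'a measure)) \<partial>lborel)"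
    by (simp add: nn_integral_gauss)
  also have "\<dots> \<le> (\<integral>\<^sup>+x. liminf (\<lambda>n. ennreal (indicator U x * h (1 / Suc n) x)) \<partial>lborel)"
  proof (intro nn_integral_mono)
    fix x :: 'a
    show "indicator U x * (\<integral>\<^sup>+s. ennreal (gauss s) \<partial>(lborel::'a measure)) \<le> liminf (\<lambda>n. ennreal (indicator U x * h (1 / Suc n) x))"
    proof (cases "x \<in> U")
      case True
      have "(\<integral>\<^sup>+s. ennreal (gauss s) \<partial>(lborel::'a measure)) \<le> (\<integral>\<^sup>+s. liminf (\<lambda>n. ennreal (indicator U (x - (1 / Suc n) *\<^sub>R s) * gauss s)) \<partial>lborel)"
      proof (intro nn_integral_mono)
        fix s :: 'a
        have "(\<lambda>n. x - (1 / real (Suc n)) *\<^sub>R s) \<longlonglongrightarrow> x - 0 *\<^sub>R s"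
          by (intro tendsto_intros lim_1_over_n[THEN LIMSEQ_Suc])
        then have "\<forall>\<^sub>F n in sequentially. x - (1 / real (Suc n)) *\<^sub>R s \<in> U"
          using U True by (simp add: topological_tendstoD)
        then have "\<forall>\<^sub>F n in sequentially. ennreal (gauss s) \<le> ennreal (indicator U (x - (1 / Suc n) *\<^sub>R s) * gauss s)"
          by eventually_elim simp
        then show "ennreal (gauss s) \<le> liminf (\<lambda>n. ennreal (indicator U (x - (1 / Suc n) *\<^sub>R s) * gauss s))"
          by (rule Liminf_bounded)
      qed
      also have "\<dots> \<le> liminf (\<lambda>n. \<integral>\<^sup>+s. ennreal (indicator U (x - (1 / Suc n) *\<^sub>R s) * gauss s) \<partial>lborel)"
        by (rule nn_integral_liminf) measurable
      finally show ?thesis using True by (simp add: h_nn)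
    qed simp
  qed
  also have "\<dots> \<le> liminf (\<lambda>n. \<integral>\<^sup>+x. ennreal (indicator U x * h (1 / Suc n) x) \<partial>lborel)"
    by (rule nn_integral_liminf) measurable
  also have "\<dots> \<le> ennreal (normsq lborel (fourier ?f) / (2 * pi) ^ DIM('a))"
    by (intro Liminf_le always_eventually allI le) auto
  finally have "measure lborel U \<le> normsq lborel (fourier ?f) / (2 * pi) ^ DIM('a)"
    using fin by (simp add: emeasure_eq_ennreal_measure)
  then show ?thesis by (simp add: field_simps)
qed

lemma L12_add: "f \<in> L12 \<Longrightarrow> g \<in> L12 \<Longrightarrow> (\<lambda>x. f x + g x) \<in> L12"
  by (auto simp: L12_def L2_add)

lemma L12_diff: "f \<in> L12 \<Longrightarrow> g \<in> L12 \<Longrightarrow> (\<lambda>x. f x - g x) \<in> L12"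
  by (auto simp: L12_def L2_diff)

lemma L12_cmult: "f \<in> L12 \<Longrightarrow> (\<lambda>x. c * f x) \<in> L12"
  by (auto simp: L12_def L2_cmult)

text \<open>
  The amount by which Plancherel's identity fails. It is a nonnegative quadratic form, and
  \<open>defect (f + g) \<le> 2 defect f + 2 defect g\<close> makes its zeros a linear subspace, closed in $L^2$ because
  the defect is bounded by the square norm.
\<close>

definition defect :: "('a::euclidean_space \<Rightarrow> complex) \<Rightarrow> real" where
  "defect f = (2 * pi) ^ DIM('a) * normsq lborel f - normsq lborel (fourier f)"

lemma defect_nonneg: "f \<in> L12 \<Longrightarrow> 0 \<le> defect f"
  using fourier_L2_upper(2)[of f] by (simp add: defect_def)

lemma defect_le: "defect f \<le> (2 * pi) ^ DIM('a) * normsq lborel f" for f :: "'a::euclidean_space \<Rightarrow> complex"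
  by (simp add: defect_def)

lemma defect_parallelogram:
  assumes "f \<in> L12" "g \<in> L12"
  shows "defect (\<lambda>x. f x + g x) + defect (\<lambda>x. f x - g x) = 2 * defect f + 2 * defect g"
proof -
  have "fourier (\<lambda>x. f x + g x) = (\<lambda>\<xi>. fourier f \<xi> + fourier g \<xi>)"
    "fourier (\<lambda>x. f x - g x) = (\<lambda>\<xi>. fourier f \<xi> - fourier g \<xi>)"
    using assms by (auto simp: fun_eq_iff fourier_add fourier_diff L12D)
  moreover note normsq_parallelogram[OF fourier_L2_upper(1) fourier_L2_upper(1), OF assms]
  moreover have "(2 * pi) ^ DIM('a) * (normsq lborel (\<lambda>x. f x + g x) + normsq lborel (\<lambda>x. f x - g x))
      = (2 * pi) ^ DIM('a) * (2 * normsq lborel f + 2 * normsq lborel g)"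
    using normsq_parallelogram[OF L12D(2) L12D(2), OF assms] by simp
  ultimately show ?thesis by (simp add: defect_def distrib_left)
qed

lemma defect_add_le:
  assumes "f \<in> L12" "g \<in> L12"
  shows "defect (\<lambda>x. f x + g x) \<le> 2 * defect f + 2 * defect g"
  using defect_parallelogram[OF assms] defect_nonneg[OF L12_diff[OF assms]] by linarith

lemma defect_diff_le:
  assumes "f \<in> L12" "g \<in> L12"
  shows "defect (\<lambda>x. f x - g x) \<le> 2 * defect f + 2 * defect g"
  using defect_parallelogram[OF assms] defect_nonneg[OF L12_add[OF assms]] by linarith

lemma defect_cmult: "defect (\<lambda>x. c * f x) = (cmod c)\<^sup>2 * defect f"
  using normsq_cmult[of lborel c "fourier f"]
  by (simp add: defect_def normsq_cmult fourier_cmult[abs_def] right_diff_distrib mult_ac)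

text \<open>
  By outer regularity the indicator is the difference of the indicators of an open set, without
  defect, and of a set of small measure, with small defect.
\<close>

lemma defect_indicator:
  fixes A :: "'a::euclidean_space set"
  assumes A[measurable]: "A \<in> sets borel" and fin: "emeasure lborel A < \<infinity>"
  shows "defect (indicator A) = 0"
proof -
  let ?c = "(2 * pi) ^ DIM('a)"
  have "defect (indicator A) \<le> e" if e: "e > 0" for e
  proof -
    \<comment> \<open>Chosen so that twice the bound \<open>?c * d\<close> for the defect of the remainder is \<open>e\<close>.\<close>
    define d where "d = e / (2 * ?c)"
    have d: "d > 0" using e by (simp add: d_def)
    obtain U where U: "open U" "A \<subseteq> U" "emeasure lborel (U - A) < ennreal d"
      using outer_regular_lborel[OF A d] by blast
    have [measurable]: "U \<in> sets borel" using U by simp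
    have UA: "emeasure lborel (U - A) < \<infinity>" using U(3) by (rule less_trans) simp
    have "emeasure lborel U \<le> emeasure lborel (U - A) + emeasure lborel A"
      using emeasure_subadditive[of "U - A" lborel A] \<open>A \<subseteq> U\<close> by (simp add: Un_absorb2)
    also have "\<dots> < \<infinity>" using fin UA by simp
    finally have Uf: "emeasure lborel U < \<infinity>" .
    have "defect (indicator U) = 0"
      using plancherel_open[OF U(1) Uf] defect_nonneg[OF indicator_L12(1)[of U]] Uf
      by (simp add: defect_def indicator_L12(2))
    moreover have "(\<lambda>x. indicator U x - indicator (U - A) x) = (indicator A :: 'a \<Rightarrow> complex)"
      using U(2) by (auto simp: indicator_def fun_eq_iff)
    ultimately have "defect (indicator A) \<le> 2 * defect (indicator (U - A))"
      using defect_diff_le[OF indicator_L12(1) indicator_L12(1), of U "U - A"] Uf UA by simp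
    also have "\<dots> \<le> 2 * (?c * measure lborel (U - A))"
      using defect_le[of "indicator (U - A)"] UA by (simp add: indicator_L12(2))
    also have "\<dots> \<le> 2 * (?c * d)"
      using U(3) UA d by (intro mult_left_mono) (auto simp: emeasure_eq_ennreal_measure ennreal_less_iff)
    also have "\<dots> = e" by (simp add: d_def)
    finally show ?thesis .
  qed
  then have "defect (indicator A) \<le> 0"
    by (rule field_le_epsilon[where y = 0, simplified])
  then show ?thesis
    using defect_nonneg[OF indicator_L12(1)[OF assms]] by linarith
qed

lemma defect_sum:
  assumes "finite I" "\<And>i. i \<in> I \<Longrightarrow> f i \<in> L12 \<and> defect (f i) = 0"
  shows "(\<lambda>x. \<Sum>i\<in>I. f i x) \<in> L12 \<and> defect (\<lambda>x. \<Sum>i\<in>I. f i x) = 0"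
  using assms
proof (induction I)
  case empty
  have "(\<lambda>x. 0) \<in> L12" by (simp add: L12_def L2_def)
  then show ?case using defect_cmult[of 0 "\<lambda>x. 0"] by simp
next
  case (insert i I)
  then have *: "(\<lambda>x. \<Sum>i\<in>I. f i x) \<in> L12" "defect (\<lambda>x. \<Sum>i\<in>I. f i x) = 0" "f i \<in> L12" "defect (f i) = 0"
    by auto
  have "(\<lambda>x. f i x + (\<Sum>i\<in>I. f i x)) \<in> L12" by (intro L12_add *)
  with defect_add_le[OF *(3,1)] defect_nonneg[OF this] insert show ?case
    by (simp add: *)
qed

text \<open>
  The value 0 is left out of the sum because the corresponding level set may have infinite measure.
\<close>

lemma defect_simple:
  fixes s :: "'a::euclidean_space \<Rightarrow> complex"
  assumes s: "simple_function lborel s" and i: "integrable lborel s"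
  shows "s \<in> L12 \<and> defect s = 0"
proof -
  let ?R = "range s - {0}"
  have fin: "finite ?R" using simple_functionD(1)[OF s] by simp
  have [measurable]: "s \<in> borel_measurable borel" using borel_measurable_integrable[OF i] by simp
  have eq: "s = (\<lambda>x. \<Sum>y\<in>?R. y * indicator (s -` {y}) x)"
  proof
    fix x
    have "(\<Sum>y\<in>?R. y * indicator (s -` {y}) x) = (\<Sum>y\<in>?R. if y = s x then y else 0)"
      by (intro sum.cong) (auto simp: indicator_def)
    also have "\<dots> = s x" using fin by (simp add: sum.delta)
    finally show "s x = (\<Sum>y\<in>?R. y * indicator (s -` {y}) x)" ..
  qed
  have "(\<lambda>x. y * indicator (s -` {y}) x) \<in> L12 \<and> defect (\<lambda>x. y * indicator (s -` {y}) x) = 0" if y: "y \<in> ?R" for y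
  proof -
    have meas: "s -` {y} \<in> sets borel" using measurable_sets[of s borel borel "{y}"] by simp
    have "ennreal (cmod y) * emeasure lborel (s -` {y}) = (\<integral>\<^sup>+x. ennreal (cmod y) * indicator (s -` {y}) x \<partial>lborel)"
      using meas by (simp add: nn_integral_cmult)
    also have "\<dots> \<le> (\<integral>\<^sup>+x. ennreal (cmod (s x)) \<partial>lborel)"
      by (intro nn_integral_mono) (auto simp: indicator_def)
    also have "\<dots> < \<infinity>" using i by (simp add: integrable_iff_bounded)
    finally have "emeasure lborel (s -` {y}) < \<infinity>"
      using y by (auto simp: ennreal_mult_less_top)
    then show ?thesis
      using meas by (simp add: L12_cmult indicator_L12(1) defect_cmult defect_indicator)
  qed
  from defect_sum[OF fin this] show ?thesis
    by (subst (1 2) eq) simp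
qed

text \<open>
  Simple functions dominated by \<open>2 |f|\<close> that converge pointwise to \<open>f\<close> also converge in $L^2$. They have
  no defect, so the defect of \<open>f\<close> is bounded by the square norm of an arbitrarily small remainder.
\<close>

theorem plancherel:
  fixes f :: "'a::euclidean_space \<Rightarrow> complex"
  assumes f: "f \<in> L12"
  shows "fourier f \<in> L2 lborel" and "normsq lborel (fourier f) = (2 * pi) ^ DIM('a) * normsq lborel f"
proof -
  show "fourier f \<in> L2 lborel" by (rule fourier_L2_upper[OF f])
  have [measurable]: "f \<in> borel_measurable borel" using f by (rule L12D)
  have "f \<in> borel_measurable lborel" by simp
  from borel_measurable_implies_sequence_metric[OF this, of 0]
  obtain s where s: "\<And>i. simple_function lborel (s i)" "\<And>x. (\<lambda>i. s i x) \<longlonglongrightarrow> f x"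
    and sb: "\<And>i x. cmod (s i x) \<le> 2 * cmod (f x)"
    by auto
  have sm[measurable]: "s i \<in> borel_measurable borel" for i
    using borel_measurable_simple_function[OF s(1)[of i]] by simp
  have "integrable lborel (s i)" for i
    by (rule Bochner_Integration.integrable_bound[OF integrable_mult_right[OF integrable_norm[OF L12D(1)[OF f]], of 2]])
       (use sb in auto)
  then have s12: "s i \<in> L12" and d0: "defect (s i) = 0" for i
    using defect_simple[OF s(1)] by auto
  have "(\<lambda>i. normsq lborel (\<lambda>x. f x - s i x)) \<longlonglongrightarrow> (\<integral>x. 0 \<partial>(lborel :: 'a measure))"
    unfolding normsq_def
  proof (rule integral_dominated_convergence[where w="\<lambda>x. 9 * (cmod (f x))\<^sup>2"])
    show "AE x in lborel. (\<lambda>i. (cmod (f x - s i x))\<^sup>2) \<longlonglongrightarrow> 0"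
    proof (rule AE_I2)
      fix x
      have "(\<lambda>i. (cmod (f x - s i x))\<^sup>2) \<longlonglongrightarrow> (cmod (f x - f x))\<^sup>2"
        by (intro tendsto_intros s(2))
      then show "(\<lambda>i. (cmod (f x - s i x))\<^sup>2) \<longlonglongrightarrow> 0" by simp
    qed
    show "AE x in lborel. norm ((cmod (f x - s i x))\<^sup>2) \<le> 9 * (cmod (f x))\<^sup>2" for i
    proof (rule AE_I2)
      fix x
      have "cmod (f x - s i x) \<le> 3 * cmod (f x)"
        using norm_triangle_ineq4[of "f x" "s i x"] sb[of i x] by linarith
      from power_mono[OF this, of 2] show "norm ((cmod (f x - s i x))\<^sup>2) \<le> 9 * (cmod (f x))\<^sup>2"
        by (simp add: power_mult_distrib)
    qed
  qed (use L2_integrable[OF L12D(2)[OF f]] in auto)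
  then have lim: "(\<lambda>i. 2 * ((2 * pi) ^ DIM('a) * normsq lborel (\<lambda>x. f x - s i x))) \<longlonglongrightarrow> 2 * ((2 * pi) ^ DIM('a) * 0)"
    by (intro tendsto_intros) simp
  have "defect f \<le> 2 * ((2 * pi) ^ DIM('a) * normsq lborel (\<lambda>x. f x - s i x))" for i
    using defect_add_le[OF s12[of i] L12_diff[OF f s12[of i]]] defect_le[of "\<lambda>x. f x - s i x"]
    by (simp add: d0)
  then have "defect f \<le> 2 * ((2 * pi) ^ DIM('a) * 0)"
    by (intro LIMSEQ_le_const[OF lim]) blast
  then have "defect f \<le> 0" by simp
  then show "normsq lborel (fourier f) = (2 * pi) ^ DIM('a) * normsq lborel f"
    using defect_nonneg[OF f] by (simp add: defect_def)
qed

section \<open>Correlations\<close>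

lemma affine_reflect:
  fixes t :: "'a::euclidean_space"
  shows "f \<in> borel_measurable borel \<Longrightarrow> (\<integral>\<^sup>+b. f (t - b) \<partial>lborel) = (\<integral>\<^sup>+b. f b \<partial>lborel)"
    and "g \<in> borel_measurable borel \<Longrightarrow> (\<integral>b. g (t - b) \<partial>lborel) = (\<integral>b. g b \<partial>lborel :: complex)"
  using nn_integral_affine[of 1 "\<lambda>x. t + (-1) *\<^sub>R x" f] integral_affine[of 1 "\<lambda>x. t + (-1) *\<^sub>R x" g]
    lborel_affine'[of "-1" t]
  by auto

lemma L2_translate:
  fixes h :: "'a::euclidean_space \<Rightarrow> complex"
  assumes "h \<in> L2 lborel"
  shows "(\<lambda>t. h (t - b)) \<in> L2 lborel" "normsq lborel (\<lambda>t. h (t - b)) = normsq lborel h"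
proof -
  have [measurable]: "h \<in> borel_measurable borel" using assms by (simp add: L2_def)
  have eq: "(\<integral>\<^sup>+t. ennreal ((cmod (h (t - b)))\<^sup>2) \<partial>lborel) = ennreal (normsq lborel h)"
    using nn_integral_translate[of "\<lambda>t. ennreal ((cmod (h t))\<^sup>2)" "-b"] nn_integral_eq_normsq[OF assms] by simp
  show 1: "(\<lambda>t. h (t - b)) \<in> L2 lborel"
    by (simp add: L2_iff_nn eq)
  show "normsq lborel (\<lambda>t. h (t - b)) = normsq lborel h"
    using eq nn_integral_eq_normsq[OF 1] by simp
qed

text \<open>
  The inner product of \<open>g\<close> with the translate of \<open>h\<close> by \<open>b\<close>. For fixed dilation parameter the wavelet
  transform has this form.
\<close>

definition corr :: "('a::euclidean_space \<Rightarrow> complex) \<Rightarrow> ('a \<Rightarrow> complex) \<Rightarrow> 'a \<Rightarrow> complex" where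
  "corr g h b = (\<integral>t. g t * cnj (h (t - b)) \<partial>lborel)"

lemma corr_ip: "corr g h b = ip lborel g (\<lambda>t. h (t - b))"
  by (simp add: corr_def ip_def)

lemma corr_measurable:
  assumes [measurable]: "g \<in> borel_measurable borel" "h \<in> borel_measurable borel"
  shows "corr g h \<in> borel_measurable borel"
  unfolding corr_def by measurable

lemma corr_bound:
  assumes "g \<in> L2 lborel" "h \<in> L2 lborel"
  shows "(cmod (corr g h b))\<^sup>2 \<le> normsq lborel g * normsq lborel h"
  unfolding corr_ip using L2_Cauchy_Schwarz[OF assms(1) L2_translate(1)[OF assms(2)]] L2_translate(2)[OF assms(2)]
  by simp

lemma corr_diff:
  assumes "g \<in> L2 lborel" "h \<in> L2 lborel" "k \<in> L2 lborel"
  shows "corr g (\<lambda>x. h x - k x) b = corr g h b - corr g k b"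
  unfolding corr_def using ip_integrable[OF assms(1) L2_translate(1)[OF assms(2), of b]]
    ip_integrable[OF assms(1) L2_translate(1)[OF assms(3), of b]]
  by (simp add: right_diff_distrib)

lemma corr_pair_integrable:
  fixes g h :: "'a::euclidean_space \<Rightarrow> complex"
  assumes g: "integrable lborel g" and h: "integrable lborel h"
  shows "integrable (lborel \<Otimes>\<^sub>M lborel) (\<lambda>(t, b). g t * cnj (h (t - b)))"
proof (rule integrableI_bounded)
  have [measurable]: "g \<in> borel_measurable borel" "h \<in> borel_measurable borel"
    using borel_measurable_integrable[OF g] borel_measurable_integrable[OF h] by auto
  show "(\<lambda>(t, b). g t * cnj (h (t - b))) \<in> borel_measurable (lborel \<Otimes>\<^sub>M lborel)" by measurable
  have "(\<integral>\<^sup>+z. ennreal (norm (case z of (t, b) \<Rightarrow> g t * cnj (h (t - b)))) \<partial>(lborel \<Otimes>\<^sub>M lborel))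
     = (\<integral>\<^sup>+t. \<integral>\<^sup>+b. ennreal (cmod (g t)) * ennreal (cmod (h (t - b))) \<partial>lborel \<partial>lborel)"
    by (subst lborel.nn_integral_fst[symmetric]) (auto simp: norm_mult ennreal_mult)
  also have "\<dots> = (\<integral>\<^sup>+t. ennreal (cmod (g t)) * (\<integral>\<^sup>+b. ennreal (cmod (h b)) \<partial>lborel) \<partial>lborel)"
    using affine_reflect(1)[of "\<lambda>b. ennreal (cmod (h b))"]
    by (intro nn_integral_cong) (simp add: nn_integral_cmult)
  also have "\<dots> < \<infinity>"
    using g h by (auto simp: nn_integral_multc integrable_iff_bounded ennreal_mult_less_top)
  finally show "(\<integral>\<^sup>+z. ennreal (norm (case z of (t, b) \<Rightarrow> g t * cnj (h (t - b)))) \<partial>(lborel \<Otimes>\<^sub>M lborel)) < \<infinity>" .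
qed

lemma corr_L12:
  fixes g h :: "'a::euclidean_space \<Rightarrow> complex"
  assumes g: "g \<in> L12" and h: "h \<in> L12"
  shows "corr g h \<in> L12"
proof -
  have [measurable]: "g \<in> borel_measurable borel" "h \<in> borel_measurable borel"
    using g h by (auto intro: L12D)
  have i: "integrable lborel (corr g h)"
    using lborel_pair.integrable_snd[OF corr_pair_integrable[OF L12D(1)[OF g] L12D(1)[OF h]]]
    by (simp add: corr_def[abs_def])
  have [measurable]: "corr g h \<in> borel_measurable borel" by (intro corr_measurable) auto
  define K where "K = sqrt (normsq lborel g * normsq lborel h)"
  have K: "cmod (corr g h b) \<le> K" for b
    unfolding K_def by (intro real_le_rsqrt corr_bound L12D g h)
  have "integrable lborel (\<lambda>b. (cmod (corr g h b))\<^sup>2)"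
  proof (rule Bochner_Integration.integrable_bound[OF integrable_mult_right[OF integrable_norm[OF i], of K]])
    show "AE x in lborel. norm ((cmod (corr g h x))\<^sup>2) \<le> norm (K * cmod (corr g h x))"
      using K order_trans[OF norm_ge_zero K]
      by (auto simp: power2_eq_square abs_mult intro!: mult_right_mono)
  qed simp
  then show ?thesis using i by (simp add: L12_def L2_def)
qed

lemma fourier_corr:
  fixes g h :: "'a::euclidean_space \<Rightarrow> complex"
  assumes g: "integrable lborel g" and h: "integrable lborel h"
  shows "fourier (corr g h) \<xi> = fourier g \<xi> * cnj (fourier h \<xi>)"
proof -
  have [measurable]: "g \<in> borel_measurable borel" "h \<in> borel_measurable borel"
    using borel_measurable_integrable[OF g] borel_measurable_integrable[OF h] by auto
  have int: "integrable (lborel \<Otimes>\<^sub>M lborel) (\<lambda>(t, b). g t * cnj (h (t - b)) * cis (- (b \<bullet> \<xi>)))"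
    by (rule Bochner_Integration.integrable_bound[OF corr_pair_integrable[OF g h]])
       (auto simp: norm_mult)
  have "fourier (corr g h) \<xi> = (\<integral>b. \<integral>t. g t * cnj (h (t - b)) * cis (- (b \<bullet> \<xi>)) \<partial>lborel \<partial>lborel)"
    unfolding fourier_def corr_def by simp
  also have "\<dots> = (\<integral>t. \<integral>b. g t * cnj (h (t - b)) * cis (- (b \<bullet> \<xi>)) \<partial>lborel \<partial>lborel)"
    by (rule lborel_pair.Fubini_integral[OF int])
  also have "\<dots> = (\<integral>t. g t * cis (- (t \<bullet> \<xi>)) * cnj (fourier h \<xi>) \<partial>lborel)"
  proof (intro Bochner_Integration.integral_cong refl)
    fix t
    have "(\<integral>b. g t * cnj (h (t - b)) * cis (- (b \<bullet> \<xi>)) \<partial>lborel)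
        = (\<integral>s. g t * cnj (h (t - (t - s))) * cis (- ((t - s) \<bullet> \<xi>)) \<partial>lborel)"
      by (rule affine_reflect(2)[symmetric]) measurable
    also have "\<dots> = (\<integral>s. g t * cis (- (t \<bullet> \<xi>)) * cnj (h s * cis (- (s \<bullet> \<xi>))) \<partial>lborel)"
      by (intro Bochner_Integration.integral_cong refl)
         (simp add: inner_diff_left cis_cnj cis_divide[symmetric] field_simps cis_mult)
    also have "\<dots> = g t * cis (- (t \<bullet> \<xi>)) * cnj (fourier h \<xi>)"
      unfolding fourier_def Bochner_Integration.integral_cnj[symmetric] by (rule integral_mult_right_zero)
    finally show "(\<integral>b. g t * cnj (h (t - b)) * cis (- (b \<bullet> \<xi>)) \<partial>lborel) = g t * cis (- (t \<bullet> \<xi>)) * cnj (fourier h \<xi>)" .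
  qed
  also have "\<dots> = fourier g \<xi> * cnj (fourier h \<xi>)"
    unfolding fourier_def by (rule integral_mult_left_zero)
  finally show ?thesis .
qed

text \<open>
  If \<open>h\<close> is also integrable, this is Plancherel's theorem together with the product formula
  \<open>fourier_corr\<close>. In general \<open>h\<close> and its Fourier transform \<open>H\<close> are limits of \<open>hn n\<close> and of their
  transforms. Because the Fourier transform of \<open>g\<close> is bounded, the right-hand sides converge, and
  because their differences are again of this form, the correlations form a Cauchy sequence; their
  pointwise limit is the correlation with \<open>h\<close>.
\<close>

theorem corr_normsq:
  fixes g h :: "'a::euclidean_space \<Rightarrow> complex"
  assumes g: "g \<in> L12" and h: "h \<in> L2 lborel" and hn: "\<And>n. hn n \<in> L12"
    and lim: "(\<lambda>n. normsq lborel (\<lambda>x. hn n x - h x)) \<longlonglongrightarrow> 0"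
    and H: "H \<in> L2 lborel" and Hlim: "(\<lambda>n. normsq lborel (\<lambda>x. fourier (hn n) x - H x)) \<longlonglongrightarrow> 0"
  shows "corr g h \<in> L2 lborel"
    and "(2 * pi) ^ DIM('a) * normsq lborel (corr g h) = normsq lborel (\<lambda>\<xi>. fourier g \<xi> * cnj (H \<xi>))"
proof -
  let ?c = "(2 * pi) ^ DIM('a)"
  have c: "?c > 0" by simp
  have [measurable]: "g \<in> borel_measurable borel" "h \<in> borel_measurable borel"
    using g h by (auto simp: L12D L2_def)
  define K where "K = (\<integral>x. cmod (g x) \<partial>lborel)"
  have mult: "(\<lambda>\<xi>. fourier g \<xi> * cnj (k \<xi>)) \<in> L2 lborel \<and>
      normsq lborel (\<lambda>\<xi>. fourier g \<xi> * cnj (k \<xi>)) \<le> K\<^sup>2 * normsq lborel k" if k: "k \<in> L2 lborel" for k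
  proof -
    have [measurable]: "k \<in> borel_measurable borel" using k by (simp add: L2_def)
    have "cmod (fourier g x * cnj (k x)) \<le> K * cmod (k x)" for x
      unfolding K_def using fourier_bound[OF L12D(1)[OF g], of x] by (auto simp: norm_mult intro: mult_right_mono)
    then show ?thesis using L2_bound[OF k, of "\<lambda>\<xi>. fourier g \<xi> * cnj (k \<xi>)" K] by simp
  qed
  have pl: "?c * normsq lborel (corr g k) = normsq lborel (\<lambda>\<xi>. fourier g \<xi> * cnj (fourier k \<xi>))" if k: "k \<in> L12" for k
  proof -
    have "fourier (corr g k) = (\<lambda>\<xi>. fourier g \<xi> * cnj (fourier k \<xi>))"
      by (intro ext fourier_corr L12D g k)
    then show ?thesis using plancherel(2)[OF corr_L12[OF g k]] by simp
  qed
  have F: "fourier (hn n) \<in> L2 lborel" for n by (rule plancherel(1)[OF hn])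
  have u: "corr g (hn n) \<in> L2 lborel" for n by (rule L12D(2)[OF corr_L12[OF g hn]])
  have cauchy: "L2_Cauchy lborel (\<lambda>n. corr g (hn n))"
    unfolding L2_Cauchy_def
  proof (intro conjI allI impI u)
    fix e :: real assume e: "e > 0"
    have "0 < e * ?c / (K\<^sup>2 + 1)" using e by (simp add: add_nonneg_pos)
    then obtain N where N: "normsq lborel (\<lambda>x. fourier (hn m) x - fourier (hn n) x) < e * ?c / (K\<^sup>2 + 1)" if "m \<ge> N" "n \<ge> N" for m n
      using L2_tendsto_Cauchy[OF F H Hlim] unfolding L2_Cauchy_def by blast
    have "normsq lborel (\<lambda>x. corr g (hn m) x - corr g (hn n) x) < e" if mn: "m \<ge> N" "n \<ge> N" for m n
    proof -
      let ?d = "\<lambda>x. hn m x - hn n x"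
      have Fd: "fourier ?d = (\<lambda>\<xi>. fourier (hn m) \<xi> - fourier (hn n) \<xi>)"
        by (auto simp: fun_eq_iff fourier_diff L12D hn)
      have "(\<lambda>x. corr g (hn m) x - corr g (hn n) x) = corr g ?d"
        by (auto simp: fun_eq_iff corr_diff L12D g hn)
      then have "?c * normsq lborel (\<lambda>x. corr g (hn m) x - corr g (hn n) x) = normsq lborel (\<lambda>\<xi>. fourier g \<xi> * cnj (fourier ?d \<xi>))"
        using pl[OF L12_diff[OF hn hn], of m n] by simp
      also have "\<dots> \<le> K\<^sup>2 * normsq lborel (fourier ?d)"
        using mult[OF plancherel(1)[OF L12_diff[OF hn hn], of m n]] by blast
      also have "\<dots> \<le> (K\<^sup>2 + 1) * normsq lborel (fourier ?d)"
        by (intro mult_right_mono) auto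
      also have "\<dots> < ?c * e"
        using N[OF mn] unfolding Fd by (simp add: pos_less_divide_eq add_nonneg_pos mult_ac)
      finally show ?thesis using c by (simp only: mult_less_cancel_left_pos)
    qed
    then show "\<exists>N. \<forall>m\<ge>N. \<forall>n\<ge>N. normsq lborel (\<lambda>x. corr g (hn m) x - corr g (hn n) x) < e" by blast
  qed
  have ptw: "(\<lambda>n. corr g (hn n) b) \<longlonglongrightarrow> corr g h b" for b
  proof (rule LIM_zero_cancel, rule Lim_null_comparison)
    show "\<forall>\<^sub>F n in sequentially. norm (corr g (hn n) b - corr g h b) \<le> sqrt (normsq lborel g * normsq lborel (\<lambda>x. hn n x - h x))"
      using corr_bound[OF L12D(2)[OF g] L2_diff[OF L12D(2)[OF hn] h]]
      by (auto intro!: always_eventually real_le_rsqrt simp: corr_diff[symmetric] L12D g hn h)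
    show "(\<lambda>n. sqrt (normsq lborel g * normsq lborel (\<lambda>x. hn n x - h x))) \<longlonglongrightarrow> 0"
      using tendsto_real_sqrt[OF tendsto_mult_right_zero[OF lim, of "normsq lborel g"]] by simp
  qed
  have meas: "corr g h \<in> borel_measurable lborel" using corr_measurable[of g h] by simp
  have ae: "AE b in lborel. (\<lambda>n. corr g (hn (id n)) b) \<longlonglongrightarrow> corr g h b"
    using ptw by simp
  note L = L2_Cauchy_limit[OF cauchy meas strict_mono_id ae]
  show "corr g h \<in> L2 lborel" by (rule L(1))
  have "(\<lambda>n. ?c * normsq lborel (corr g (hn n))) \<longlonglongrightarrow> ?c * normsq lborel (corr g h)"
    by (intro tendsto_intros normsq_tendsto u L)
  moreover have "(\<lambda>n. normsq lborel (\<lambda>\<xi>. fourier g \<xi> * cnj (fourier (hn n) \<xi>))) \<longlonglongrightarrow> normsq lborel (\<lambda>\<xi>. fourier g \<xi> * cnj (H \<xi>))"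
  proof (intro normsq_tendsto)
    show "(\<lambda>n. normsq lborel (\<lambda>x. fourier g x * cnj (fourier (hn n) x) - fourier g x * cnj (H x))) \<longlonglongrightarrow> 0"
    proof (rule Lim_null_comparison)
      show "\<forall>\<^sub>F n in sequentially. norm (normsq lborel (\<lambda>x. fourier g x * cnj (fourier (hn n) x) - fourier g x * cnj (H x)))
          \<le> K\<^sup>2 * normsq lborel (\<lambda>x. fourier (hn n) x - H x)"
        using mult[OF L2_diff[OF F H]] by (auto intro!: always_eventually simp: right_diff_distrib)
      show "(\<lambda>n. K\<^sup>2 * normsq lborel (\<lambda>x. fourier (hn n) x - H x)) \<longlonglongrightarrow> 0"
        by (rule tendsto_mult_right_zero[OF Hlim])
    qed
  qed (use mult F H in auto)
  ultimately show "?c * normsq lborel (corr g h) = normsq lborel (\<lambda>\<xi>. fourier g \<xi> * cnj (H \<xi>))"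
    unfolding pl[OF hn] by (rule LIMSEQ_unique)
qed

section \<open>The Fourier transform of a square-integrable function\<close>

definition trunc :: "nat \<Rightarrow> ('a::euclidean_space \<Rightarrow> complex) \<Rightarrow> 'a \<Rightarrow> complex" where
  "trunc n f x = indicator (cball 0 (real n)) x * f x"

lemma trunc_L12:
  assumes f: "f \<in> L2 lborel"
  shows "trunc n f \<in> L12"
proof -
  have b: "indicator (cball 0 (real n)) \<in> (L12 :: ('a \<Rightarrow> complex) set)"
    using emeasure_lborel_cball_finite[of "0::'a" "real n"] by (intro indicator_L12) auto
  have "integrable lborel (\<lambda>x. indicator (cball 0 (real n)) x * f x)"
    by (intro L2_mult_integrable L12D(2)[OF b] f)
  then show ?thesis
    using L2_indicator_mult[OF f, of "cball 0 (real n)"] by (simp add: L12_def trunc_def[abs_def])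
qed

lemma trunc_tendsto: "(\<lambda>n. trunc n f x) \<longlonglongrightarrow> f x"
proof (rule tendsto_eventually)
  obtain N :: nat where N: "norm x \<le> real N" using real_arch_simple by blast
  show "\<forall>\<^sub>F n in sequentially. trunc n f x = f x"
    using eventually_ge_at_top[of N] by eventually_elim (use N in \<open>auto simp: trunc_def\<close>)
qed

lemma trunc_L2_tendsto:
  assumes f: "f \<in> L2 lborel"
  shows "(\<lambda>n. normsq lborel (\<lambda>x. trunc n f x - f x)) \<longlonglongrightarrow> 0"
proof -
  have [measurable]: "f \<in> borel_measurable borel" using f by (simp add: L2_def)
  have tm: "trunc n f \<in> borel_measurable borel" for n by (rule L12D(3)[OF trunc_L12[OF f]])
  note tm[measurable]
  have "(\<lambda>n. normsq lborel (\<lambda>x. trunc n f x - f x)) \<longlonglongrightarrow> (\<integral>x. 0 \<partial>(lborel :: 'a measure))"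
    unfolding normsq_def
  proof (rule integral_dominated_convergence[where w="\<lambda>x. (cmod (f x))\<^sup>2"])
    show "AE x in lborel. (\<lambda>n. (cmod (trunc n f x - f x))\<^sup>2) \<longlonglongrightarrow> 0"
    proof (rule AE_I2)
      fix x
      have "(\<lambda>n. (cmod (trunc n f x - f x))\<^sup>2) \<longlonglongrightarrow> (cmod (f x - f x))\<^sup>2"
        by (intro tendsto_intros trunc_tendsto)
      then show "(\<lambda>n. (cmod (trunc n f x - f x))\<^sup>2) \<longlonglongrightarrow> 0" by simp
    qed
    show "AE x in lborel. norm ((cmod (trunc n f x - f x))\<^sup>2) \<le> (cmod (f x))\<^sup>2" for n
      by (auto simp: trunc_def indicator_def)
  qed (use L2_integrable[OF f] in auto)
  then show ?thesis by simp
qed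

lemma fourier_trunc_Cauchy:
  fixes f :: "'a::euclidean_space \<Rightarrow> complex"
  assumes f: "f \<in> L2 lborel"
  shows "L2_Cauchy lborel (\<lambda>n. fourier (trunc n f))"
proof -
  have c: "L2_Cauchy lborel (\<lambda>n. trunc n f)"
    by (rule L2_tendsto_Cauchy[OF L12D(2)[OF trunc_L12[OF f]] f trunc_L2_tendsto[OF f]])
  have eq: "normsq lborel (\<lambda>x. fourier (trunc m f) x - fourier (trunc n f) x)
      = (2 * pi) ^ DIM('a) * normsq lborel (\<lambda>x. trunc m f x - trunc n f x)" for m n
  proof -
    have "fourier (\<lambda>x. trunc m f x - trunc n f x) = (\<lambda>x. fourier (trunc m f) x - fourier (trunc n f) x)"
      by (intro ext fourier_diff L12D trunc_L12 f)
    with plancherel(2)[OF L12_diff[OF trunc_L12[OF f] trunc_L12[OF f]], of m n] show ?thesis by simp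
  qed
  have F: "fourier (trunc n f) \<in> L2 lborel" for n by (rule plancherel(1)[OF trunc_L12[OF f]])
  show ?thesis
    unfolding L2_Cauchy_def
  proof (intro conjI allI impI F)
    fix e :: real assume "e > 0"
    then have "e / (2 * pi) ^ DIM('a) > 0" by simp
    then obtain N where "\<forall>m\<ge>N. \<forall>n\<ge>N. normsq lborel (\<lambda>x. trunc m f x - trunc n f x) < e / (2 * pi) ^ DIM('a)"
      using c unfolding L2_Cauchy_def by blast
    then show "\<exists>N. \<forall>m\<ge>N. \<forall>n\<ge>N. normsq lborel (\<lambda>x. fourier (trunc m f) x - fourier (trunc n f) x) < e"
      unfolding eq by (auto simp: pos_less_divide_eq mult.commute)
  qed
qed

text \<open>
  The Fourier transform on $L^2$, determined up to a null set as the limit in norm of the transforms of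
  truncations to balls.
\<close>

definition fourier_L2 :: "('a::euclidean_space \<Rightarrow> complex) \<Rightarrow> 'a \<Rightarrow> complex" where
  "fourier_L2 f = (SOME H. H \<in> L2 lborel \<and> (\<lambda>n. normsq lborel (\<lambda>x. fourier (trunc n f) x - H x)) \<longlonglongrightarrow> 0)"

lemma fourier_L2:
  assumes "f \<in> L2 lborel"
  shows "fourier_L2 f \<in> L2 lborel" "(\<lambda>n. normsq lborel (\<lambda>x. fourier (trunc n f) x - fourier_L2 f x)) \<longlonglongrightarrow> 0"
proof -
  have "\<exists>H. H \<in> L2 lborel \<and> (\<lambda>n. normsq lborel (\<lambda>x. fourier (trunc n f) x - H x)) \<longlonglongrightarrow> 0"
    by (rule lborel.L2_complete[OF fourier_trunc_Cauchy[OF assms]]) blast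
  from someI_ex[OF this] show "fourier_L2 f \<in> L2 lborel"
    "(\<lambda>n. normsq lborel (\<lambda>x. fourier (trunc n f) x - fourier_L2 f x)) \<longlonglongrightarrow> 0"
    unfolding fourier_L2_def by blast+
qed

section \<open>Componentwise dilations\<close>

text \<open>
  The inverse of \<^const>\<open>vec_divide\<close> in its first argument. With the roles of the two factors exchanged it
  also describes the dependence of \<open>a \<eta>\<close> on \<open>a\<close>.
\<close>

definition dil :: "real ^ 'n::finite \<Rightarrow> real ^ 'n \<Rightarrow> real ^ 'n" where
  "dil a x = (\<chi> k. a $ k * x $ k)"

lemma dil_commute: "dil a x = dil x a"
  by (simp add: dil_def mult.commute)

lemma R0_iff: "a \<in> R0 \<longleftrightarrow> (\<forall>k. a $ k \<noteq> 0)"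
  by (simp add: R0_def abs_m_def)

lemma abs_m_nonneg [simp]: "0 \<le> abs_m a"
  by (simp add: abs_m_def)

lemma abs_m_pos: "a \<in> R0 \<Longrightarrow> 0 < abs_m a"
  unfolding R0_def using abs_m_nonneg[of a] by (simp add: less_le)

lemma abs_m_dil: "abs_m (dil a x) = abs_m a * abs_m x"
  by (simp add: abs_m_def dil_def prod.distrib abs_mult)

lemma vec_divide_dil: "a \<in> R0 \<Longrightarrow> vec_divide (dil a x) a = x"
  by (simp add: R0_iff vec_divide_def dil_def vec_eq_iff)

lemma dil_inner: "dil a x \<bullet> y = x \<bullet> dil a y"
  by (simp add: dil_def inner_vec_def mult_ac)

lemma vec_measurable:
  fixes f :: "'a \<Rightarrow> real ^ 'n::finite"
  assumes "\<And>k. (\<lambda>x. f x $ k) \<in> borel_measurable M"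
  shows "f \<in> borel_measurable M"
proof (subst borel_measurable_euclidean_space, intro ballI)
  fix i :: "real ^ 'n" assume "i \<in> Basis"
  then obtain k where "i = axis k 1" by (auto simp: Basis_vec_def)
  then show "(\<lambda>x. f x \<bullet> i) \<in> borel_measurable M"
    using assms[of k] by (simp add: inner_axis)
qed

lemma vec_nth_measurable [measurable]: "(\<lambda>x::real ^ 'n::finite. x $ k) \<in> borel_measurable borel"
  by (intro borel_measurable_continuous_onI continuous_intros)

lemma vec_nth_measurable' [measurable (raw)]:
  fixes f :: "'a \<Rightarrow> real ^ 'n::finite"
  shows "f \<in> borel_measurable M \<Longrightarrow> (\<lambda>x. f x $ k) \<in> borel_measurable M"
  by (rule measurable_compose[OF _ vec_nth_measurable])

lemma abs_m_measurable [measurable]: "abs_m \<in> borel_measurable borel"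
  unfolding abs_m_def[abs_def] by measurable

lemma R0_sets [measurable]: "R0 \<in> sets borel"
proof -
  have "R0 = {x \<in> space borel. abs_m x \<noteq> 0}" by (simp add: R0_def)
  also have "\<dots> \<in> sets borel" by measurable
  finally show ?thesis .
qed

lemma dil_measurable [measurable (raw)]:
  fixes f g :: "'a \<Rightarrow> real ^ 'n::finite"
  assumes [measurable]: "f \<in> borel_measurable M" "g \<in> borel_measurable M"
  shows "(\<lambda>x. dil (f x) (g x)) \<in> borel_measurable M"
  by (rule vec_measurable) (simp add: dil_def)

lemma vec_divide_measurable [measurable (raw)]:
  fixes f g :: "'a \<Rightarrow> real ^ 'n::finite"
  assumes [measurable]: "f \<in> borel_measurable M" "g \<in> borel_measurable M"
  shows "(\<lambda>x. vec_divide (f x) (g x)) \<in> borel_measurable M"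
  by (rule vec_measurable) (simp add: vec_divide_def)

lemma Basis_vec_axis: "(Basis :: (real ^ 'n::finite) set) = range (\<lambda>k. axis k 1)"
  by (auto simp: Basis_vec_def)

lemma lborel_dil:
  fixes a t :: "real ^ 'n::finite"
  assumes a: "a \<in> R0"
  shows "lborel = density (distr lborel borel (\<lambda>x. t + dil a x)) (\<lambda>_. ennreal (abs_m a))"
proof -
  have inj: "inj (\<lambda>k::'n. axis k (1::real))" by (auto simp: inj_on_def axis_eq_axis)
  have nz: "a \<bullet> j \<noteq> 0" if "j \<in> Basis" for j
    using a that by (auto simp: R0_iff Basis_vec_axis inner_axis)
  have 1: "t + (\<Sum>j\<in>Basis. ((a \<bullet> j) * (x \<bullet> j)) *\<^sub>R j) = t + dil a x" for x
  proof -
    have "dil a x = (\<Sum>j\<in>Basis. (dil a x \<bullet> j) *\<^sub>R j)"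
      by (simp add: euclidean_representation)
    also have "\<dots> = (\<Sum>j\<in>Basis. ((a \<bullet> j) * (x \<bullet> j)) *\<^sub>R j)"
      by (intro sum.cong refl) (auto simp: Basis_vec_axis inner_axis dil_def)
    finally show ?thesis by simp
  qed
  have "(\<Prod>j\<in>Basis. \<bar>a \<bullet> j\<bar>) = abs_m a"
    unfolding Basis_vec_axis by (subst prod.reindex[OF inj]) (simp add: inner_axis abs_m_def abs_prod)
  then show ?thesis
    using lborel_affine_euclidean[of "\<lambda>j. a \<bullet> j" t, OF nz] by (simp only: 1 prod_ennreal abs_ge_zero)
qed

lemma AE_R0: "AE x in lborel. (x :: real ^ 'n::finite) \<in> R0"
proof -
  have "AE x in lborel. (x :: real ^ 'n) $ k \<noteq> 0" for k
  proof -
    have "negligible {x :: real ^ 'n. x $ k = 0}" by (rule negligible_standard_hyperplane_cart)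
    then have "AE x in lebesgue. x \<notin> {x :: real ^ 'n. x $ k = 0}"
      by (intro AE_not_in) (simp add: negligible_iff_null_sets)
    then show ?thesis by (simp add: AE_completion_iff)
  qed
  then have "AE x in lborel. \<forall>k\<in>UNIV. (x :: real ^ 'n) $ k \<noteq> 0"
    by (intro AE_ball_countable[THEN iffD2]) auto
  then show ?thesis by (simp add: R0_iff)
qed

context
  fixes a t :: "real ^ 'n::finite"
  assumes a: "a \<in> R0"
begin

lemma dil_affine_measurable: "(\<lambda>x. t + dil a x) \<in> borel_measurable borel"
  by measurable

lemmas nn_integral_dil_affine = nn_integral_affine[OF abs_m_pos[OF a] dil_affine_measurable lborel_dil[OF a]]
lemmas integral_dil_affine = integral_affine[OF abs_m_pos[OF a] dil_affine_measurable lborel_dil[OF a]]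
lemmas integrable_dil_affine = integrable_affine[OF abs_m_pos[OF a] dil_affine_measurable lborel_dil[OF a]]

end

lemma nn_integral_dil:
  "a \<in> R0 \<Longrightarrow> f \<in> borel_measurable borel \<Longrightarrow>
    (\<integral>\<^sup>+x. f x \<partial>lborel) = ennreal (abs_m a) * (\<integral>\<^sup>+x. f (dil a x) \<partial>lborel)"
  using nn_integral_dil_affine[of a f 0] by simp

lemma integral_dil:
  fixes f :: "real ^ 'n::finite \<Rightarrow> complex"
  shows "a \<in> R0 \<Longrightarrow> f \<in> borel_measurable borel \<Longrightarrow>
    (\<integral>x. f x \<partial>lborel) = abs_m a * (\<integral>x. f (dil a x) \<partial>lborel)"
  using integral_dil_affine[of a f 0] by simp

lemma L2_dil:
  assumes a: "a \<in> R0" and h: "h \<in> L2 lborel"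
  shows "(\<lambda>x. h (dil a x)) \<in> L2 lborel" "normsq lborel (\<lambda>x. h (dil a x)) = normsq lborel h / abs_m a"
proof -
  have [measurable]: "h \<in> borel_measurable borel" using h by (simp add: L2_def)
  have pos: "abs_m a > 0" by (rule abs_m_pos[OF a])
  have "ennreal (abs_m a) * (\<integral>\<^sup>+x. ennreal ((cmod (h (dil a x)))\<^sup>2) \<partial>lborel) = ennreal (normsq lborel h)"
    using nn_integral_dil[OF a, of "\<lambda>x. ennreal ((cmod (h x))\<^sup>2)"] nn_integral_eq_normsq[OF h] by simp
  then have "ennreal (1 / abs_m a) * (ennreal (abs_m a) * (\<integral>\<^sup>+x. ennreal ((cmod (h (dil a x)))\<^sup>2) \<partial>lborel))
     = ennreal (1 / abs_m a) * ennreal (normsq lborel h)" by simp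
  then have eq: "(\<integral>\<^sup>+x. ennreal ((cmod (h (dil a x)))\<^sup>2) \<partial>lborel) = ennreal (normsq lborel h / abs_m a)"
    using pos by (simp add: mult.assoc[symmetric] ennreal_mult[symmetric])
  show 1: "(\<lambda>x. h (dil a x)) \<in> L2 lborel" by (simp add: L2_iff_nn eq)
  show "normsq lborel (\<lambda>x. h (dil a x)) = normsq lborel h / abs_m a"
    using eq nn_integral_eq_normsq[OF 1] pos by simp
qed

lemma vec_divide_eq_dil: "vec_divide x a = dil (\<chi> k. 1 / a $ k) x"
  by (simp add: vec_divide_def dil_def)

lemma inverse_R0: "a \<in> R0 \<Longrightarrow> (\<chi> k. 1 / a $ k) \<in> R0" "abs_m (\<chi> k. 1 / a $ k) = 1 / abs_m a"
  by (auto simp: R0_iff abs_m_def prod_dividef)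

lemma L2_vec_divide:
  assumes a: "a \<in> R0" and h: "h \<in> L2 lborel"
  shows "(\<lambda>x. h (vec_divide x a)) \<in> L2 lborel" "normsq lborel (\<lambda>x. h (vec_divide x a)) = abs_m a * normsq lborel h"
  using L2_dil[OF inverse_R0(1)[OF a] h] by (simp_all add: vec_divide_eq_dil inverse_R0(2))

lemma L12_vec_divide:
  assumes a: "a \<in> R0" and h: "h \<in> L12"
  shows "(\<lambda>x. h (vec_divide x a)) \<in> L12"
  using L2_vec_divide(1)[OF a L12D(2)[OF h]] integrable_dil_affine[OF inverse_R0(1)[OF a] L12D(1)[OF h], of 0]
  by (simp add: L12_def vec_divide_eq_dil)

lemma fourier_vec_divide:
  assumes a: "a \<in> R0" and [measurable]: "h \<in> borel_measurable borel"
  shows "fourier (\<lambda>x. h (vec_divide x a)) \<eta> = abs_m a * fourier h (dil a \<eta>)"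
  unfolding fourier_def using integral_dil[OF a, of "\<lambda>x. h (vec_divide x a) * cis (- (x \<bullet> \<eta>))"]
  by (simp add: vec_divide_dil a dil_inner)

text \<open>
  The measure \<open>da / |a|\<^sub>m\<close> is invariant under dilations: it is the Haar measure of the multiplicative
  group of vectors without zero components.
\<close>

lemma nn_integral_scale_invariant:
  fixes f :: "real ^ 'n::finite \<Rightarrow> ennreal"
  assumes [measurable]: "f \<in> borel_measurable borel" and y: "y \<in> R0"
  shows "(\<integral>\<^sup>+a. f (dil y a) * ennreal (1 / abs_m a) \<partial>lborel) = (\<integral>\<^sup>+u. f u * ennreal (1 / abs_m u) \<partial>lborel)"
proof -
  have pos: "abs_m y > 0" by (rule abs_m_pos[OF y])
  have "(\<integral>\<^sup>+u. f u * ennreal (1 / abs_m u) \<partial>lborel)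
      = ennreal (abs_m y) * (\<integral>\<^sup>+a. f (dil y a) * ennreal (1 / abs_m (dil y a)) \<partial>lborel)"
    by (rule nn_integral_dil[OF y]) measurable
  also have "\<dots> = (\<integral>\<^sup>+a. f (dil y a) * (ennreal (abs_m y) * ennreal (1 / abs_m (dil y a))) \<partial>lborel)"
    by (subst nn_integral_cmult[symmetric]) (auto simp: mult_ac)
  also have "\<dots> = (\<integral>\<^sup>+a. f (dil y a) * ennreal (1 / abs_m a) \<partial>lborel)"
    using pos by (intro nn_integral_cong arg_cong2[where f="(*)"] refl)
      (simp add: ennreal_mult[symmetric] abs_m_dil)
  finally show ?thesis ..
qed

section \<open>Lebesgue measurable functions and their Borel representatives\<close>

lemma square_integrable_iff: "square_integrable f \<longleftrightarrow> f \<in> L2 lebesgue"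
  by (simp add: square_integrable_def L2_def)

lemma l2_tendsto_iff:
  "l2_tendsto F f \<longleftrightarrow> (\<forall>n. F n \<in> L2 lebesgue) \<and> f \<in> L2 lebesgue \<and>
     (\<lambda>n. normsq lebesgue (\<lambda>x. F n x - f x)) \<longlonglongrightarrow> 0"
proof -
  have "(\<integral>\<^sup>+x. ennreal ((norm (F n x - f x))\<^sup>2) \<partial>lebesgue) = ennreal (normsq lebesgue (\<lambda>x. F n x - f x))"
    if "F n \<in> L2 lebesgue" "f \<in> L2 lebesgue" for n
    by (rule nn_integral_eq_normsq[OF L2_diff[OF that]])
  then show ?thesis
    unfolding l2_tendsto_def square_integrable_iff
    by (auto simp: tendsto_ennreal_iff[of _ _ 0, simplified])
qed

lemma L2_lborel_lebesgue:
  assumes "f \<in> L2 lborel"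
  shows "f \<in> L2 lebesgue" "normsq lebesgue f = normsq lborel f"
proof -
  have [measurable]: "f \<in> borel_measurable borel" using assms by (simp add: L2_def)
  show "f \<in> L2 lebesgue" "normsq lebesgue f = normsq lborel f"
    using assms by (auto simp: L2_def normsq_def integrable_completion integral_completion measurable_completion)
qed

text \<open>
  A function that agrees almost everywhere with a Borel function may replace it in integrals with
  respect to the completed measure. Applied with Lebesgue measure and with the measure on parameter
  space.
\<close>

lemma completion_cong_AE:
  fixes f g :: "'a \<Rightarrow> complex"
  assumes g: "g \<in> borel_measurable M" and ae: "AE x in M. f x = g x"
  shows "f \<in> borel_measurable (completion M)"
    and "integrable (completion M) f \<longleftrightarrow> integrable M g"
    and "integral\<^sup>L (completion M) f = integral\<^sup>L M g"
proof -
  have gc: "g \<in> borel_measurable (completion M)" using g by (rule measurable_completion)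
  have aec: "AE x in completion M. f x = g x" using ae by (rule AE_completion)
  show fc: "f \<in> borel_measurable (completion M)"
  proof (rule measurableI)
    fix S :: "complex set" assume S: "S \<in> sets borel"
    have "AE x in completion M. x \<in> g -` S \<inter> space (completion M) \<longleftrightarrow> x \<in> f -` S \<inter> space (completion M)"
      using aec by eventually_elim simp
    then show "f -` S \<inter> space (completion M) \<in> sets (completion M)"
      by (rule completion.in_sets_AE) (use measurable_sets[OF gc S] in auto)
  qed simp
  show "integrable (completion M) f \<longleftrightarrow> integrable M g"
    using integrable_cong_AE[OF fc gc aec] integrable_completion[OF g] by simp
  show "integral\<^sup>L (completion M) f = integral\<^sup>L M g"
    using integral_cong_AE[OF fc gc aec] integral_completion[OF g] by simp
qed

lemma L2_lebesgue_representative: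
  assumes f: "f \<in> L2 lebesgue"
  obtains f' where "f' \<in> L2 lborel" "AE x in lborel. f x = f' x" "f' \<in> borel_measurable borel"
proof -
  have fm: "f \<in> borel_measurable lebesgue" using f by (rule L2_measurable)
  have "(\<lambda>x. Re (f x)) \<in> borel_measurable lebesgue" "(\<lambda>x. Im (f x)) \<in> borel_measurable lebesgue"
    using fm by auto
  then obtain r i where ri: "r \<in> borel_measurable lborel" "AE x in lborel. Re (f x) = r x"
    "i \<in> borel_measurable lborel" "AE x in lborel. Im (f x) = i x"
    using completion_ex_borel_measurable_real by metis
  define f' where "f' x = Complex (r x) (i x)" for x
  have m: "f' \<in> borel_measurable borel"
    unfolding f'_def[abs_def] Complex_eq using ri by simp
  have ae: "AE x in lborel. f x = f' x"
    using ri(2,4) by eventually_elim (simp add: f'_def complex_eq_iff)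
  have "f' \<in> L2 lebesgue"
    by (rule L2_cong_AE(1)[OF f]) (use m ae in \<open>auto intro: measurable_completion AE_completion\<close>)
  then have "f' \<in> L2 lborel" using m by (simp add: L2_def integrable_completion)
  with ae m show thesis by (intro that)
qed

section \<open>The wavelet transform as a tight frame\<close>

lemma chirp_norm [simp]: "cmod (chirp \<alpha> s x) = 1"
  unfolding chirp_def by (rule norm_exp_i_times)

lemma chirp_measurable [measurable]: "chirp \<alpha> s \<in> borel_measurable borel"
  unfolding chirp_def[abs_def] by measurable

lemma cnj_chirp: "cnj (chirp \<alpha> s x) = chirp \<alpha> (- s) x"
  unfolding chirp_def cis_conv_exp[symmetric] by (simp only: cis_cnj mult_minus_left)

lemma chirp_L12:
  assumes f: "f \<in> L12"
  shows "(\<lambda>t. f t * chirp \<alpha> s t) \<in> L12"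
    and "normsq lborel (\<lambda>t. f t * chirp \<alpha> s t) = normsq lborel f"
proof -
  let ?g = "\<lambda>t. f t * chirp \<alpha> s t"
  have [measurable]: "f \<in> borel_measurable borel" using f by (rule L12D)
  have "integrable lborel ?g"
    by (rule Bochner_Integration.integrable_bound[OF L12D(1)[OF f]]) (auto simp: norm_mult)
  moreover have "?g \<in> L2 lborel"
    by (rule L2_same_modulus(1)[OF L12D(2)[OF f]]) (auto simp: norm_mult)
  ultimately show "?g \<in> L12" by (simp add: L12_def)
  show "normsq lborel ?g = normsq lborel f"
    by (rule L2_same_modulus(2)[OF L12D(2)[OF f]]) (auto simp: norm_mult)
qed

lemma c_coef_nonzero: "c_coef \<alpha> \<noteq> 0"
proof -
  have "csqrt (1 - \<i> * complex_of_real y) \<noteq> 0" for y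
  proof
    assume "csqrt (1 - \<i> * complex_of_real y) = 0"
    then have "Re (1 - \<i> * complex_of_real y) = 0" by (simp del: Re_complex_of_real)
    then show False by simp
  qed
  then show ?thesis by (simp add: c_coef_def)
qed

text \<open>
  The hypotheses of the reconstruction formula for a Borel measurable wavelet. For such a wavelet the
  atoms are jointly Borel measurable in parameters and points, as Fubini's theorem demands.
\<close>

locale borel_wavelet =
  fixes \<alpha> :: "real ^ 'n::finite" and lam :: real and \<psi> :: "real ^ 'n \<Rightarrow> complex"
  assumes lam: "lam \<noteq> 0" and \<alpha>: "\<And>k. sin (\<alpha> $ k) \<noteq> 0" and \<psi>: "\<psi> \<in> L2 lborel"
    and adm: "(\<integral>\<^sup>+u\<in>R0. ennreal ((norm (mfrft \<alpha> lam \<psi> u))\<^sup>2 / abs_m u) \<partial>lebesgue) < \<infinity>"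
    and const: "wavelet_const \<alpha> lam \<psi> \<noteq> 0"
begin

text \<open>
  The function written \<open>\<psi>\<close> with a tilde in the definition of the wavelet transform. Its
  ordinary Fourier transform carries the fractional one.
\<close>

definition chirped :: "real ^ 'n \<Rightarrow> complex" where "chirped x = \<psi> x * chirp \<alpha> (lam\<^sup>2) x"

text \<open>
  The fractional transform at \<open>\<xi>\<close> evaluates the ordinary one at the frequency \<open>\<sigma> \<xi>\<close> (componentwise).
\<close>

definition \<sigma> :: "real ^ 'n" where "\<sigma> = (\<chi> k. lam\<^sup>2 / sin (\<alpha> $ k))"

lemma \<sigma>: "\<sigma> \<in> R0"
  using lam \<alpha> by (simp add: R0_iff \<sigma>_def)

lemma \<psi>_measurable [measurable]: "\<psi> \<in> borel_measurable borel"
  using \<psi> by (simp add: L2_def)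

lemma chirped_measurable [measurable]: "chirped \<in> borel_measurable borel"
  unfolding chirped_def[abs_def] by measurable

lemma chirped_L2: "chirped \<in> L2 lborel" "normsq lborel chirped = normsq lborel \<psi>"
  by (rule L2_same_modulus[OF \<psi>]; simp add: chirped_def norm_mult)+

definition chirp_factor :: "real ^ 'n \<Rightarrow> complex" where
  "chirp_factor \<xi> = c_coef \<alpha> / complex_of_real (sqrt (2 * pi) ^ CARD('n)) * chirp \<alpha> (lam\<^sup>2) \<xi>"

lemma chirp_factor_measurable [measurable]: "chirp_factor \<in> borel_measurable borel"
  unfolding chirp_factor_def[abs_def] by measurable

abbreviation \<kappa> :: real where "\<kappa> \<equiv> (cmod (c_coef \<alpha>))\<^sup>2 / (2 * pi) ^ CARD('n)"

lemma norm_chirp_factor_sq: "(cmod (chirp_factor \<xi>))\<^sup>2 = \<kappa>"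
proof -
  have "(sqrt (2 * pi) ^ CARD('n))\<^sup>2 = (2 * pi) ^ CARD('n)"
    by (metis mult.commute power_mult real_sqrt_pow2 pi_ge_zero zero_le_numeral mult_nonneg_nonneg)
  then show ?thesis
    by (simp add: chirp_factor_def norm_mult norm_divide power_divide norm_power)
qed

lemma mfrft_trunc_eq: "mfrft_trunc \<alpha> lam \<psi> n \<xi> = chirp_factor \<xi> * fourier (trunc n chirped) (dil \<sigma> \<xi>)"
proof -
  have kernel: "\<psi> x * mfrft_kernel \<alpha> lam x \<xi> = chirp_factor \<xi> * (chirped x * cis (- (x \<bullet> dil \<sigma> \<xi>)))" for x
  proof -
    have "lam\<^sup>2 * (\<Sum>k\<in>UNIV. x $ k * \<xi> $ k * (1 / sin (\<alpha> $ k))) = x \<bullet> dil \<sigma> \<xi>"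
      by (simp add: inner_vec_def dil_def \<sigma>_def sum_distrib_left mult_ac)
    then have "exp (- \<i> * complex_of_real (lam\<^sup>2 * (\<Sum>k\<in>UNIV. x $ k * \<xi> $ k * (1 / sin (\<alpha> $ k))))) = cis (- (x \<bullet> dil \<sigma> \<xi>))"
      by (simp only:) (simp add: cis_conv_exp)
    then show ?thesis by (simp only: mfrft_kernel_def chirp_factor_def chirped_def mult_ac)
  qed
  have eq: "indicator (cball 0 (real n)) x *\<^sub>R (\<psi> x * mfrft_kernel \<alpha> lam x \<xi>)
      = chirp_factor \<xi> * (trunc n chirped x * cis (- (x \<bullet> dil \<sigma> \<xi>)))" for x
    unfolding kernel by (simp add: trunc_def indicator_def)
  have [measurable]: "trunc n chirped \<in> borel_measurable borel" by (rule L12D(3)[OF trunc_L12[OF chirped_L2(1)]])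
  show ?thesis
    unfolding mfrft_trunc_def set_lebesgue_integral_def eq fourier_def
    by (subst integral_completion) (auto simp: measurable_completion)
qed

definition H :: "real ^ 'n \<Rightarrow> complex" where "H = fourier_L2 chirped"

lemma H_L2: "H \<in> L2 lborel"
  and H_lim: "(\<lambda>n. normsq lborel (\<lambda>x. fourier (trunc n chirped) x - H x)) \<longlonglongrightarrow> 0"
  unfolding H_def by (rule fourier_L2[OF chirped_L2(1)])+

text \<open>
  The truncated transforms converge in norm to \<open>\<lambda>\<xi>. chirp_factor \<xi> * H (\<sigma> \<xi>)\<close>, so the choice
  made in \<^const>\<open>mfrft\<close> succeeds, and limits in norm are unique almost everywhere.
\<close>

lemma mfrft_measurable: "mfrft \<alpha> lam \<psi> \<in> borel_measurable lebesgue"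
  and mfrft_H: "AE \<xi> in lborel. (cmod (mfrft \<alpha> lam \<psi> \<xi>))\<^sup>2
       = \<kappa> * (cmod (H (dil \<sigma> \<xi>)))\<^sup>2"
proof -
  note H = H_L2 and lim = H_lim
  have F: "fourier (trunc n chirped) \<in> L2 lborel" for n by (rule plancherel(1)[OF trunc_L12[OF chirped_L2(1)]])
  have mL: "(\<lambda>\<xi>. chirp_factor \<xi> * u (dil \<sigma> \<xi>)) \<in> L2 lborel \<and> normsq lborel (\<lambda>\<xi>. chirp_factor \<xi> * u (dil \<sigma> \<xi>)) = \<kappa> * (normsq lborel u / abs_m \<sigma>)"
    if u: "u \<in> L2 lborel" for u
  proof -
    have [measurable]: "u \<in> borel_measurable borel" using u by (simp add: L2_def)
    have eq: "(cmod (chirp_factor \<xi> * u (dil \<sigma> \<xi>)))\<^sup>2 = \<kappa> * (cmod (u (dil \<sigma> \<xi>)))\<^sup>2" for \<xi>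
      by (simp add: norm_mult power_mult_distrib norm_chirp_factor_sq)
    show ?thesis
      using L2_dil[OF \<sigma> u] by (simp add: L2_def normsq_def eq)
  qed
  define g where "g \<xi> = chirp_factor \<xi> * H (dil \<sigma> \<xi>)" for \<xi>
  have g: "g \<in> L2 lebesgue" unfolding g_def[abs_def] using mL[OF H] L2_lborel_lebesgue by blast
  have T: "mfrft_trunc \<alpha> lam \<psi> n \<in> L2 lebesgue" for n
    unfolding mfrft_trunc_eq[abs_def] using mL[OF F] L2_lborel_lebesgue by blast
  have d: "normsq lebesgue (\<lambda>x. mfrft_trunc \<alpha> lam \<psi> n x - g x) = \<kappa> * (normsq lborel (\<lambda>x. fourier (trunc n chirped) x - H x) / abs_m \<sigma>)" for n
    unfolding mfrft_trunc_eq g_def right_diff_distrib[symmetric]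
    using mL[OF L2_diff[OF F[of n] H]] L2_lborel_lebesgue(2)[OF conjunct1[OF mL[OF L2_diff[OF F[of n] H]]]] by simp
  have "(\<lambda>n. \<kappa> * (normsq lborel (\<lambda>x. fourier (trunc n chirped) x - H x) / abs_m \<sigma>)) \<longlonglongrightarrow> \<kappa> * (0 / abs_m \<sigma>)"
    by (intro tendsto_intros lim) (use abs_m_pos[OF \<sigma>] in auto)
  then have limg: "(\<lambda>n. normsq lebesgue (\<lambda>x. mfrft_trunc \<alpha> lam \<psi> n x - g x)) \<longlonglongrightarrow> 0"
    by (simp only: d) simp
  then have "l2_tendsto (mfrft_trunc \<alpha> lam \<psi>) g"
    unfolding l2_tendsto_iff using T g by blast
  then have "l2_tendsto (mfrft_trunc \<alpha> lam \<psi>) (mfrft \<alpha> lam \<psi>)"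
    unfolding mfrft_def by (rule someI[where P = "l2_tendsto (mfrft_trunc \<alpha> lam \<psi>)"])
  then have M: "mfrft \<alpha> lam \<psi> \<in> L2 lebesgue"
    and limM: "(\<lambda>n. normsq lebesgue (\<lambda>x. mfrft_trunc \<alpha> lam \<psi> n x - mfrft \<alpha> lam \<psi> x)) \<longlonglongrightarrow> 0"
    unfolding l2_tendsto_iff by blast+
  have "AE \<xi> in lebesgue. mfrft \<alpha> lam \<psi> \<xi> = g \<xi>"
    by (rule L2_lim_unique[OF T M g limM limg])
  then have "AE \<xi> in lborel. mfrft \<alpha> lam \<psi> \<xi> = g \<xi>"
    by (simp add: AE_completion_iff)
  then show "AE \<xi> in lborel. (cmod (mfrft \<alpha> lam \<psi> \<xi>))\<^sup>2 = \<kappa> * (cmod (H (dil \<sigma> \<xi>)))\<^sup>2"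
    by eventually_elim (simp add: g_def norm_mult power_mult_distrib norm_chirp_factor_sq)
  show "mfrft \<alpha> lam \<psi> \<in> borel_measurable lebesgue"
    using M by (rule L2_measurable)
qed

lemma H_measurable [measurable]: "H \<in> borel_measurable borel"
  using H_L2 by (simp add: L2_def)

text \<open>
  The admissibility integral for the ordinary Fourier transform of the chirped wavelet.
\<close>

definition A :: ennreal where
  "A = (\<integral>\<^sup>+u. ennreal ((cmod (H u))\<^sup>2) * ennreal (1 / abs_m u) \<partial>lborel)"

text \<open>
  The frequency scaling \<open>\<sigma>\<close> disappears because \<open>du / |u|\<^sub>m\<close> is invariant under dilations.
\<close>

lemma admissible_A:
  "(\<integral>\<^sup>+u\<in>R0. ennreal ((norm (mfrft \<alpha> lam \<psi> u))\<^sup>2 / abs_m u) \<partial>lebesgue)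
    = ennreal (\<kappa>) * A"
proof -
  have "(\<integral>\<^sup>+u\<in>R0. ennreal ((norm (mfrft \<alpha> lam \<psi> u))\<^sup>2 / abs_m u) \<partial>lebesgue)
     = (\<integral>\<^sup>+u. ennreal ((norm (mfrft \<alpha> lam \<psi> u))\<^sup>2 / abs_m u) * indicator R0 u \<partial>lborel)"
    by (rule nn_integral_completion)
  also have "\<dots> = (\<integral>\<^sup>+u. ennreal \<kappa> * (ennreal ((cmod (H (dil \<sigma> u)))\<^sup>2) * ennreal (1 / abs_m u)) \<partial>lborel)"
  proof (rule nn_integral_cong_AE, use mfrft_H in eventually_elim)
    fix u
    assume eq: "(cmod (mfrft \<alpha> lam \<psi> u))\<^sup>2 = \<kappa> * (cmod (H (dil \<sigma> u)))\<^sup>2"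
    show "ennreal ((norm (mfrft \<alpha> lam \<psi> u))\<^sup>2 / abs_m u) * indicator R0 u
      = ennreal \<kappa> * (ennreal ((cmod (H (dil \<sigma> u)))\<^sup>2) * ennreal (1 / abs_m u))"
      unfolding eq by (cases "u \<in> R0") (auto simp: ennreal_mult[symmetric] R0_def)
  qed
  also have "\<dots> = ennreal \<kappa> * (\<integral>\<^sup>+u. ennreal ((cmod (H (dil \<sigma> u)))\<^sup>2) * ennreal (1 / abs_m u) \<partial>lborel)"
    by (rule nn_integral_cmult) measurable
  also have "(\<integral>\<^sup>+u. ennreal ((cmod (H (dil \<sigma> u)))\<^sup>2) * ennreal (1 / abs_m u) \<partial>lborel) = A"
    unfolding A_def by (rule nn_integral_scale_invariant[OF _ \<sigma>]) measurable
  finally show ?thesis .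
qed

definition C :: real where "C = wavelet_const \<alpha> lam \<psi>"

lemma C_A: "ennreal C = ennreal ((cmod (c_coef \<alpha>))\<^sup>2) * A" and C_pos: "0 < C"
proof -
  have kp: "\<kappa> > 0" using c_coef_nonzero[of \<alpha>] by (intro divide_pos_pos) auto
  have A: "A < \<infinity>"
    using adm kp unfolding admissible_A by (auto simp: ennreal_mult_less_top)
  obtain a where a: "A = ennreal a" "a \<ge> 0" using A by (cases A) auto
  have [measurable]: "mfrft \<alpha> lam \<psi> \<in> borel_measurable lebesgue" by (rule mfrft_measurable)
  have [measurable]: "abs_m \<in> borel_measurable lebesgue" "R0 \<in> sets lebesgue"
    by (auto simp: measurable_completion)
  let ?q = "\<lambda>u. (norm (mfrft \<alpha> lam \<psi> u))\<^sup>2 / abs_m u"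
  have "(LINT u:R0|lebesgue. ?q u)
      = enn2real (\<integral>\<^sup>+u. ennreal (indicator R0 u *\<^sub>R ?q u) \<partial>lebesgue)"
    unfolding set_lebesgue_integral_def by (rule integral_eq_nn_integral) auto
  also have "(\<integral>\<^sup>+u. ennreal (indicator R0 u *\<^sub>R ?q u) \<partial>lebesgue)
      = (\<integral>\<^sup>+u\<in>R0. ennreal (?q u) \<partial>lebesgue)"
    by (intro nn_integral_cong) (simp split: split_indicator)
  also have "\<dots> = ennreal (\<kappa> * a)"
    unfolding admissible_A a(1) by (rule ennreal_mult[symmetric]) (use kp a in simp_all)
  finally have "C = (cmod (c_coef \<alpha>))\<^sup>2 * a"
    using a kp by (simp add: C_def wavelet_const_def)
  then show "ennreal C = ennreal ((cmod (c_coef \<alpha>))\<^sup>2) * A" "0 < C"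
    using a const by (auto simp: C_def ennreal_mult less_le)
qed

lemma mfrwt_eq_corr:
  assumes "a \<in> R0" and [measurable]: "f \<in> borel_measurable borel"
  shows "mfrwt \<alpha> lam \<psi> f a b = c_coef \<alpha> * chirp \<alpha> (- (lam\<^sup>2)) b * complex_of_real (1 / sqrt (abs_m a)) *
     corr (\<lambda>t. f t * chirp \<alpha> (lam\<^sup>2) t) (\<lambda>x. chirped (vec_divide x a)) b"
proof -
  have "mfrwt \<alpha> lam \<psi> f a b = (\<integral>t. f t * cnj (wavelet_atom \<alpha> lam \<psi> a b t) \<partial>lborel)"
    unfolding mfrwt_def wavelet_atom_def Let_def
    by (subst integral_completion) (auto simp: measurable_completion)
  also have "\<dots> = (\<integral>t. (c_coef \<alpha> * chirp \<alpha> (- (lam\<^sup>2)) b * complex_of_real (1 / sqrt (abs_m a))) *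
     ((f t * chirp \<alpha> (lam\<^sup>2) t) * cnj (chirped (vec_divide (t - b) a))) \<partial>lborel)"
    by (intro Bochner_Integration.integral_cong refl)
       (simp add: wavelet_atom_def chirped_def cnj_chirp mult_ac)
  finally show ?thesis
    unfolding corr_def by (simp only: integral_mult_right_zero)
qed

text \<open>
  \<open>corr_normsq\<close> for the dilated wavelet, whose Fourier transform at \<open>\<eta>\<close> is \<open>|a|\<^sub>m H (a \<eta>)\<close>. The
  factor \<open>|a|\<^sub>m\<close> is what remains of its square \<open>|a|\<^sub>m\<^sup>2\<close> after the factor \<open>1 / |a|\<^sub>m\<close> from the squared atom.
\<close>

lemma mfrwt_nn_slice:
  assumes a: "a \<in> R0" and f: "f \<in> L12"
  defines "g \<equiv> \<lambda>t. f t * chirp \<alpha> (lam\<^sup>2) t"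
  shows "(\<integral>\<^sup>+b. ennreal ((cmod (mfrwt \<alpha> lam \<psi> f a b))\<^sup>2) \<partial>lborel) =
    ennreal (\<kappa> * abs_m a) *
    (\<integral>\<^sup>+\<eta>. ennreal ((cmod (fourier g \<eta>))\<^sup>2) * ennreal ((cmod (H (dil a \<eta>)))\<^sup>2) \<partial>lborel)"
proof -
  have fm[measurable]: "f \<in> borel_measurable borel" using f by (rule L12D)
  have pos: "abs_m a > 0" by (rule abs_m_pos[OF a])
  have g: "g \<in> L12" unfolding g_def by (rule chirp_L12(1)[OF f])
  then have gm[measurable]: "g \<in> borel_measurable borel" by (rule L12D)
  let ?h = "\<lambda>x. chirped (vec_divide x a)"
  let ?H = "\<lambda>\<eta>. abs_m a * H (dil a \<eta>)"
  have tr: "trunc n chirped \<in> L12" for n by (rule trunc_L12[OF chirped_L2(1)])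
  have F: "fourier (trunc n chirped) \<in> L2 lborel" for n by (rule plancherel(1)[OF tr])
  have HL: "?H \<in> L2 lborel" by (intro L2_cmult L2_dil(1) a H_L2)
  have l1: "(\<lambda>n. normsq lborel (\<lambda>x. trunc n chirped (vec_divide x a) - ?h x)) \<longlonglongrightarrow> 0"
    using L2_vec_divide(2)[OF a L2_diff[OF L12D(2)[OF tr] chirped_L2(1)]]
      tendsto_mult_right_zero[OF trunc_L2_tendsto[OF chirped_L2(1)], of "abs_m a"] by simp
  have l2: "(\<lambda>n. normsq lborel (\<lambda>x. fourier (\<lambda>x. trunc n chirped (vec_divide x a)) x - ?H x)) \<longlonglongrightarrow> 0"
  proof -
    have "normsq lborel (\<lambda>x. fourier (\<lambda>x. trunc n chirped (vec_divide x a)) x - ?H x)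
      = (abs_m a)\<^sup>2 * (normsq lborel (\<lambda>x. fourier (trunc n chirped) x - H x) / abs_m a)" for n
    proof -
      have "(\<lambda>x. fourier (\<lambda>x. trunc n chirped (vec_divide x a)) x - ?H x)
          = (\<lambda>x. abs_m a * (fourier (trunc n chirped) (dil a x) - H (dil a x)))"
        by (simp add: fourier_vec_divide[OF a L12D(3)[OF tr]] right_diff_distrib)
      then show ?thesis
        using L2_dil(2)[OF a L2_diff[OF F H_L2], of n] by (simp add: normsq_cmult)
    qed
    moreover have "(\<lambda>n. (abs_m a)\<^sup>2 * (normsq lborel (\<lambda>x. fourier (trunc n chirped) x - H x) / abs_m a)) \<longlonglongrightarrow> (abs_m a)\<^sup>2 * (0 / abs_m a)"
      by (intro tendsto_intros H_lim) (use pos in auto)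
    ultimately show ?thesis by simp
  qed
  note corr = corr_normsq[OF g L2_vec_divide(1)[OF a chirped_L2(1)] L12_vec_divide[OF a tr] l1 HL l2]
  have gH: "(\<lambda>\<xi>. fourier g \<xi> * cnj (?H \<xi>)) \<in> L2 lborel"
  proof (rule L2_bound(1)[OF HL, where c="\<integral>x. cmod (g x) \<partial>lborel"])
    show "cmod (fourier g x * cnj (?H x)) \<le> (\<integral>x. cmod (g x) \<partial>lborel) * cmod (?H x)" for x
      unfolding norm_mult complex_mod_cnj by (intro mult_right_mono fourier_bound L12D g) auto
  qed simp
  have cc: "(cmod (mfrwt \<alpha> lam \<psi> f a b))\<^sup>2 = (cmod (c_coef \<alpha>))\<^sup>2 / abs_m a * (cmod (corr g ?h b))\<^sup>2" for b
    unfolding mfrwt_eq_corr[OF a fm] g_def[symmetric] using pos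
    by (simp add: norm_mult norm_divide power_mult_distrib power_divide)
  have "(\<integral>\<^sup>+b. ennreal ((cmod (mfrwt \<alpha> lam \<psi> f a b))\<^sup>2) \<partial>lborel)
      = (\<integral>\<^sup>+b. ennreal ((cmod (c_coef \<alpha>))\<^sup>2 / abs_m a) * ennreal ((cmod (corr g ?h b))\<^sup>2) \<partial>lborel)"
    unfolding cc by (intro nn_integral_cong ennreal_mult) auto
  also have "\<dots> = ennreal ((cmod (c_coef \<alpha>))\<^sup>2 / abs_m a) * ennreal (normsq lborel (corr g ?h))"
    using L2_measurable[OF corr(1)] by (subst nn_integral_cmult) (auto simp: nn_integral_eq_normsq[OF corr(1)])
  also have "\<dots> = ennreal (\<kappa> / abs_m a) * ennreal (normsq lborel (\<lambda>\<xi>. fourier g \<xi> * cnj (?H \<xi>)))"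
    unfolding corr(2)[symmetric] using pos by (simp add: ennreal_mult[symmetric])
  also have "ennreal (normsq lborel (\<lambda>\<xi>. fourier g \<xi> * cnj (?H \<xi>)))
     = (\<integral>\<^sup>+\<xi>. ennreal ((cmod (fourier g \<xi> * cnj (?H \<xi>)))\<^sup>2) \<partial>lborel)"
    by (rule nn_integral_eq_normsq[OF gH, symmetric])
  also have "\<dots> = (\<integral>\<^sup>+\<eta>. ennreal ((abs_m a)\<^sup>2) * (ennreal ((cmod (fourier g \<eta>))\<^sup>2) * ennreal ((cmod (H (dil a \<eta>)))\<^sup>2)) \<partial>lborel)"
    by (intro nn_integral_cong) (simp add: ennreal_mult[symmetric] norm_mult power_mult_distrib mult_ac)
  also have "\<dots> = ennreal ((abs_m a)\<^sup>2) * (\<integral>\<^sup>+\<eta>. ennreal ((cmod (fourier g \<eta>))\<^sup>2) * ennreal ((cmod (H (dil a \<eta>)))\<^sup>2) \<partial>lborel)"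
    by (rule nn_integral_cmult) measurable
  finally show ?thesis
    using pos by (simp add: mult.assoc[symmetric] ennreal_mult[symmetric] power2_eq_square)
qed

text \<open>
  The measure \<open>da db / |a|\<^sub>m\<^sup>2\<close> on Borel sets, whose completion is \<^const>\<open>phase_measure\<close>.
\<close>

definition P :: "((real ^ 'n) \<times> (real ^ 'n)) measure" where
  "P = density lborel (\<lambda>(a, b). ennreal (1 / (abs_m a)\<^sup>2))"

definition atom :: "(real ^ 'n) \<times> (real ^ 'n) \<Rightarrow> real ^ 'n \<Rightarrow> complex" where
  "atom p t = wavelet_atom \<alpha> lam \<psi> (fst p) (snd p) t"

lemma sets_P [measurable_cong, simp]: "sets P = sets (borel \<Otimes>\<^sub>M borel)" "space P = UNIV"
  unfolding borel_prod by (simp_all add: P_def)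

lemma atom_eq: "atom p t = cnj (c_coef \<alpha>) * chirp \<alpha> (lam\<^sup>2) (snd p) * chirp \<alpha> (- (lam\<^sup>2)) t *
   complex_of_real (1 / sqrt (abs_m (fst p))) * chirped (vec_divide (t - snd p) (fst p))"
  by (simp add: atom_def wavelet_atom_def chirped_def)

lemma atom_measurable: "case_prod atom \<in> borel_measurable (P \<Otimes>\<^sub>M lborel)"
  unfolding case_prod_beta' atom_eq by measurable

lemma atom_measurable' [measurable]: "atom p \<in> borel_measurable borel"
  unfolding atom_eq[abs_def] by measurable

lemma mfrwt_ip:
  assumes [measurable]: "f \<in> borel_measurable borel"
  shows "mfrwt \<alpha> lam \<psi> f (fst p) (snd p) = ip lborel f (atom p)"
  unfolding mfrwt_def ip_def atom_def[symmetric]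
  by (subst integral_completion) (auto simp: measurable_completion)

text \<open>
  The normalization by \<open>sqrt |a|\<^sub>m\<close> makes the norm independent of the parameters. On the excluded set
  \<open>|a|\<^sub>m = 0\<close> the convention \<open>1 / 0 = 0\<close> makes the atom vanish, so no parameter is an exception.
\<close>

lemma atom_L2: "atom p \<in> L2 lborel" and atom_normsq: "normsq lborel (atom p) \<le> (cmod (c_coef \<alpha>))\<^sup>2 * normsq lborel \<psi>"
proof -
  have "atom p \<in> L2 lborel \<and> normsq lborel (atom p) \<le> (cmod (c_coef \<alpha>))\<^sup>2 * normsq lborel \<psi>"
  proof (cases "fst p \<in> R0")
    case True
    let ?a = "fst p" and ?b = "snd p"
    have pos: "abs_m ?a > 0" by (rule abs_m_pos[OF True])
    let ?u = "\<lambda>t. chirped (vec_divide (t - ?b) ?a)"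
    have u: "?u \<in> L2 lborel" "normsq lborel ?u = abs_m ?a * normsq lborel chirped"
      using L2_translate[OF L2_vec_divide(1)[OF True chirped_L2(1)], of ?b] L2_vec_divide(2)[OF True chirped_L2(1)] by auto
    let ?v = "\<lambda>t. complex_of_real (1 / sqrt (abs_m ?a)) * c_coef \<alpha> * ?u t"
    have v: "?v \<in> L2 lborel" by (intro L2_cmult u)
    have eq: "cmod (atom p t) = cmod (?v t)" for t
      by (simp add: atom_eq norm_mult norm_divide)
    have "normsq lborel ?v = (cmod (complex_of_real (1 / sqrt (abs_m ?a)) * c_coef \<alpha>))\<^sup>2 * normsq lborel ?u"
      by (rule normsq_cmult)
    also have "(cmod (complex_of_real (1 / sqrt (abs_m ?a)) * c_coef \<alpha>))\<^sup>2 = (cmod (c_coef \<alpha>))\<^sup>2 / abs_m ?a"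
      using pos by (simp add: norm_mult norm_divide power_divide)
    finally have "normsq lborel ?v = (cmod (c_coef \<alpha>))\<^sup>2 * normsq lborel \<psi>"
      using pos by (simp add: u chirped_L2)
    then show ?thesis
      using L2_same_modulus[OF v, of "atom p"] eq by auto
  next
    case False
    then have "atom p = (\<lambda>t. 0)" by (auto simp: atom_eq R0_def fun_eq_iff)
    then show ?thesis by (simp add: L2_zero) (simp add: normsq_def)
  qed
  then show "atom p \<in> L2 lborel" "normsq lborel (atom p) \<le> (cmod (c_coef \<alpha>))\<^sup>2 * normsq lborel \<psi>" by auto
qed

lemma V_measurable [measurable]:
  assumes [measurable]: "f \<in> borel_measurable borel"
  shows "(\<lambda>p. ip lborel f (atom p)) \<in> borel_measurable (borel \<Otimes>\<^sub>M borel)"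
proof -
  note atom_measurable[unfolded measurable_cong_sets[OF sets_pair_measure_cong[OF sets_P(1) refl] refl], measurable]
  show ?thesis unfolding ip_def by measurable
qed

lemma nn_integral_P:
  assumes [measurable]: "F \<in> borel_measurable (borel \<Otimes>\<^sub>M borel)"
  shows "(\<integral>\<^sup>+p. F p \<partial>P) = (\<integral>\<^sup>+a. \<integral>\<^sup>+b. ennreal (1 / (abs_m a)\<^sup>2) * F (a, b) \<partial>lborel \<partial>lborel)"
proof -
  have "(\<integral>\<^sup>+p. F p \<partial>P) = (\<integral>\<^sup>+p. (case p of (a, b) \<Rightarrow> ennreal (1 / (abs_m a)\<^sup>2)) * F p \<partial>lborel)"
    unfolding P_def by (rule nn_integral_density) (auto simp: borel_prod[symmetric])
  also have "\<dots> = (\<integral>\<^sup>+a. \<integral>\<^sup>+b. ennreal (1 / (abs_m a)\<^sup>2) * F (a, b) \<partial>lborel \<partial>lborel)"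
    unfolding lborel_prod[symmetric] by (subst lborel.nn_integral_fst[symmetric]) auto
  finally show ?thesis .
qed

text \<open>
  Combine \<open>mfrwt_nn_slice\<close> with the density \<open>1 / |a|\<^sub>m\<^sup>2\<close>, which leaves \<open>da / |a|\<^sub>m\<close>, and integrate in \<open>a\<close>
  first. For \<open>\<eta>\<close> without zero components the inner integral is the constant \<open>A\<close> by scale invariance.
\<close>

lemma isometry_L12:
  assumes f: "f \<in> L12"
  shows "(\<lambda>p. ip lborel f (atom p)) \<in> L2 P" "normsq P (\<lambda>p. ip lborel f (atom p)) = C * normsq lborel f"
proof -
  let ?V = "\<lambda>p. ip lborel f (atom p)"
  define g where "g = (\<lambda>t. f t * chirp \<alpha> (lam\<^sup>2) t)"
  have fm[measurable]: "f \<in> borel_measurable borel" using f by (rule L12D)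
  have g: "g \<in> L12" and gf: "normsq lborel g = normsq lborel f"
    unfolding g_def by (rule chirp_L12[OF f])+
  have gm[measurable]: "g \<in> borel_measurable borel" using g by (rule L12D)
  let ?G = "\<lambda>\<eta>. ennreal ((cmod (fourier g \<eta>))\<^sup>2)" and ?H = "\<lambda>u. ennreal ((cmod (H u))\<^sup>2)"
  have "(\<integral>\<^sup>+p. ennreal ((cmod (?V p))\<^sup>2) \<partial>P)
      = (\<integral>\<^sup>+a. \<integral>\<^sup>+b. ennreal (1 / (abs_m a)\<^sup>2) * ennreal ((cmod (?V (a, b)))\<^sup>2) \<partial>lborel \<partial>lborel)"
    by (rule nn_integral_P) measurable
  also have "\<dots> = (\<integral>\<^sup>+a. \<integral>\<^sup>+\<eta>. ennreal \<kappa> * (?G \<eta> * (?H (dil a \<eta>) * ennreal (1 / abs_m a))) \<partial>lborel \<partial>lborel)"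
  proof (rule nn_integral_cong_AE, use AE_R0 in eventually_elim)
    fix a :: "real ^ 'n" assume a: "a \<in> R0"
    have pos: "abs_m a > 0" by (rule abs_m_pos[OF a])
    have "(\<integral>\<^sup>+b. ennreal (1 / (abs_m a)\<^sup>2) * ennreal ((cmod (?V (a, b)))\<^sup>2) \<partial>lborel)
        = ennreal (1 / (abs_m a)\<^sup>2) * (\<integral>\<^sup>+b. ennreal ((cmod (mfrwt \<alpha> lam \<psi> f a b))\<^sup>2) \<partial>lborel)"
      using mfrwt_ip[OF fm, of "(a, _)"] by (subst nn_integral_cmult) auto
    also have "\<dots> = ennreal (\<kappa> * (1 / abs_m a)) * (\<integral>\<^sup>+\<eta>. ?G \<eta> * ?H (dil a \<eta>) \<partial>lborel)"
    proof -
      have "ennreal (1 / (abs_m a)\<^sup>2) * ennreal (\<kappa> * abs_m a) = ennreal (\<kappa> * (1 / abs_m a))"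
        using pos by (subst ennreal_mult[symmetric]) (auto simp: field_simps power2_eq_square)
      then show ?thesis
        unfolding mfrwt_nn_slice[OF a f] g_def[symmetric] mult.assoc[symmetric] by (simp only:)
    qed
    also have "\<dots> = (\<integral>\<^sup>+\<eta>. ennreal (\<kappa> * (1 / abs_m a)) * (?G \<eta> * ?H (dil a \<eta>)) \<partial>lborel)"
      by (rule nn_integral_cmult[symmetric]) measurable
    also have "ennreal (\<kappa> * (1 / abs_m a)) = ennreal \<kappa> * ennreal (1 / abs_m a)"
      using pos by (intro ennreal_mult) auto
    finally show "(\<integral>\<^sup>+b. ennreal (1 / (abs_m a)\<^sup>2) * ennreal ((cmod (?V (a, b)))\<^sup>2) \<partial>lborel)
        = (\<integral>\<^sup>+\<eta>. ennreal \<kappa> * (?G \<eta> * (?H (dil a \<eta>) * ennreal (1 / abs_m a))) \<partial>lborel)"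
      by (simp only: mult_ac)
  qed
  also have "\<dots> = (\<integral>\<^sup>+\<eta>. \<integral>\<^sup>+a. ennreal \<kappa> * (?G \<eta> * (?H (dil a \<eta>) * ennreal (1 / abs_m a))) \<partial>lborel \<partial>lborel)"
    by (rule lborel_pair.Fubini') measurable
  also have "\<dots> = (\<integral>\<^sup>+\<eta>. ennreal \<kappa> * (?G \<eta> * A) \<partial>lborel)"
  proof (rule nn_integral_cong_AE, use AE_R0 in eventually_elim)
    fix \<eta> :: "real ^ 'n" assume \<eta>: "\<eta> \<in> R0"
    have "(\<integral>\<^sup>+a. ?H (dil a \<eta>) * ennreal (1 / abs_m a) \<partial>lborel) = A"
      unfolding A_def dil_commute[of _ \<eta>] by (rule nn_integral_scale_invariant[OF _ \<eta>]) measurable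
    then show "(\<integral>\<^sup>+a. ennreal \<kappa> * (?G \<eta> * (?H (dil a \<eta>) * ennreal (1 / abs_m a))) \<partial>lborel) = ennreal \<kappa> * (?G \<eta> * A)"
      by (simp add: nn_integral_cmult)
  qed
  also have "\<dots> = ennreal \<kappa> * A * ennreal ((2 * pi) ^ CARD('n) * normsq lborel g)"
    using nn_integral_eq_normsq[OF plancherel(1)[OF g]] plancherel(2)[OF g]
    by (simp add: nn_integral_cmult nn_integral_multc mult_ac)
  also have "\<dots> = ennreal (\<kappa> * (2 * pi) ^ CARD('n)) * A * ennreal (normsq lborel f)"
  proof -
    have "ennreal ((2 * pi) ^ CARD('n) * normsq lborel f) = ennreal ((2 * pi) ^ CARD('n)) * ennreal (normsq lborel f)"
      "ennreal (\<kappa> * (2 * pi) ^ CARD('n)) = ennreal \<kappa> * ennreal ((2 * pi) ^ CARD('n))"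
      by (rule ennreal_mult; simp)+
    then show ?thesis unfolding gf by (simp only: mult_ac)
  qed
  also have "ennreal (\<kappa> * (2 * pi) ^ CARD('n)) * A = ennreal C"
    unfolding C_A by simp
  also have "ennreal C * ennreal (normsq lborel f) = ennreal (C * normsq lborel f)"
    using C_pos by (simp add: ennreal_mult)
  finally have eq: "(\<integral>\<^sup>+p. ennreal ((cmod (?V p))\<^sup>2) \<partial>P) = ennreal (C * normsq lborel f)" .
  show 1: "?V \<in> L2 P" by (simp add: L2_iff_nn eq)
  show "normsq P ?V = C * normsq lborel f"
    using eq nn_integral_eq_normsq[OF 1] C_pos by simp
qed

text \<open>
  Approximate \<open>f\<close> by truncations: the transforms converge at every parameter, and by \<open>isometry_L12\<close> for
  differences they form a Cauchy sequence.
\<close>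

lemma isometry:
  assumes f: "f \<in> L2 lborel"
  shows "(\<lambda>p. ip lborel f (atom p)) \<in> L2 P" "normsq P (\<lambda>p. ip lborel f (atom p)) = C * normsq lborel f"
proof -
  let ?V = "\<lambda>f p. ip lborel f (atom p)"
  have [measurable]: "f \<in> borel_measurable borel" using f by (simp add: L2_def)
  have T: "trunc n f \<in> L12" for n by (rule trunc_L12[OF f])
  have c: "L2_Cauchy lborel (\<lambda>n. trunc n f)"
    by (rule L2_tendsto_Cauchy[OF L12D(2)[OF T] f trunc_L2_tendsto[OF f]])
  have eq: "normsq P (\<lambda>p. ?V (trunc m f) p - ?V (trunc n f) p) = C * normsq lborel (\<lambda>x. trunc m f x - trunc n f x)" for m n
    using isometry_L12(2)[OF L12_diff[OF T T], of m n]
    by (simp add: ip_diff_left[OF L12D(2)[OF T] L12D(2)[OF T] atom_L2])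
  have cauchy: "L2_Cauchy P (\<lambda>n. ?V (trunc n f))"
    unfolding L2_Cauchy_def
  proof (intro conjI allI impI isometry_L12(1) T)
    fix e :: real assume "e > 0"
    then have "e / C > 0" using C_pos by simp
    then obtain N where "\<forall>m\<ge>N. \<forall>n\<ge>N. normsq lborel (\<lambda>x. trunc m f x - trunc n f x) < e / C"
      using c unfolding L2_Cauchy_def by blast
    then show "\<exists>N. \<forall>m\<ge>N. \<forall>n\<ge>N. normsq P (\<lambda>p. ?V (trunc m f) p - ?V (trunc n f) p) < e"
      unfolding eq using C_pos by (auto simp: pos_less_divide_eq mult.commute)
  qed
  have ptw: "(\<lambda>n. ?V (trunc n f) p) \<longlonglongrightarrow> ?V f p" for p
  proof (rule LIM_zero_cancel, rule Lim_null_comparison)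
    have "(cmod (?V (trunc n f) p - ?V f p))\<^sup>2 \<le> normsq lborel (\<lambda>x. trunc n f x - f x) * normsq lborel (atom p)" for n
      using L2_Cauchy_Schwarz[OF L2_diff[OF L12D(2)[OF T[of n]] f] atom_L2[of p]]
      by (simp only: ip_diff_left[OF L12D(2)[OF T] f atom_L2])
    then show "\<forall>\<^sub>F n in sequentially. norm (?V (trunc n f) p - ?V f p) \<le> sqrt (normsq lborel (\<lambda>x. trunc n f x - f x) * normsq lborel (atom p))"
      by (intro always_eventually allI real_le_rsqrt)
    show "(\<lambda>n. sqrt (normsq lborel (\<lambda>x. trunc n f x - f x) * normsq lborel (atom p))) \<longlonglongrightarrow> 0"
      using tendsto_real_sqrt[OF tendsto_mult_left_zero[OF trunc_L2_tendsto[OF f], of "normsq lborel (atom p)"]] by simp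
  qed
  have ae: "AE p in P. (\<lambda>n. ?V (trunc (id n) f) p) \<longlonglongrightarrow> ?V f p"
    using ptw by simp
  have meas: "?V f \<in> borel_measurable P" by measurable
  note L = L2_Cauchy_limit[OF cauchy meas strict_mono_id ae]
  show "?V f \<in> L2 P" by (rule L(1))
  have "(\<lambda>n. normsq P (?V (trunc n f))) \<longlonglongrightarrow> normsq P (?V f)"
    by (intro normsq_tendsto isometry_L12(1) T L)
  moreover have "(\<lambda>n. C * normsq lborel (trunc n f)) \<longlonglongrightarrow> C * normsq lborel f"
    by (intro tendsto_intros normsq_tendsto L12D(2) T f trunc_L2_tendsto)
  ultimately show "normsq P (?V f) = C * normsq lborel f"
    unfolding isometry_L12(2)[OF T] by (rule LIMSEQ_unique)
qed

lemma sigma_finite_P: "sigma_finite_measure P"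
  unfolding P_def by (subst sigma_finite_measure.sigma_finite_iff_density_finite[OF sigma_finite_lborel]) (auto simp: borel_prod[symmetric])

sublocale frame: tight_frame P lborel atom "(cmod (c_coef \<alpha>))\<^sup>2 * normsq lborel \<psi>" C
proof -
  interpret P: sigma_finite_measure P by (rule sigma_finite_P)
  show "tight_frame P lborel atom ((cmod (c_coef \<alpha>))\<^sup>2 * normsq lborel \<psi>) C"
    by unfold_locales (fact atom_measurable atom_L2 atom_normsq C_pos isometry)+
qed

text \<open>
  Completing the measure commutes with taking the density because the density is positive almost
  everywhere.
\<close>

lemma phase_measure_eq: "phase_measure = completion P"
  and AE_P: "(AE p in lborel. Q p) \<Longrightarrow> (AE p in P. Q p)"
  and AE_phase_space: "AE p in P. p \<in> phase_space"
proof -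
  have m: "(\<lambda>(a, b). ennreal (1 / (abs_m a)\<^sup>2)) \<in> borel_measurable (lborel :: ((real ^ 'n) \<times> (real ^ 'n)) measure)"
    by (simp add: borel_prod[symmetric])
  have ps: "{p \<in> space (lborel \<Otimes>\<^sub>M lborel). p \<in> phase_space} \<in> sets (lborel \<Otimes>\<^sub>M lborel)"
    unfolding phase_space_def mem_Times_iff by measurable
  have "AE a in lborel. AE b in lborel. (a :: real ^ 'n, b :: real ^ 'n) \<in> phase_space"
    using AE_R0 by eventually_elim (simp add: phase_space_def)
  then have "AE p in lborel \<Otimes>\<^sub>M lborel. p \<in> (phase_space :: ((real ^ 'n) \<times> (real ^ 'n)) set)"
    using lborel_pair.AE_pair_measure[OF ps] by blast
  then have ae: "AE p in lborel. p \<in> (phase_space :: ((real ^ 'n) \<times> (real ^ 'n)) set)"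
    unfolding lborel_prod .
  then have "AE p in lborel. 0 < (case p of (a :: real ^ 'n, b :: real ^ 'n) \<Rightarrow> ennreal (1 / (abs_m a)\<^sup>2))"
    by eventually_elim (auto simp: phase_space_def dest!: abs_m_pos)
  from completion_density_eq[OF this m] show "phase_measure = completion P"
    unfolding phase_measure_def P_def ..
  show AE: "(AE p in P. Q p)" if "AE p in lborel. Q p" for Q
    unfolding P_def by (subst AE_density[OF m]) (use that in \<open>auto elim: eventually_mono\<close>)
  show "AE p in P. p \<in> phase_space" by (rule AE[OF ae])
qed

end

section \<open>The reconstruction formula\<close>

lemma AE_vec_divide:
  fixes a b :: "real ^ 'n::finite"
  assumes a: "a \<in> R0" and ae: "AE x in lborel. Q x"
  shows "AE t in lborel. Q (vec_divide (t - b) a)" "AE t in lborel. Q (vec_divide (b - t) a)"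
proof -
  let ?i = "\<chi> k. 1 / a $ k" and ?j = "\<chi> k. - 1 / a $ k"
  have i: "?i \<in> R0" "?j \<in> R0" using a by (auto simp: R0_iff)
  have "(\<lambda>t. vec_divide (t - b) a) = (\<lambda>t. - vec_divide b a + dil ?i t)"
    "(\<lambda>t. vec_divide (b - t) a) = (\<lambda>t. vec_divide b a + dil ?j t)"
    by (auto simp: fun_eq_iff vec_divide_def dil_def vec_eq_iff diff_divide_distrib)
  then show "AE t in lborel. Q (vec_divide (t - b) a)" "AE t in lborel. Q (vec_divide (b - t) a)"
    using AE_affine[OF abs_m_pos[OF i(1)] dil_affine_measurable[OF i(1)] lborel_dil[OF i(1)] ae, of "- vec_divide b a"]
      AE_affine[OF abs_m_pos[OF i(2)] dil_affine_measurable[OF i(2)] lborel_dil[OF i(2)] ae, of "vec_divide b a"]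
    by (simp_all add: fun_eq_iff)
qed

lemma atom_zero: "a \<notin> R0 \<Longrightarrow> wavelet_atom \<alpha> lam \<psi> a b t = 0"
  by (simp add: wavelet_atom_def R0_def)

text \<open>
  For fixed parameters the atoms of two representatives of the wavelet agree at almost every \<open>t\<close>, and
  for fixed \<open>t\<close> (\<open>atom_AE_ab\<close>) they agree at almost all parameters. The wavelet transform requires the
  former, the integrals of the reconstruction formula the latter.
\<close>

lemma atom_AE_t:
  assumes "AE x in lborel. \<psi> x = \<psi>' x"
  shows "AE t in lborel. wavelet_atom \<alpha> lam \<psi> a b t = wavelet_atom \<alpha> lam \<psi>' a b t"
proof (cases "a \<in> R0")
  case True
  show ?thesis
    using AE_vec_divide(1)[OF True assms, of b] by eventually_elim (simp add: wavelet_atom_def)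
qed (simp add: atom_zero)

text \<open>
  For each admissible \<open>a\<close> the map \<open>b \<mapsto> (t - b) / a\<close> pulls null sets back to null sets. Fubini's theorem
  is applied to a Borel null set that contains the exceptional points.
\<close>

lemma atom_AE_ab:
  fixes \<psi> \<psi>' :: "real ^ 'n::finite \<Rightarrow> complex"
  assumes ae: "AE x in lborel. \<psi> x = \<psi>' x"
  shows "AE p in lborel. wavelet_atom \<alpha> lam \<psi> (fst p) (snd p) t = wavelet_atom \<alpha> lam \<psi>' (fst p) (snd p) t"
proof -
  from ae obtain N where N: "{x \<in> space lborel. \<psi> x \<noteq> \<psi>' x} \<subseteq> N" "emeasure lborel N = 0" "N \<in> sets lborel"
    by (rule AE_E)
  have Nm[measurable]: "N \<in> sets borel" using N by simp
  have aeN: "AE x in lborel. x \<notin> N" using N by (intro AE_not_in) auto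
  have "AE a in lborel. AE b in lborel. vec_divide (t - snd (a :: real ^ 'n, b)) (fst (a, b)) \<notin> N"
    using AE_R0 by eventually_elim (use AE_vec_divide(2)[OF _ aeN] in simp)
  then have "AE p in lborel \<Otimes>\<^sub>M lborel. vec_divide (t - snd (p :: (real ^ 'n) \<times> (real ^ 'n))) (fst p) \<notin> N"
    by (intro lborel_pair.AE_pair_measure) measurable
  then have "AE p in lborel. vec_divide (t - snd (p :: (real ^ 'n) \<times> (real ^ 'n))) (fst p) \<notin> N"
    unfolding lborel_prod .
  then show ?thesis
    by eventually_elim (use N in \<open>auto simp: wavelet_atom_def\<close>)
qed

theorem theorem3p3:
  fixes \<alpha> :: "real ^ 'n::finite" and lam :: real
    and f \<psi> :: "real ^ 'n \<Rightarrow> complex"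
  assumes "lam \<noteq> 0"
    and "\<And>k. \<alpha> $ k \<in> {- pi<..<pi} - {0}"
    and "square_integrable f"
    and "wavelet_admissible \<alpha> lam \<psi>"
    and "wavelet_const \<alpha> lam \<psi> \<noteq> 0"
  shows "recon_weak \<alpha> lam \<psi> f \<and> recon_norm \<alpha> lam \<psi> f \<and> recon_ae \<alpha> lam \<psi> f"
proof -
  let ?I = "recon_integrand \<alpha> lam \<psi> f"
  let ?R = "recon \<alpha> lam \<psi> f"
  have f: "f \<in> L2 lebesgue" and \<psi>: "\<psi> \<in> L2 lebesgue"
    using assms by (auto simp: square_integrable_iff wavelet_admissible_def)
  obtain f' where f': "f' \<in> L2 lborel" "AE x in lborel. f x = f' x" and f'm[measurable]: "f' \<in> borel_measurable borel"
    using L2_lebesgue_representative[OF f] by blast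
  obtain \<psi>' where \<psi>': "\<psi>' \<in> L2 lborel" "AE x in lborel. \<psi> x = \<psi>' x" and \<psi>'m[measurable]: "\<psi>' \<in> borel_measurable borel"
    using L2_lebesgue_representative[OF \<psi>] by blast
  \<comment> \<open>The truncated transforms are integrals, hence they do not distinguish representatives at any point.\<close>
  have "mfrft_trunc \<alpha> lam \<psi> = mfrft_trunc \<alpha> lam \<psi>'"
  proof (intro ext)
    fix n \<xi>
    have k: "(\<lambda>x. mfrft_kernel \<alpha> lam x \<xi>) \<in> borel_measurable lborel"
      unfolding mfrft_kernel_def by measurable
    let ?F = "\<lambda>\<psi> x. indicator (cball 0 (real n)) x *\<^sub>R (\<psi> x * mfrft_kernel \<alpha> lam x \<xi>)"
    have F: "?F \<psi>' \<in> borel_measurable lborel"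
      using \<psi>'m by (intro borel_measurable_scaleR borel_measurable_times k borel_measurable_indicator) simp_all
    have "integral\<^sup>L lebesgue (?F \<psi>) = integral\<^sup>L lborel (?F \<psi>')"
    proof (rule completion_cong_AE(3))
      show "?F \<psi>' \<in> borel_measurable lborel" by (rule F)
      show "AE x in lborel. ?F \<psi> x = ?F \<psi>' x"
        using \<psi>'(2) by eventually_elim simp
    qed
    also have "\<dots> = integral\<^sup>L lebesgue (?F \<psi>')"
      by (rule integral_completion[symmetric, OF F])
    finally show "mfrft_trunc \<alpha> lam \<psi> n \<xi> = mfrft_trunc \<alpha> lam \<psi>' n \<xi>"
      unfolding mfrft_trunc_def set_lebesgue_integral_def .
  qed
  then have M: "mfrft \<alpha> lam \<psi> = mfrft \<alpha> lam \<psi>'"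
    by (simp add: mfrft_def)
  then have const_eq: "wavelet_const \<alpha> lam \<psi> = wavelet_const \<alpha> lam \<psi>'"
    by (simp add: wavelet_const_def)
  have "sin (\<alpha> $ k) \<noteq> 0" for k
    using assms(2)[of k] sin_gt_zero[of "\<alpha> $ k"] sin_gt_zero[of "- \<alpha> $ k"] by (cases "\<alpha> $ k > 0") auto
  then interpret borel_wavelet \<alpha> lam \<psi>'
    using assms(1,4,5) \<psi>'(1) by unfold_locales (auto simp: wavelet_admissible_def M const_eq)
  have phase: "integrable phase_measure F \<longleftrightarrow> integrable P G" "integral\<^sup>L phase_measure F = integral\<^sup>L P G"
    if "G \<in> borel_measurable P" "AE p in P. F p = G p" for F G :: "(real ^ 'n) \<times> (real ^ 'n) \<Rightarrow> complex"
    unfolding phase_measure_eq using completion_cong_AE[OF that] by auto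
  have atom_borel: "wavelet_atom \<alpha> lam \<psi>' a b \<in> borel_measurable borel" for a b
    using atom_measurable'[of "(a, b)"] by (simp add: atom_def[abs_def])
  have W: "mfrwt \<alpha> lam \<psi> f a b = frame.V f' (a, b)" for a b
  proof -
    have "mfrwt \<alpha> lam \<psi> f a b = (\<integral>t. f' t * cnj (atom (a, b) t) \<partial>lborel)"
      unfolding mfrwt_def
    proof (rule completion_cong_AE(3))
      show "AE t in lborel. f t * cnj (wavelet_atom \<alpha> lam \<psi> a b t) = f' t * cnj (atom (a, b) t)"
        using f'(2) atom_AE_t[OF \<psi>'(2), of \<alpha> lam a b] by eventually_elim (simp add: atom_def)
    qed measurable
    then show ?thesis by (simp add: ip_def)
  qed
  have ip_eq: "l2_inner u g = ip lborel u' g'"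
    if "u' \<in> borel_measurable borel" "AE x in lborel. u x = u' x" "g' \<in> borel_measurable borel" "AE x in lborel. g x = g' x"
    for u u' g g' :: "real ^ 'n \<Rightarrow> complex"
    unfolding l2_inner_def ip_def
  proof (rule completion_cong_AE(3))
    show "AE x in lborel. u x * cnj (g x) = u' x * cnj (g' x)"
      using that(2,4) by eventually_elim simp
  qed (use that in measurable)
  have Vm[measurable]: "frame.V f' \<in> borel_measurable P"
    by (rule L2_measurable[OF frame.analysis_L2[OF f'(1)]])
  have weak: "recon_weak \<alpha> lam \<psi> f"
    unfolding recon_weak_def
  proof (intro allI impI)
    fix g :: "real ^ 'n \<Rightarrow> complex" assume "square_integrable g"
    then have g: "g \<in> L2 lebesgue" by (simp add: square_integrable_iff)
    obtain g' where g': "g' \<in> L2 lborel" "AE x in lborel. g x = g' x" "g' \<in> borel_measurable borel"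
      using L2_lebesgue_representative[OF g] by blast
    let ?F = "\<lambda>(a, b). mfrwt \<alpha> lam \<psi> f a b * l2_inner (wavelet_atom \<alpha> lam \<psi> a b) g"
    let ?G = "\<lambda>p. frame.V f' p * ip lborel (atom p) g'"
    have A: "l2_inner (wavelet_atom \<alpha> lam \<psi> a b) g = ip lborel (atom (a, b)) g'" for a b
    proof (rule ip_eq)
      show "AE t in lborel. wavelet_atom \<alpha> lam \<psi> a b t = atom (a, b) t"
        using atom_AE_t[OF \<psi>'(2), of \<alpha> lam a b] by (simp add: atom_def)
    qed (use g' in auto)
    have "AE p in P. indicator phase_space p *\<^sub>R ?F p = ?G p"
      using AE_phase_space by eventually_elim (auto simp: W A)
    note ph = phase[OF borel_measurable_integrable[OF frame.weak_reconstruction(1)[OF f'(1) g'(1)]] this]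
    have I: "set_integrable phase_measure phase_space ?F"
      unfolding set_integrable_def ph(1) by (rule frame.weak_reconstruction(1)[OF f'(1) g'(1)])
    have "(LINT p:phase_space|phase_measure. ?F p) = C * ip lborel f' g'"
      unfolding set_lebesgue_integral_def ph(2) by (rule frame.weak_reconstruction(2)[OF f'(1) g'(1)])
    then have "l2_inner f g = complex_of_real (1 / wavelet_const \<alpha> lam \<psi>) * (LINT p:phase_space|phase_measure. ?F p)"
      using C_pos ip_eq[OF f'm f'(2) g'(3,2)] by (simp add: const_eq C_def)
    with I show "set_integrable phase_measure phase_space ?F \<and>
        l2_inner f g = complex_of_real (1 / wavelet_const \<alpha> lam \<psi>) * (LINT p:phase_space|phase_measure. ?F p)"
      by blast
  qed
  have recon_AE: "AE p in P. ?I t p = frame.V f' p * atom p t" for t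
    using AE_P[OF atom_AE_ab[OF \<psi>'(2), of \<alpha> lam t]]
    by eventually_elim (simp add: recon_integrand_def case_prod_beta' W atom_def)
  have atom_t[measurable]: "(\<lambda>p. atom p t) \<in> borel_measurable P" for t
    using measurable_Pair1[OF frame.atom_measurable, of t] by simp
  have ae: "recon_ae \<alpha> lam \<psi> f"
  proof -
    have "AE p in P. indicator phase_space p *\<^sub>R ?I t p = frame.V f' p * atom p t" for t
      using AE_phase_space recon_AE[of t] by eventually_elim simp
    note ph = phase[OF _ this]
    have "AE t in lborel. set_integrable phase_measure phase_space (?I t) \<longrightarrow>
        f t = recon \<alpha> lam \<psi> f phase_space t"
      using frame.pointwise_reconstruction[OF f'(1)] f'(2)
      by eventually_elim (simp add: recon_def set_integrable_def set_lebesgue_integral_def ph const_eq C_def)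
    then show ?thesis unfolding recon_ae_def by (rule AE_completion)
  qed
  have norm: "recon_norm \<alpha> lam \<psi> f"
    unfolding recon_norm_def
  proof (intro allI impI)
    fix K :: "nat \<Rightarrow> ((real ^ 'n) \<times> (real ^ 'n)) set"
    assume K: "\<forall>n. K n \<in> sets lebesgue \<and> emeasure phase_measure (K n) < \<infinity>"
      and inc: "incseq K" and un: "(\<Union>n. K n) = phase_space"
    have "sets (completion P) = sets lebesgue"
      unfolding phase_measure_eq[symmetric] by (simp add: phase_measure_def)
    then have Kc: "K n \<in> sets (completion P)" for n using K by simp
    \<comment> \<open>The sets \<open>K n\<close> are only Lebesgue measurable; they are replaced by Borel sets up to null sets.\<close>
    define K' where "K' n = main_part P (K n)" for n
    have K': "K' n \<in> sets P" for n unfolding K'_def by (rule main_part_sets[OF Kc])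
    have K'f: "emeasure P (K' n) < \<infinity>" for n
      using K[rule_format, of n] emeasure_completion[OF Kc[of n]] unfolding phase_measure_eq K'_def by simp
    have aeK: "AE p in P. p \<in> K n \<longleftrightarrow> p \<in> K' n" for n
      using AE_in_main_part[OF Kc[of n]] by eventually_elim (simp add: K'_def)
    then have "AE p in P. \<forall>n. p \<in> K n \<longleftrightarrow> p \<in> K' n"
      by (simp add: AE_all_countable)
    with AE_phase_space have ev: "AE p in P. \<forall>\<^sub>F n in sequentially. p \<in> K' n"
    proof eventually_elim
      fix p assume "p \<in> phase_space" and eq: "\<forall>n. p \<in> K n \<longleftrightarrow> p \<in> K' n"
      then obtain m where m: "p \<in> K m" using un by blast
      show "\<forall>\<^sub>F n in sequentially. p \<in> K' n"
        using eventually_ge_at_top[of m] by eventually_elim (use m eq incseqD[OF inc, of m] in blast)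
    qed
    let ?S = "\<lambda>n t. 1 / C * frame.synth f' (K' n) t"
    have ph: "set_integrable phase_measure (K n) (?I t) \<longleftrightarrow>
          integrable P (\<lambda>p. indicator (K' n) p * (frame.V f' p * atom p t))"
        "?R (K n) t = ?S n t" for n t
    proof -
      have ae: "AE p in P. indicator (K n) p *\<^sub>R ?I t p
          = indicator (K' n) p * (frame.V f' p * atom p t)"
        using aeK[of n] recon_AE[of t] by eventually_elim (simp split: split_indicator)
      have [measurable]: "K' n \<in> sets P" by (rule K')
      have "(\<lambda>p. indicator (K' n) p * (frame.V f' p * atom p t)) \<in> borel_measurable P" by measurable
      from phase[OF this ae]
      show "set_integrable phase_measure (K n) (?I t) \<longleftrightarrow>
          integrable P (\<lambda>p. indicator (K' n) p * (frame.V f' p * atom p t))"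
        "?R (K n) t = ?S n t"
        by (simp_all add: set_integrable_def recon_def set_lebesgue_integral_def frame.synth_def const_eq C_def)
    qed
    have S: "(\<lambda>t. ?S n t) \<in> L2 lborel" for n
      by (intro L2_cmult frame.synth_L2 f' K' K'f)
    have "normsq lebesgue (\<lambda>t. ?R (K n) t - f t)
        = normsq lborel (\<lambda>t. ?S n t - f' t)" for n
    proof -
      have "normsq lebesgue (\<lambda>t. ?R (K n) t - f t) = normsq lebesgue (\<lambda>t. ?S n t - f' t)"
      proof (rule L2_cong_AE(2))
        show "(\<lambda>t. ?S n t - f' t) \<in> L2 lebesgue"
          by (intro L2_lborel_lebesgue(1) L2_diff S f')
        show "(\<lambda>t. ?R (K n) t - f t) \<in> borel_measurable lebesgue"
          unfolding ph(2) by (intro L2_measurable[OF L2_diff] L2_lborel_lebesgue(1) S f)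
        show "AE t in lebesgue. ?S n t - f' t = ?R (K n) t - f t"
          using AE_completion[OF f'(2)] by eventually_elim (simp add: ph)
      qed
      also have "\<dots> = normsq lborel (\<lambda>t. ?S n t - f' t)"
        by (intro L2_lborel_lebesgue(2) L2_diff S f')
      finally show ?thesis .
    qed
    moreover have "(\<lambda>n. normsq lborel (\<lambda>t. ?S n t - f' t)) \<longlonglongrightarrow> 0"
      by (rule frame.norm_reconstruction[OF f'(1) K' K'f ev])
    moreover have "?R (K n) \<in> L2 lebesgue" for n
      unfolding ph(2)[abs_def] by (rule L2_lborel_lebesgue(1)[OF S])
    ultimately have "l2_tendsto (\<lambda>n. ?R (K n)) f"
      using f by (simp add: l2_tendsto_iff)
    moreover have "AE t in lebesgue. set_integrable phase_measure (K n) (?I t)" for n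
      unfolding ph(1) by (intro AE_completion frame.synth_integrable f' K' K'f)
    ultimately show "(\<forall>n. AE t in lebesgue. set_integrable phase_measure (K n) (?I t)) \<and>
        l2_tendsto (\<lambda>n. ?R (K n)) f"
      by blast
  qed
  from weak norm ae show ?thesis by blast
qed

end
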